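(* Let $a,b,c\ge1$ be integers. There exists a collection of faces of the cone $PKron_{a,b,c}$, with union $U$, such that $SKron_{a,b,c}=Kron_{a,b,c}\cap U$.
   Context: For a partition $\lambda$ of $n$ let $[\lambda]$ be the corresponding irreducible complex representation (Specht module) of $S_n$. For partitions of the same integer, the Kronecker coefficients $g(\lambda,\mu,\nu)$ are defined by $[\lambda]\otimes[\mu]=\bigoplus_\nu g(\lambda,\mu,\nu)[\nu]$, and $g(\lambda,\mu,\nu)=0$ unless $|\lambda|=|\mu|=|\nu|$. The length $\ell(\lambda)$ is the number of non zero parts. $Kron_{a,b,c}$ is the (finitely generated) semigroup of triples of partitions $(\lambda,\mu,\nu)$ with $\ell(\lambda)\le a$, $\ell(\mu)\le b$, $\ell(\nu)\le c$ and $g(\lambda,\mu,\nu)\ne0$. $PKron_{a,b,c}\subset\mathbb R^{a+b+c}$ is the rational polyhedral cone generated by $Kron_{a,b,c}$. A triple $(\lambda,\mu,\nu)$ is weakly stable if $g(k\lambda,k\mu,k\nu)=1$ for all integers $k\ge1$. $SKron_{a,b,c}$ is the set of weakly stable triples in $Kron_{a,b,c}$. *)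

theory Defs
  imports "HOL-Analysis.Analysis"
begin

definition is_partition :: "nat list \<Rightarrow> bool" where
  "is_partition l \<longleftrightarrow> sorted_wrt (\<ge>) l \<and> (\<forall>x\<in>set l. 0 < x)"

definition partitions_of :: "nat \<Rightarrow> nat list set" where
  "partitions_of n = {l. is_partition l \<and> sum_list l = n}"

definition scale_partition :: "nat \<Rightarrow> nat list \<Rightarrow> nat list" where
  "scale_partition k l = map (\<lambda>x. k * x) l"

text \<open>
  The group $S_n$ is the set of all \<open>p\<close> with \<open>p permutes {..<n}\<close>. A representation is given as a
  linear subspace \<open>rep_space\<close> of the functions \<open>'x \<Rightarrow> complex\<close>, stable under the linear action
  induced by an action \<open>pt_act\<close> of $S_n$ on the points of \<open>'x\<close>.
\<close>

record 'x perm_rep =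
  rep_space :: "('x \<Rightarrow> complex) set"
  pt_act :: "(nat \<Rightarrow> nat) \<Rightarrow> 'x \<Rightarrow> 'x"

definition rep_act :: "'x perm_rep \<Rightarrow> (nat \<Rightarrow> nat) \<Rightarrow> ('x \<Rightarrow> complex) \<Rightarrow> ('x \<Rightarrow> complex)" where
  "rep_act V p f = (\<lambda>x. f (pt_act V (inv p) x))"

definition rep_iso :: "nat \<Rightarrow> 'x perm_rep \<Rightarrow> 'y perm_rep \<Rightarrow> bool" where
  "rep_iso n V W \<longleftrightarrow>
    (\<exists>\<phi>. bij_betw \<phi> (rep_space V) (rep_space W) \<and>
      (\<forall>u\<in>rep_space V. \<forall>v\<in>rep_space V. \<phi> (\<lambda>x. u x + v x) = (\<lambda>y. \<phi> u y + \<phi> v y)) \<and>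
      (\<forall>c. \<forall>v\<in>rep_space V. \<phi> (\<lambda>x. c * v x) = (\<lambda>y. c * \<phi> v y)) \<and>
      (\<forall>p. p permutes {..<n} \<longrightarrow> (\<forall>v\<in>rep_space V. \<phi> (rep_act V p v) = rep_act W p (\<phi> v))))"

text \<open>
  The tensor product (with diagonal action) is realised inside the functions on pairs of points,
  \<open>v \<otimes> w\<close> being the function \<open>(x, y) \<mapsto> v x * w y\<close>.
\<close>

definition tensor_rep :: "'x perm_rep \<Rightarrow> 'y perm_rep \<Rightarrow> ('x \<times> 'y) perm_rep" where
  "tensor_rep V W =
    \<lparr>rep_space = {(\<lambda>(x, y). \<Sum>k<m. v k x * w k y) | (m::nat) v w.
       \<forall>k<m. v k \<in> rep_space V \<and> w k \<in> rep_space W},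
     pt_act = (\<lambda>p (x, y). (pt_act V p x, pt_act W p y))\<rparr>"

text \<open>
  The direct sum of \<open>m i\<close> copies of \<open>R i\<close>, for \<open>i\<close> in a finite set \<open>I\<close>: the function
  \<open>x \<mapsto> f (i, k, x)\<close> is the component of \<open>f\<close> in the \<open>k\<close>-th copy of \<open>R i\<close>.
\<close>

definition multiple_sum_rep ::
    "'i set \<Rightarrow> ('i \<Rightarrow> nat) \<Rightarrow> ('i \<Rightarrow> 'x perm_rep) \<Rightarrow> ('i \<times> nat \<times> 'x) perm_rep" where
  "multiple_sum_rep I m R =
    \<lparr>rep_space = {f. \<forall>i k. if i \<in> I \<and> k < m i
       then (\<lambda>x. f (i, k, x)) \<in> rep_space (R i) else (\<forall>x. f (i, k, x) = 0)},
     pt_act = (\<lambda>p (i, k, x). (i, k, pt_act (R i) p x))\<rparr>"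

definition cells :: "nat list \<Rightarrow> (nat \<times> nat) set" where
  "cells l = {(i, j). i < length l \<and> j < l ! i}"

definition tableaux :: "nat list \<Rightarrow> (nat \<times> nat \<Rightarrow> nat) set" where
  "tableaux l = {t \<in> extensional (cells l). bij_betw t (cells l) {..<sum_list l}}"

definition tabloid :: "nat list \<Rightarrow> (nat \<times> nat \<Rightarrow> nat) \<Rightarrow> nat set list" where
  "tabloid l t = map (\<lambda>i. {t (i, j) | j. j < l ! i}) [0..<length l]"

definition column_stabilizer :: "nat list \<Rightarrow> (nat \<times> nat \<Rightarrow> nat) \<Rightarrow> (nat \<Rightarrow> nat) set" where
  "column_stabilizer l t =
    {s. s permutes {..<sum_list l} \<and>
        (\<forall>(i, j)\<in>cells l. \<exists>i'. (i', j) \<in> cells l \<and> s (t (i, j)) = t (i', j))}"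

text \<open>
  The polytabloid of \<open>t\<close> is the sum of \<open>sign s \<cdot> s{t}\<close> over the column stabilizer of \<open>t\<close>, as a
  function giving the coefficient of each tabloid.
\<close>

definition polytabloid :: "nat list \<Rightarrow> (nat \<times> nat \<Rightarrow> nat) \<Rightarrow> nat set list \<Rightarrow> complex" where
  "polytabloid l t T =
    (\<Sum>s \<in> {s \<in> column_stabilizer l t. tabloid l (s \<circ> t) = T}. of_int (sign s))"

definition specht :: "nat list \<Rightarrow> nat set list perm_rep" where
  "specht l =
    \<lparr>rep_space = {(\<lambda>T. \<Sum>t\<in>tableaux l. c t * polytabloid l t T) | c. True},
     pt_act = (\<lambda>p. map (image p))\<rparr>"

text \<open>
  The \<open>g\<close> below exists uniquely: representations of $S_n$ are completely reducible, and the Specht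
  modules of the partitions of \<open>n\<close> represent each irreducible one exactly once.
\<close>

definition kronecker :: "nat list \<Rightarrow> nat list \<Rightarrow> nat list \<Rightarrow> nat" where
  "kronecker l m =
    (if is_partition l \<and> is_partition m \<and> sum_list l = sum_list m
     then THE g. (\<forall>r. r \<notin> partitions_of (sum_list l) \<longrightarrow> g r = 0) \<and>
       rep_iso (sum_list l) (tensor_rep (specht l) (specht m))
         (multiple_sum_rep (partitions_of (sum_list l)) g specht)
     else (\<lambda>_. 0))"

definition weakly_stable :: "nat list \<times> nat list \<times> nat list \<Rightarrow> bool" where
  "weakly_stable = (\<lambda>(l, m, r). \<forall>k\<ge>1.
     kronecker (scale_partition k l) (scale_partition k m) (scale_partition k r) = 1)"

definition Kron :: "nat \<Rightarrow> nat \<Rightarrow> nat \<Rightarrow> (nat list \<times> nat list \<times> nat list) set" where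
  "Kron a b c = {(l, m, r). is_partition l \<and> is_partition m \<and> is_partition r \<and>
     length l \<le> a \<and> length m \<le> b \<and> length r \<le> c \<and> kronecker l m r \<noteq> 0}"

definition SKron :: "nat \<Rightarrow> nat \<Rightarrow> nat \<Rightarrow> (nat list \<times> nat list \<times> nat list) set" where
  "SKron a b c = {t \<in> Kron a b c. weakly_stable t}"

text \<open>
  A partition with at most \<open>CARD('d)\<close> parts, padded by zeros, is a vector in \<open>real ^ 'd\<close>; the
  index in position \<open>k\<close> (from \<open>0\<close>) of the linear order \<open>'d\<close> is the one with \<open>k\<close> predecessors.
  Triples live in \<open>(real ^ 'a) \<times> (real ^ 'b) \<times> (real ^ 'c)\<close>, which is $R^{a+b+c}$ for
  \<open>a = CARD('a)\<close>, \<open>b = CARD('b)\<close>, \<open>c = CARD('c)\<close>.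
\<close>

definition partition_vec :: "nat list \<Rightarrow> real ^ ('d :: {finite, linorder})" where
  "partition_vec l = (\<chi> i. let k = card {..<i} in if k < length l then real (l ! k) else 0)"

definition triple_vec :: "nat list \<times> nat list \<times> nat list \<Rightarrow>
    (real ^ ('a :: {finite, linorder})) \<times> (real ^ ('b :: {finite, linorder})) \<times>
    (real ^ ('c :: {finite, linorder}))" where
  "triple_vec = (\<lambda>(l, m, r). (partition_vec l, partition_vec m, partition_vec r))"

definition PKron :: "((real ^ ('a :: {finite, linorder})) \<times> (real ^ ('b :: {finite, linorder})) \<times>
    (real ^ ('c :: {finite, linorder}))) set" where
  "PKron = convex_cone hull (triple_vec ` Kron CARD('a) CARD('b) CARD('c))"

end

theory Submission
  imports Defs "HOL-Library.Function_Algebras" "HOL-Library.Multiset_Order"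
    "HOL-Combinatorics.Multiset_Permutations"
begin

text \<open>
  The faces are the minimal ones. For a weakly stable triple \<open>t\<close>, the vectors \<open>y\<close> of the cone such that
  \<open>t - \<epsilon> y\<close> stays in the cone for some \<open>\<epsilon> > 0\<close> form a face through \<open>t\<close>, and the theorem says that a triple
  \<open>s\<close> of the semigroup on this face is again weakly stable. Two facts give this.

  The first is arithmetic. The vector \<open>t - \<epsilon> s\<close> is a nonnegative real combination of lattice vectors of the
  semigroup. Approximating all coefficients, and \<open>\<epsilon>\<close>, by fractions with a common denominator \<open>q\<close> leaves an
  integral error vector of norm less than 1, which is 0. So \<open>q t = s + u\<close> in the semigroup
  (\<open>Kron_multiple_dominates\<close>).

  The second is monotonicity: \<open>g(s) \<le> g(s + u)\<close> as soon as \<open>g(u) \<noteq> 0\<close> (\<open>kronecker_mono\<close>). It makes the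
  triples a semigroup, and applied to multiples it gives \<open>1 \<le> g(k s) \<le> g(k s + k u) = g(k q t) = 1\<close>.

  For monotonicity, \<open>g(\<lambda>, \<mu>, \<nu>)\<close> is the dimension of the invariants in the triple tensor product of Specht
  modules (\<open>has_dim_kronecker\<close>). Replace a tabloid by the word that lists the row of each letter. An invariant
  is then a function of three words which only depends on the multiset of letter triples read off position by
  position, so it is a polynomial. Two such polynomials are multiplied by concatenating words and averaging over
  the symmetric group. The product stays in the Specht modules of the sum partitions because polytabloids are
  products over columns and the columns of a sum of partitions are the columns of the summands
  (\<open>polyt_append_disjoint\<close>), and it is nonzero for nonzero factors because leading monomials multiply
  (\<open>average_prod_nonzero\<close>). Multiplication by an invariant of weight \<open>u\<close> is therefore injective.

  That the coefficients are well defined and equal these dimensions is the classical theory of Specht modules,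
  and one computation carries it: a function that alternates under the column stabiliser of a tableau, and lives
  on words whose letter sum is at most that of the row word, is a multiple of the polytabloid
  (\<open>alternating_eq_polyt\<close>). It shows that polytabloids are killed by the raising operators, that Specht modules
  are irreducible, and that different ones are not isomorphic. Conversely the functions killed by all raising
  operators are combinations of polytabloids (\<open>highest_weight_in_Specht\<close>). Since a raising operator lowers the
  letter sum, an equivariant map to functions on words with the smallest possible letter sum lands in a Specht
  module; so every representation at hand contains one, and splits into Specht modules (\<open>specht_decomposition\<close>).
\<close>

section \<open>Complex functions as a vector space\<close>

interpretation cfun: vector_space "\<lambda>c (f :: 'x \<Rightarrow> complex) x. c * f x"
  by unfold_locales (auto simp: fun_eq_iff algebra_simps)

interpretation cfun_pair: vector_space_pair "\<lambda>c (f :: 'x \<Rightarrow> complex) x. c * f x"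
  "\<lambda>c (f :: 'y \<Rightarrow> complex) x. c * f x"
  by unfold_locales

lemma sum_fun_apply: "(\<Sum>i\<in>A. f i) x = (\<Sum>i\<in>A. f i x)" for f :: "'i \<Rightarrow> 'x \<Rightarrow> 'y::comm_monoid_add"
  by (induction A rule: infinite_finite_induct) auto

section \<open>Polytabloids as functions on words\<close>

text \<open>The stabiliser of the columns, when \<open>c ! x\<close> is the column of the letter \<open>x\<close>.\<close>

definition stab :: "nat list \<Rightarrow> (nat \<Rightarrow> nat) set" where
  "stab c = {p. p permutes {..<length c} \<and> permute_list p c = c}"

text \<open>A tableau is encoded by the word \<open>r\<close> of the rows and the word \<open>c\<close> of the columns of its letters, a tabloid by
  the word \<open>w\<close> of the rows of its letters. The value at \<open>w\<close> collects the signs of the column permutations that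
  carry \<open>w\<close> to \<open>r\<close>.\<close>

definition polyt :: "nat list \<Rightarrow> nat list \<Rightarrow> nat list \<Rightarrow> complex" where
  "polyt r c w = (\<Sum>p \<in> {p \<in> stab c. permute_list p w = r}. of_int (sign p))"

text \<open>Columns carry arbitrary labels and are only required to have no gaps; the shape is determined by the letter
  multiplicities of \<open>r\<close>. Juxtaposing two tableaux with different column labels then gives a tableau, without
  sorting the columns by height.\<close>

definition tableau :: "nat list \<Rightarrow> nat list \<Rightarrow> bool" where
  "tableau r c \<longleftrightarrow> length r = length c \<and> distinct (zip r c) \<and>
    (\<forall>i j i'. (i, j) \<in> set (zip r c) \<longrightarrow> i' < i \<longrightarrow> (i', j) \<in> set (zip r c))"

definition alternating :: "nat list \<Rightarrow> (nat list \<Rightarrow> complex) \<Rightarrow> bool" where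
  "alternating c f \<longleftrightarrow> (\<forall>p\<in>stab c. \<forall>w. length w = length c \<longrightarrow>
    f (permute_list p w) = of_int (sign p) * f w)"

lemma finite_stab: "finite (stab c)"
  unfolding stab_def by (rule finite_subset[OF _ finite_permutations[of "{..<length c}"]]) auto

lemma stab_id: "id \<in> stab c"
  by (auto simp: stab_def permutes_id)

lemma stab_permutation: "p \<in> stab c \<Longrightarrow> permutation p"
  by (auto simp: stab_def permutation_permutes)

lemma stab_compose: "p \<in> stab c \<Longrightarrow> q \<in> stab c \<Longrightarrow> p \<circ> q \<in> stab c"
  by (auto simp: stab_def permutes_compose permute_list_compose)

lemma permute_list_inv_cancel:
  assumes "p permutes {..<length w}"
  shows "permute_list p (permute_list (inv p) w) = w" "permute_list (inv p) (permute_list p w) = w"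
  using assms permutes_inv[OF assms]
  by (simp_all flip: permute_list_compose add: permutes_inv_o)

lemma stab_inv: "p \<in> stab c \<Longrightarrow> inv p \<in> stab c"
  unfolding stab_def using permute_list_inv_cancel(2)[of p c] by (auto simp: permutes_inv)

lemma bij_betw_stab_compose:
  assumes "q \<in> stab c"
  shows "bij_betw (\<lambda>p. q \<circ> p) (stab c) (stab c)"
proof (rule bij_betwI[where g = "\<lambda>p. inv q \<circ> p"])
  have "q permutes {..<length c}"
    using assms by (simp add: stab_def)
  then show "inv q \<circ> (q \<circ> p) = p" "q \<circ> (inv q \<circ> p) = p" for p
    by (simp_all add: fun_eq_iff permutes_inverses)
qed (use assms in \<open>auto intro: stab_compose stab_inv\<close>)

lemma alternating_polyt:
  assumes "length r = length c"
  shows "alternating c (polyt r c)"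
  unfolding alternating_def
proof (intro ballI allI impI)
  fix q and w :: "nat list" assume q: "q \<in> stab c" and w: "length w = length c"
  have q': "q permutes {..<length w}" "permutation q"
    using q w stab_permutation by (auto simp: stab_def)
  have polyt_alt: "polyt r c w = (\<Sum>p\<in>stab c. if permute_list p w = r then of_int (sign p) else 0)" for w
    unfolding polyt_def using finite_stab by (subst sum.inter_filter) auto
  have "polyt r c w = (\<Sum>p\<in>stab c. if permute_list (q \<circ> p) w = r then of_int (sign (q \<circ> p)) else 0)"
    unfolding polyt_alt by (rule sum.reindex_bij_betw[OF bij_betw_stab_compose[OF q], symmetric])
  also have "\<dots> = (\<Sum>p\<in>stab c. of_int (sign q) *
      (if permute_list p (permute_list q w) = r then of_int (sign p) else 0))"
  proof (rule sum.cong[OF refl])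
    fix p assume p: "p \<in> stab c"
    then have "permute_list (q \<circ> p) w = permute_list p (permute_list q w)"
      using w by (intro permute_list_compose) (auto simp: stab_def)
    moreover have "sign (q \<circ> p) = sign q * sign p"
      using p q' stab_permutation by (intro sign_compose)
    ultimately show "(if permute_list (q \<circ> p) w = r then of_int (sign (q \<circ> p)) else 0) =
        of_int (sign q) * (if permute_list p (permute_list q w) = r then of_int (sign p) else (0::complex))"
      by simp
  qed
  also have "\<dots> = of_int (sign q) * polyt r c (permute_list q w)"
    unfolding polyt_alt by (simp add: sum_distrib_left)
  finally show "polyt r c (permute_list q w) = of_int (sign q) * polyt r c w"
    by (cases q rule: sign_cases) auto
qed

lemma distinct_zip_iff:
  assumes "length w = length c"
  shows "distinct (zip w c) \<longleftrightarrow> (\<forall>x<length c. \<forall>y<length c. w ! x = w ! y \<longrightarrow> c ! x = c ! y \<longrightarrow> x = y)"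
  using assms by (auto simp: distinct_conv_nth)

text \<open>Exchanging two letters in the same row and column fixes both words but is an odd permutation.\<close>

lemma alternating_eq_0:
  assumes f: "alternating c f" and w: "length w = length c" "\<not> distinct (zip w c)"
  shows "f w = 0"
proof -
  obtain x y where xy: "x < length c" "y < length c" "x \<noteq> y" "w ! x = w ! y" "c ! x = c ! y"
    using w by (auto simp: distinct_zip_iff)
  define p where "p = Transposition.transpose x y"
  have p: "p permutes {..<length c}"
    using xy by (auto simp: p_def intro: permutes_swap_id)
  have fixed: "permute_list p v = v" if "length v = length c" "v ! x = v ! y" for v :: "nat list"
    using that p xy
    by (intro nth_equalityI) (auto simp: permute_list_nth p_def Transposition.transpose_def)
  have "p \<in> stab c"
    using p fixed[of c] xy by (simp add: stab_def)
  with f w have "f (permute_list p w) = of_int (sign p) * f w"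
    by (auto simp: alternating_def)
  then show "f w = 0"
    using fixed[of w] w xy by (simp add: p_def sign_swap_id)
qed

lemma sum_ge_triangular:
  fixes A :: "nat set"
  assumes "finite A"
  shows "\<Sum>{..<card A} \<le> \<Sum>A"
    and "\<Sum>A \<le> \<Sum>{..<card A} \<Longrightarrow> A = {..<card A}"
proof -
  have "\<Sum>{..<card A} \<le> \<Sum>A \<and> (\<Sum>A \<le> \<Sum>{..<card A} \<longrightarrow> A = {..<card A})"
    using assms
  proof (induction A rule: finite_linorder_max_induct)
    case (insert b A)
    have A: "A \<subseteq> {..<b}"
      using insert.hyps by auto
    then have "card A \<le> b"
      using card_mono[OF _ A] by simp
    moreover have "A = {..<b}" if "card A = b"
      using card_subset_eq[OF _ A] that by simp
    moreover have "b \<notin> A" using insert.hyps by auto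
    then have ins: "\<Sum>(insert b A) = b + \<Sum>A" "card (insert b A) = Suc (card A)"
      using insert.hyps by simp_all
    moreover have "\<Sum>{..<Suc (card A)} = card A + \<Sum>{..<card A}"
      by (simp add: lessThan_Suc)
    ultimately have eqs: "\<Sum>{..<card (insert b A)} = card A + \<Sum>{..<card A}"
      by simp
    show ?case
    proof (intro conjI impI)
      show "\<Sum>{..<card (insert b A)} \<le> \<Sum>(insert b A)"
        using insert.IH ins eqs \<open>card A \<le> b\<close> by linarith
      assume "\<Sum>(insert b A) \<le> \<Sum>{..<card (insert b A)}"
      then have "card A = b"
        using insert.IH ins eqs \<open>card A \<le> b\<close> by linarith
      then show "insert b A = {..<card (insert b A)}"
        using \<open>card A = b \<Longrightarrow> A = {..<b}\<close> ins by (simp add: lessThan_Suc)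
    qed
  qed simp
  then show "\<Sum>{..<card A} \<le> \<Sum>A" "\<Sum>A \<le> \<Sum>{..<card A} \<Longrightarrow> A = {..<card A}"
    by auto
qed

lemma downward_closed_eq_lessThan:
  fixes A :: "nat set"
  assumes "finite A" "\<And>i i'. i \<in> A \<Longrightarrow> i' < i \<Longrightarrow> i' \<in> A"
  shows "A = {..<card A}"
proof (cases "A = {}")
  case False
  have "Max A \<in> A" using assms(1) False by simp
  then have "x \<in> A" if "x \<le> Max A" for x
    using assms(2)[of "Max A" x] that by (cases "x = Max A") auto
  moreover have "x \<le> Max A" if "x \<in> A" for x
    using assms(1) that by simp
  ultimately have "A = {..<Suc (Max A)}"
    unfolding lessThan_Suc_atMost by blast
  then show ?thesis
    by (metis card_lessThan)
qed simp

lemma sum_list_by_column: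
  assumes "length w = length c"
  shows "sum_list w = (\<Sum>j\<in>set c. \<Sum>x\<in>{x. x < length c \<and> c ! x = j}. w ! x)"
proof -
  have "sum_list w = (\<Sum>x<length c. w ! x)"
    using assms by (simp add: sum_list_sum_nth atLeast0LessThan)
  also have "\<dots> = (\<Sum>j\<in>set c. \<Sum>x\<in>{x\<in>{..<length c}. c ! x = j}. w ! x)"
    by (rule sum.group[symmetric]) auto
  finally show ?thesis by simp
qed

text \<open>Distinct entries of a column with \<open>h\<close> letters sum to at least \<open>0 + 1 + \<dots> + (h - 1)\<close>, and to exactly that
  only if they are \<open>0, \<dots>, h - 1\<close>, as they are in \<open>r\<close>. Summed over the columns, the bound on the letter sums forces
  equality in each column, so \<open>w\<close> and \<open>r\<close> have the same entries column by column.\<close>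

lemma column_permutation:
  assumes rc: "tableau r c" and w: "length w = length c" "distinct (zip w c)"
    and le: "sum_list w \<le> sum_list r"
  obtains p where "p \<in> stab c" "permute_list p w = r"
proof -
  define X where "X j = {x. x < length c \<and> c ! x = j}" for j
  have r: "length r = length c" "distinct (zip r c)"
    using rc by (auto simp: tableau_def)
  have inj: "inj_on ((!) v) (X j)" if "length v = length c" "distinct (zip v c)" for v j
    using that by (auto simp: inj_on_def X_def distinct_zip_iff)
  have fin: "finite (X j)" for j
    by (auto simp: X_def)
  have sums: "(\<Sum>x\<in>X j. v ! x) = \<Sum>((!) v ` X j)" "card ((!) v ` X j) = card (X j)"
    if "length v = length c" "distinct (zip v c)" for v j
    using inj[OF that] by (simp_all add: sum.reindex card_image)
  have rX: "(!) r ` X j = {..<card (X j)}" for j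
  proof -
    have "(!) r ` X j = {i. (i, j) \<in> set (zip r c)}"
      using r by (auto simp: X_def set_zip)
    moreover have "{i. (i, j) \<in> set (zip r c)} = {..<card {i. (i, j) \<in> set (zip r c)}}"
      using rc fin[of j] calculation
      by (intro downward_closed_eq_lessThan) (auto simp: tableau_def dest: arg_cong[where f = finite])
    ultimately show ?thesis using sums(2)[OF r] by metis
  qed
  have ge: "\<Sum>{..<card (X j)} \<le> (\<Sum>x\<in>X j. w ! x)" for j
    using sum_ge_triangular(1)[of "(!) w ` X j"] fin sums[OF w] by simp
  have "(\<Sum>j\<in>set c. \<Sum>x\<in>X j. w ! x) \<le> (\<Sum>j\<in>set c. \<Sum>{..<card (X j)})"
    using le sums(1)[OF r] rX r w by (simp add: sum_list_by_column X_def)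
  then have eq: "(\<Sum>x\<in>X j. w ! x) = \<Sum>{..<card (X j)}" if "j \<in> set c" for j
    using sum_mono_inv[of "\<lambda>j. \<Sum>{..<card (X j)}" "set c" "\<lambda>j. \<Sum>x\<in>X j. w ! x" j] ge that
      sum_mono[of "set c" "\<lambda>j. \<Sum>{..<card (X j)}" "\<lambda>j. \<Sum>x\<in>X j. w ! x"]
    by (simp add: le_antisym)
  have wX: "(!) w ` X j = (!) r ` X j" if "j \<in> set c" for j
    using sum_ge_triangular(2)[of "(!) w ` X j"] fin sums[OF w] eq[OF that] rX by simp
  have sub: "set (zip v c) \<subseteq> set (zip v' c)"
    if "length v = length c" "length v' = length c" "\<And>j. j \<in> set c \<Longrightarrow> (!) v ` X j = (!) v' ` X j"
    for v v' :: "nat list"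
  proof
    fix a assume "a \<in> set (zip v c)"
    then obtain x where x: "x < length c" "a = (v ! x, c ! x)"
      using that by (auto simp: set_zip)
    then have "v ! x \<in> (!) v' ` X (c ! x)"
      using that(3)[of "c ! x"] by (auto simp: X_def)
    then show "a \<in> set (zip v' c)"
      using x that by (force simp: X_def set_zip)
  qed
  have "set (zip w c) = set (zip r c)"
    using sub[of w r] sub[of r w] wX w r by auto
  then have "mset (zip r c) = mset (zip w c)"
    using w r set_eq_iff_mset_eq_distinct by blast
  then obtain p where p: "p permutes {..<length (zip w c)}" "permute_list p (zip w c) = zip r c"
    by (rule mset_eq_permutation)
  then have "zip (permute_list p w) (permute_list p c) = zip r c"
    using w by (simp add: permute_list_zip)
  then have "permute_list p w = r" "permute_list p c = c"
    using w r by (metis length_permute_list map_fst_zip map_snd_zip)+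
  then show ?thesis
    using p w by (intro that[of p]) (auto simp: stab_def)
qed

lemma polyt_self:
  assumes "tableau r c"
  shows "polyt r c r = 1"
proof -
  have r: "length r = length c" "distinct (zip r c)"
    using assms by (auto simp: tableau_def)
  have "p = id" if "p \<in> stab c" "permute_list p r = r" for p
  proof
    fix x show "p x = id x"
    proof (cases "x < length c")
      case True
      have p: "p permutes {..<length c}" "permute_list p c = c"
        using that by (auto simp: stab_def)
      have "p x < length c"
        using p True permutes_in_image[OF p(1)] by auto
      moreover have "r ! p x = r ! x" "c ! p x = c ! x"
        using permute_list_nth[of p r x] permute_list_nth[of p c x] that p r True by auto
      ultimately show ?thesis
        using r True by (auto simp: distinct_zip_iff)
    qed (use that in \<open>auto simp: stab_def permutes_def\<close>)
  qed
  then have "{p \<in> stab c. permute_list p r = r} = {id}"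
    using stab_id by auto
  then show ?thesis by (simp add: polyt_def)
qed

text \<open>Both sides alternate. Hence both vanish at \<open>w\<close> if a column of \<open>w\<close> repeats an entry, and otherwise \<open>w\<close> can be
  carried to \<open>r\<close> by a column permutation. The letter sum takes the place of the dominance order: all
  uniqueness properties of Specht modules below come from this comparison.\<close>

lemma alternating_eq_polyt:
  assumes f: "alternating c f" and rc: "tableau r c"
    and w: "length w = length c" "sum_list w \<le> sum_list r"
  shows "f w = f r * polyt r c w"
proof (cases "distinct (zip w c)")
  case True
  obtain p where p: "p \<in> stab c" "permute_list p w = r"
    using column_permutation[OF rc w(1) True w(2)] .
  have P: "alternating c (polyt r c)"
    using rc by (auto simp: tableau_def intro: alternating_polyt)
  have "f r = of_int (sign p) * f w" "1 = of_int (sign p) * polyt r c w"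
    using f P p w polyt_self[OF rc] unfolding alternating_def by metis+
  moreover have "f w * (of_int (sign p) * polyt r c w) = of_int (sign p) * f w * polyt r c w"
    by (simp only: ac_simps)
  ultimately show ?thesis
    by simp
next
  case False
  moreover have "alternating c (polyt r c)"
    using rc by (auto simp: tableau_def intro: alternating_polyt)
  ultimately show ?thesis
    using alternating_eq_0[of c f w] alternating_eq_0[of c "polyt r c" w] f w by simp
qed

lemma polyt_eq_0:
  assumes "length r = length c" "mset w \<noteq> mset r"
  shows "polyt r c w = 0"
proof -
  have "permute_list p w \<noteq> r" if "p \<in> stab c" for p
  proof
    assume p: "permute_list p w = r"
    then have "p permutes {..<length w}"
      using that assms by (auto simp: stab_def)
    then show False
      using mset_permute_list p assms by metis
  qed
  then have "{p \<in> stab c. permute_list p w = r} = {}"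
    by auto
  then show ?thesis by (simp only: polyt_def sum.empty)
qed

section \<open>Specht modules as spaces of highest weight vectors\<close>

definition supported :: "nat multiset \<Rightarrow> (nat list \<Rightarrow> complex) \<Rightarrow> bool" where
  "supported \<kappa> f \<longleftrightarrow> (\<forall>w. f w \<noteq> 0 \<longrightarrow> mset w = \<kappa>)"

definition Specht :: "nat multiset \<Rightarrow> (nat list \<Rightarrow> complex) set" where
  "Specht \<kappa> = cfun.span {polyt r c | r c. tableau r c \<and> mset r = \<kappa>}"

text \<open>For \<open>b = Suc a\<close> this is the raising operator of the Lie algebra of matrices acting on functions on words: a
  function of content \<open>\<kappa>\<close> becomes one whose content has one letter \<open>Suc a\<close> replaced by \<open>a\<close>. For \<open>a = Suc b\<close> it is
  the corresponding lowering operator.\<close>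

definition shift :: "nat \<Rightarrow> nat \<Rightarrow> (nat list \<Rightarrow> complex) \<Rightarrow> nat list \<Rightarrow> complex" where
  "shift a b f w = (\<Sum>x \<in> {x. x < length w \<and> w ! x = a}. f (w[x := b]))"

lemma subspace_Specht: "cfun.subspace (Specht \<kappa>)"
  by (simp add: Specht_def)

lemma Specht_0: "0 \<in> Specht \<kappa>"
  and Specht_add: "f \<in> Specht \<kappa> \<Longrightarrow> g \<in> Specht \<kappa> \<Longrightarrow> f + g \<in> Specht \<kappa>"
  and Specht_scale: "f \<in> Specht \<kappa> \<Longrightarrow> (\<lambda>x. a * f x) \<in> Specht \<kappa>"
  and Specht_sum: "(\<And>i. i \<in> A \<Longrightarrow> h i \<in> Specht \<kappa>) \<Longrightarrow> (\<Sum>i\<in>A. h i) \<in> Specht \<kappa>"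
  by (simp_all add: Specht_def cfun.span_zero cfun.span_add cfun.span_scale cfun.span_sum)

lemma polyt_in_Specht: "tableau r c \<Longrightarrow> polyt r c \<in> Specht (mset r)"
  unfolding Specht_def by (rule cfun.span_base) auto

lemma Specht_induct [consumes 1, case_names zero add scale polyt]:
  assumes "f \<in> Specht \<kappa>"
    and "P (\<lambda>_. 0)" "\<And>f g. P f \<Longrightarrow> P g \<Longrightarrow> P (\<lambda>x. f x + g x)" "\<And>a f. P f \<Longrightarrow> P (\<lambda>x. a * f x)"
    and "\<And>r c. tableau r c \<Longrightarrow> mset r = \<kappa> \<Longrightarrow> P (polyt r c)"
  shows "P f"
  using assms(1) unfolding Specht_def
proof (induction rule: cfun.span_induct)
  case base
  show ?case
    unfolding cfun.subspace_def using assms(2-4) by (simp add: zero_fun_def plus_fun_def)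
qed (use assms(5) in auto)

lemma supported_Specht: "f \<in> Specht \<kappa> \<Longrightarrow> supported \<kappa> f"
  unfolding supported_def
proof (induction rule: Specht_induct)
  case (add f g)
  then show ?case by (metis add_0_left)
next
  case (polyt r c)
  then show ?case
    using polyt_eq_0[of r c] by (auto simp: tableau_def)
qed auto

lemma permute_list_update:
  assumes p: "p permutes {..<length w}" and x: "x < length w"
  shows "(permute_list p w)[x := a] = permute_list p (w[p x := a])"
proof (rule nth_equalityI)
  fix i assume "i < length ((permute_list p w)[x := a])"
  then have i: "i < length w" by simp
  have "p i < length w" "p x < length w"
    using permutes_in_image[OF p] i x by auto
  moreover have "p i = p x \<longleftrightarrow> i = x"
    using permutes_inj[OF p] by (auto dest: injD)
  ultimately show "(permute_list p w)[x := a] ! i = permute_list p (w[p x := a]) ! i"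
    using i x p by (auto simp: permute_list_nth nth_list_update)
qed simp

lemma shift_permute:
  assumes p: "p permutes {..<length w}"
  shows "shift a b f (permute_list p w) = shift a b (\<lambda>v. f (permute_list p v)) w"
proof -
  have inj: "inj_on p S" for S
    using permutes_inj[OF p] by (auto intro: inj_on_subset)
  have im: "p ` {x. x < length w \<and> w ! p x = a} = {x. x < length w \<and> w ! x = a}"
  proof (intro set_eqI iffI)
    fix y assume "y \<in> {x. x < length w \<and> w ! x = a}"
    then have "inv p y < length w \<and> w ! p (inv p y) = a" "y = p (inv p y)"
      using permutes_in_image[OF permutes_inv[OF p]] permutes_inverses[OF p] by auto
    then show "y \<in> p ` {x. x < length w \<and> w ! p x = a}"
      by blast
  qed (use permutes_in_image[OF p] in auto)
  have "shift a b f (permute_list p w) =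
      (\<Sum>x \<in> {x. x < length w \<and> w ! p x = a}. f (permute_list p (w[p x := b])))"
    unfolding shift_def by (intro sum.cong) (auto simp: permute_list_nth p permute_list_update)
  also have "\<dots> = (\<Sum>x \<in> p ` {x. x < length w \<and> w ! p x = a}. f (permute_list p (w[x := b])))"
    using inj by (simp add: sum.reindex)
  finally show ?thesis
    by (simp add: im shift_def)
qed

lemma alternating_shift:
  assumes "alternating c f"
  shows "alternating c (shift a b f)"
  unfolding alternating_def
proof (intro ballI allI impI)
  fix p and w :: "nat list" assume p: "p \<in> stab c" and w: "length w = length c"
  then have "shift a b f (permute_list p w) = shift a b (\<lambda>v. f (permute_list p v)) w"
    by (intro shift_permute) (auto simp: stab_def)
  also have "\<dots> = (\<Sum>x \<in> {x. x < length w \<and> w ! x = a}. of_int (sign p) * f (w[x := b]))"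
    unfolding shift_def using assms p w by (intro sum.cong) (auto simp: alternating_def)
  finally show "shift a b f (permute_list p w) = of_int (sign p) * shift a b f w"
    by (simp add: shift_def sum_distrib_left)
qed

lemma shift_add: "shift a b (\<lambda>x. f x + g x) w = shift a b f w + shift a b g w"
  and shift_scale: "shift a b (\<lambda>x. k * f x) w = k * shift a b f w"
  and shift_zero: "shift a b (\<lambda>x. 0) w = 0"
  by (simp_all add: shift_def sum.distrib sum_distrib_left)

lemma mset_ne_sum_list: "sum_list w \<noteq> sum_list v \<Longrightarrow> mset w \<noteq> mset v" for w v :: "nat list"
  by (metis sum_mset_sum_list)

text \<open>The image of a polytabloid alternates and has a smaller letter sum, so it is a multiple of the same polytabloid;
  but the contents differ.\<close>

lemma raise_polyt:
  assumes rc: "tableau r c"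
  shows "shift j (Suc j) (polyt r c) w = 0"
proof -
  have len: "length r = length c"
    using rc by (simp add: tableau_def)
  have neq: "shift j (Suc j) (polyt r c) v = 0" if "Suc (sum_list v) \<noteq> sum_list r" for v
    unfolding shift_def
  proof (intro sum.neutral ballI)
    fix x assume "x \<in> {x. x < length v \<and> v ! x = j}"
    then have "sum_list (v[x := Suc j]) = Suc (sum_list v)"
      using member_le_sum_list[of "v ! x" v] by (auto simp: sum_list_update)
    then show "polyt r c (v[x := Suc j]) = 0"
      using that by (intro polyt_eq_0[OF len] mset_ne_sum_list) simp
  qed
  show ?thesis
  proof (cases "length w = length c \<and> Suc (sum_list w) = sum_list r")
    case True
    then have "shift j (Suc j) (polyt r c) w = shift j (Suc j) (polyt r c) r * polyt r c w"
      using len by (intro alternating_eq_polyt alternating_shift alternating_polyt rc) auto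
    then show ?thesis using neq[of r] by simp
  next
    case False
    have "shift j (Suc j) (polyt r c) w = 0" if "length w \<noteq> length c"
      unfolding shift_def using that len
      by (intro sum.neutral ballI polyt_eq_0) (auto dest!: mset_eq_length)
    then show ?thesis using False neq by blast
  qed
qed

lemma raise_Specht: "f \<in> Specht \<kappa> \<Longrightarrow> shift j (Suc j) f w = 0"
  by (induction arbitrary: w rule: Specht_induct) (simp_all add: shift_add shift_scale shift_zero raise_polyt)

text \<open>Where the value is not 0, a letter \<open>j\<close> of a correctly filled column has become a second \<open>Suc j\<close> of that column;
  an alternating function vanishes there.\<close>

lemma lower_polyt_eq_0:
  assumes rc: "tableau r c"
    and full: "\<And>k. (j, k) \<in> set (zip r c) \<Longrightarrow> (Suc j, k) \<in> set (zip r c)"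
  shows "shift (Suc j) j (polyt r c) v = 0"
proof (rule ccontr)
  assume nz: "shift (Suc j) j (polyt r c) v \<noteq> 0"
  have len: "length r = length c"
    using rc by (simp add: tableau_def)
  have alt: "alternating c (polyt r c)"
    using len by (rule alternating_polyt)
  obtain x where x: "x < length v" "v ! x = Suc j" "polyt r c (v[x := j]) \<noteq> 0"
    using nz unfolding shift_def by (auto elim: sum.not_neutral_contains_not_neutral)
  define u where "u = v[x := j]"
  have mu: "mset u = mset r"
    using polyt_eq_0[OF len, of u] x by (auto simp: u_def)
  then have lu: "length u = length c"
    using len by (metis mset_eq_length)
  have "distinct (zip u c)"
    using alternating_eq_0[OF alt lu] x by (auto simp: u_def)
  moreover have "sum_list u = sum_list r"
    using mu by (metis sum_mset_sum_list)
  ultimately obtain p where p: "p \<in> stab c" "permute_list p u = r"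
    using column_permutation[OF rc lu] by auto
  then have "permute_list p (zip u c) = zip r c"
    using lu by (auto simp: stab_def permute_list_zip)
  then have set: "set (zip u c) = set (zip r c)"
    using p lu set_permute_list[of p "zip u c"] by (auto simp: stab_def)
  have "(j, c ! x) \<in> set (zip u c)"
    using x lu by (auto simp: u_def set_zip intro!: exI[of _ x])
  then have "(Suc j, c ! x) \<in> set (zip u c)"
    using full set by auto
  then obtain y where y: "y < length u" "u ! y = Suc j" "c ! y = c ! x"
    by (auto simp: set_zip)
  then have "y \<noteq> x" "v ! y = Suc j"
    using x by (auto simp: u_def nth_list_update split: if_splits)
  then have "\<not> distinct (zip v c)"
    using distinct_zip_iff[of v c] x y lu by (simp add: u_def) metis
  then show False
    using alternating_eq_0[OF alternating_shift[OF alt], of v "Suc j" j] nz lu by (auto simp: u_def)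
qed

text \<open>Bilinear, not sesquilinear. The polytabloids are real, so the Specht space is closed under conjugation and
  the form is still definite on it.\<close>

definition dot :: "nat multiset \<Rightarrow> (nat list \<Rightarrow> complex) \<Rightarrow> (nat list \<Rightarrow> complex) \<Rightarrow> complex" where
  "dot \<kappa> f g = (\<Sum>w \<in> permutations_of_multiset \<kappa>. f w * g w)"

lemma mset_list_update: "x < length w \<Longrightarrow> mset (w[x := a]) = add_mset a (mset w - {#w ! x#})"
  by (simp add: mset_update)

lemma dot_shift:
  assumes "b \<in># \<kappa>" "a \<noteq> b" "\<kappa>' = add_mset a (\<kappa> - {#b#})"
  shows "dot \<kappa> (shift b a g) h = dot \<kappa>' g (shift a b h)"
proof -
  let ?A = "SIGMA w:permutations_of_multiset \<kappa>. {x. x < length w \<and> w ! x = b}"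
  let ?B = "SIGMA w:permutations_of_multiset \<kappa>'. {x. x < length w \<and> w ! x = a}"
  have \<kappa>: "\<kappa> = add_mset b (\<kappa>' - {#a#})"
    using assms by auto
  have "dot \<kappa> (shift b a g) h = (\<Sum>(w, x)\<in>?A. g (w[x := a]) * h w)"
    by (simp add: dot_def shift_def sum_distrib_right sum.Sigma)
  also have "\<dots> = (\<Sum>(w, x)\<in>?B. g w * h (w[x := b]))"
  proof (rule sum.reindex_bij_witness[where i = "\<lambda>(w, x). (w[x := b], x)" and j = "\<lambda>(w, x). (w[x := a], x)"])
    fix z assume "z \<in> ?A"
    then show "(case case z of (w, x) \<Rightarrow> (w[x := a], x) of (w, x) \<Rightarrow> (w[x := b], x)) = z"
      and "(case z of (w, x) \<Rightarrow> (w[x := a], x)) \<in> ?B"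
      and "(case case z of (w, x) \<Rightarrow> (w[x := a], x) of (w, x) \<Rightarrow> g w * h (w[x := b])) =
        (case z of (w, x) \<Rightarrow> g (w[x := a]) * h w)"
      by (auto simp: assms(3) permutations_of_multiset_def mset_list_update)
  next
    fix z assume "z \<in> ?B"
    then show "(case case z of (w, x) \<Rightarrow> (w[x := b], x) of (w, x) \<Rightarrow> (w[x := a], x)) = z"
      by auto
    obtain w x where z: "z = (w, x)" "mset w = \<kappa>'" "x < length w" "w ! x = a"
      using \<open>z \<in> ?B\<close> by (auto simp: permutations_of_multiset_def)
    then have "mset (w[x := b]) = \<kappa>"
      using \<kappa> by (simp add: mset_list_update)
    then show "(case z of (w, x) \<Rightarrow> (w[x := b], x)) \<in> ?A"
      using z by (simp add: permutations_of_multiset_def)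
  qed
  also have "\<dots> = dot \<kappa>' g (shift a b h)"
    by (simp add: dot_def shift_def sum_distrib_left sum.Sigma)
  finally show ?thesis .
qed

lemma cnj_Specht: "f \<in> Specht \<kappa> \<Longrightarrow> (\<lambda>w. cnj (f w)) \<in> Specht \<kappa>"
proof (induction rule: Specht_induct)
  case zero
  then show ?case using Specht_0 by (simp add: zero_fun_def)
next
  case (add f g)
  then show ?case using Specht_add[OF add] by (simp add: plus_fun_def)
next
  case (polyt r c)
  have "cnj (polyt r c w) = polyt r c w" for w
    by (simp add: polyt_def)
  then show ?case using polyt_in_Specht polyt by auto
qed (simp add: Specht_scale)

lemma dot_definite:
  assumes f: "f \<in> Specht \<kappa>" and orth: "\<And>r c. tableau r c \<Longrightarrow> mset r = \<kappa> \<Longrightarrow> dot \<kappa> f (polyt r c) = 0"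
  shows "f w = 0"
proof -
  have "dot \<kappa> f g = 0" if "g \<in> Specht \<kappa>" for g
    using that by (induction rule: Specht_induct)
      (use orth in \<open>auto simp: dot_def algebra_simps sum.distrib simp flip: sum_distrib_left\<close>)
  then have "(\<Sum>w \<in> permutations_of_multiset \<kappa>. f w * cnj (f w)) = 0"
    using cnj_Specht[OF f] by (simp add: dot_def)
  then have "of_real (\<Sum>w \<in> permutations_of_multiset \<kappa>. (norm (f w))\<^sup>2) = (0 :: complex)"
    by (simp add: complex_norm_square[symmetric])
  then have "(\<Sum>w \<in> permutations_of_multiset \<kappa>. (norm (f w))\<^sup>2) = 0"
    by (simp only: of_real_eq_0_iff)
  then have "\<forall>w \<in> permutations_of_multiset \<kappa>. (norm (f w))\<^sup>2 = 0"
    by (subst (asm) sum_nonneg_eq_0_iff) simp_all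
  then have "f w = 0" if "mset w = \<kappa>"
    using that by (auto simp: permutations_of_multiset_def)
  then show ?thesis
    using supported_Specht[OF f] by (auto simp: supported_def)
qed

lemma raise_append:
  "shift j (Suc j) f (w @ [i]) =
    shift j (Suc j) (\<lambda>v. f (v @ [i])) w + (if i = j then f (w @ [Suc j]) else 0)"
proof -
  have "{x. x < length (w @ [i]) \<and> (w @ [i]) ! x = j} =
      {x. x < length w \<and> w ! x = j} \<union> (if i = j then {length w} else {})"
    by (auto simp: nth_append less_Suc_eq)
  then show ?thesis
    unfolding shift_def by (auto simp: list_update_append intro!: sum.cong arg_cong2[where f = "(+)"]
      simp flip: add.commute[of "f _"])
qed

text \<open>The box in row \<open>l\<close> can be added at the bottom of column \<open>k\<close>.\<close>

definition addable :: "nat list \<Rightarrow> nat list \<Rightarrow> nat \<Rightarrow> nat \<Rightarrow> bool" where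
  "addable r c l k \<longleftrightarrow> (l, k) \<notin> set (zip r c) \<and> (\<forall>i<l. (i, k) \<in> set (zip r c))"

lemma tableau_append:
  assumes "tableau r c" "addable r c l k"
  shows "tableau (r @ [l]) (c @ [k])"
  using assms unfolding tableau_def addable_def by (auto simp: zip_append)

lemma permute_list_snoc:
  assumes "length v = n" "p permutes {..<n}"
  shows "permute_list p (v @ [a]) = permute_list p v @ [a]"
proof -
  have "p n = n" "\<And>i. i < n \<Longrightarrow> p i < n"
    using permutes_in_image[OF assms(2)] permutes_not_in[OF assms(2), of n] by auto
  then show ?thesis
    using assms(1) by (simp add: permute_list_def nth_append)
qed

text \<open>The new letter is at the bottom of its column. A column permutation that moves \<open>l\<close> to the last position
  therefore fixes that position, and no entry above \<open>l\<close> can be moved there.\<close>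

lemma polyt_append:
  assumes rc: "tableau r c" and k: "addable r c l k"
  shows "polyt (r @ [l]) (c @ [k]) (w @ [l]) = polyt r c w"
    and "i > l \<Longrightarrow> polyt (r @ [l]) (c @ [k]) (w @ [i]) = 0"
proof -
  have len: "length r = length c"
    using rc by (simp add: tableau_def)
  have t': "tableau (r @ [l]) (c @ [k])"
    using tableau_append[OF rc k] .
  have last: "\<exists>y \<le> length c. p y = length c \<and> (r @ [l]) ! y = i \<and> (c @ [k]) ! y = k"
    if p: "p \<in> stab (c @ [k])" "permute_list p (w @ [i]) = r @ [l]" "length w = length c" for p i
  proof -
    have pp: "p permutes {..<Suc (length c)}" "permute_list p (c @ [k]) = c @ [k]"
      using p by (auto simp: stab_def)
    define y where "y = inv p (length c)"
    have y: "y < Suc (length c)" "p y = length c"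
      using permutes_in_image[OF permutes_inv[OF pp(1)], of "length c"] permutes_inverses[OF pp(1)]
      by (auto simp: y_def)
    have "(r @ [l]) ! y = (w @ [i]) ! p y" "(c @ [k]) ! y = (c @ [k]) ! p y"
      using pp p y permute_list_nth[of p "w @ [i]" y] permute_list_nth[of p "c @ [k]" y] by simp_all
    then show ?thesis
      using y p by (intro exI[of _ y]) (auto simp: nth_append)
  qed
  show "polyt (r @ [l]) (c @ [k]) (w @ [l]) = polyt r c w"
  proof (cases "length w = length c")
    case True
    have "{p \<in> stab (c @ [k]). permute_list p (w @ [l]) = r @ [l]} = {p \<in> stab c. permute_list p w = r}"
      (is "?A = ?B")
    proof (intro set_eqI iffI)
      fix p assume p: "p \<in> ?A"
      then obtain y where y: "y \<le> length c" "p y = length c" "(r @ [l]) ! y = l" "(c @ [k]) ! y = k"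
        using last[of p l] True by auto
      have "distinct (zip (r @ [l]) (c @ [k]))"
        using t' by (simp only: tableau_def)
      then have "\<forall>x<length (c @ [k]). \<forall>y<length (c @ [k]). (r @ [l]) ! x = (r @ [l]) ! y \<longrightarrow>
          (c @ [k]) ! x = (c @ [k]) ! y \<longrightarrow> x = y"
        by (subst (asm) distinct_zip_iff) (simp_all add: len)
      note D = this[rule_format]
      have "(r @ [l]) ! length c = l" "(c @ [k]) ! length c = k"
        using len by (simp_all add: nth_append)
      then have "y = length c"
        by (intro D[of y "length c"]) (use y in simp_all)
      then have last_fixed: "p (length c) = length c"
        using y(2) by simp
      have "p permutes {..<Suc (length c)}"
        using p by (simp add: stab_def)
      then have pp: "p permutes {..<length c}"
        by (rule permutes_superset) (use last_fixed in \<open>auto simp: less_Suc_eq\<close>)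
      show "p \<in> ?B"
        using p True by (simp add: stab_def pp permute_list_snoc[OF _ pp])
    next
      fix p assume p: "p \<in> ?B"
      then have pp: "p permutes {..<length c}"
        by (simp add: stab_def)
      then have "p permutes {..<Suc (length c)}"
        by (rule permutes_subset) auto
      then show "p \<in> ?A"
        using p True by (simp add: stab_def permute_list_snoc[OF _ pp])
    qed
    then show ?thesis
      by (simp only: polyt_def)
  next
    case False
    then have "mset w \<noteq> mset r" "mset (w @ [l]) \<noteq> mset (r @ [l])"
      using len by (auto dest: mset_eq_length)
    then show ?thesis
      using polyt_eq_0[of r c w] polyt_eq_0[of "r @ [l]" "c @ [k]" "w @ [l]"] len by simp
  qed
  assume i: "i > l"
  show "polyt (r @ [l]) (c @ [k]) (w @ [i]) = 0"
  proof (cases "length w = length c")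
    case True
    have "\<not> (p \<in> stab (c @ [k]) \<and> permute_list p (w @ [i]) = r @ [l])" for p
    proof
      assume "p \<in> stab (c @ [k]) \<and> permute_list p (w @ [i]) = r @ [l]"
      then obtain y where y: "y \<le> length c" "(r @ [l]) ! y = i" "(c @ [k]) ! y = k"
        using last[of p i] True by auto
      then have "(i, k) \<in> set (zip r c)"
        using i len by (auto simp: nth_append set_zip split: if_splits)
      then show False
        using rc k i unfolding tableau_def addable_def by blast
    qed
    then show ?thesis
      unfolding polyt_def by (intro sum.neutral) auto
  next
    case False
    then have "length (w @ [i]) \<noteq> length (r @ [l])"
      using len by simp
    then have "mset (w @ [i]) \<noteq> mset (r @ [l])"
      by (metis mset_eq_length)
    then show ?thesis
      using polyt_eq_0[of "r @ [l]" "c @ [k]" "w @ [i]"] len by simp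
  qed
qed

lemma count_row:
  assumes "tableau r c"
  shows "card {k. (i, k) \<in> set (zip r c)} = count (mset r) i" "finite {k. (i, k) \<in> set (zip r c)}"
proof -
  have rc: "length r = length c" "distinct (zip r c)"
    using assms by (auto simp: tableau_def)
  have eq: "{k. (i, k) \<in> set (zip r c)} = (!) c ` {x. x < length r \<and> r ! x = i}"
    using rc by (auto simp: set_zip)
  moreover have "inj_on ((!) c) {x. x < length r \<and> r ! x = i}"
    using rc by (auto simp: inj_on_def distinct_zip_iff)
  ultimately have "card {k. (i, k) \<in> set (zip r c)} = card {x. x < length r \<and> r ! x = i}"
    by (simp add: card_image)
  then show "card {k. (i, k) \<in> set (zip r c)} = count (mset r) i"
    by (simp add: count_mset count_list_eq_length_filter length_filter_conv_card eq_commute)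
  show "finite {k. (i, k) \<in> set (zip r c)}"
    unfolding eq by simp
qed

lemma addable_exists:
  assumes rc: "tableau r c" and l: "l = 0 \<or> count (mset r) l < count (mset r) (l - 1)"
  obtains k where "addable r c l k"
proof (cases "l = 0")
  case True
  obtain k where "k \<notin> set c"
    using ex_new_if_finite[OF infinite_UNIV_nat, of "set c"] by auto
  then show ?thesis
    using that[of k] True by (auto simp: addable_def dest: set_zip_rightD)
next
  case False
  then have "\<not> {k. (l - 1, k) \<in> set (zip r c)} \<subseteq> {k. (l, k) \<in> set (zip r c)}"
    using l False card_mono[OF count_row(2)[OF rc, of l], of "{k. (l - 1, k) \<in> set (zip r c)}"]
    unfolding count_row(1)[OF rc] by linarith
  then obtain k where "(l - 1, k) \<in> set (zip r c)" "(l, k) \<notin> set (zip r c)"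
    by auto
  moreover have "i < l - 1 \<or> i = l - 1" if "i < l" for i
    using that by auto
  ultimately show ?thesis
    using rc that[of k] unfolding addable_def tableau_def by blast
qed

lemma count_row_antimono:
  assumes "tableau r c"
  shows "count (mset r) (Suc i) \<le> count (mset r) i"
proof -
  have "{k. (Suc i, k) \<in> set (zip r c)} \<subseteq> {k. (i, k) \<in> set (zip r c)}"
    using assms unfolding tableau_def by blast
  then show ?thesis
    using card_mono[OF count_row(2)[OF assms, of i]] unfolding count_row(1)[OF assms, symmetric] by blast
qed

lemma full_columns:
  assumes rc: "tableau r c" and le: "count (mset r) i \<le> count (mset r) (Suc i)"
    and k: "(i, k) \<in> set (zip r c)"
  shows "(Suc i, k) \<in> set (zip r c)"
proof -
  have "{k. (Suc i, k) \<in> set (zip r c)} \<subseteq> {k. (i, k) \<in> set (zip r c)}"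
    using rc unfolding tableau_def by blast
  then have "{k. (Suc i, k) \<in> set (zip r c)} = {k. (i, k) \<in> set (zip r c)}"
    using le by (intro card_seteq) (simp_all add: count_row[OF rc])
  then show ?thesis using k by blast
qed

text \<open>Provides the element with prescribed leading coefficient that is subtracted in the proof of
  \<open>highest_weight_in_Specht\<close>. The hypothesis says that a box fits in row \<open>l\<close>.\<close>

lemma extend_Specht:
  assumes h: "h \<in> Specht \<kappa>" and l: "l = 0 \<or> count \<kappa> l < count \<kappa> (l - 1)"
  shows "\<exists>H \<in> Specht (add_mset l \<kappa>). \<forall>w. H (w @ [l]) = h w \<and> (\<forall>i>l. H (w @ [i]) = 0)"
  using h
proof (induction rule: Specht_induct)
  case zero
  then show ?case by (intro bexI[of _ 0]) (auto simp: Specht_0)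
next
  case (add f g)
  then obtain F G where F: "F \<in> Specht (add_mset l \<kappa>)" "\<forall>w. F (w @ [l]) = f w \<and> (\<forall>i>l. F (w @ [i]) = 0)"
    and G: "G \<in> Specht (add_mset l \<kappa>)" "\<forall>w. G (w @ [l]) = g w \<and> (\<forall>i>l. G (w @ [i]) = 0)"
    by blast
  then show ?case by (intro bexI[of _ "F + G"]) (auto simp: Specht_add)
next
  case (scale a f)
  then obtain F where F: "F \<in> Specht (add_mset l \<kappa>)" "\<forall>w. F (w @ [l]) = f w \<and> (\<forall>i>l. F (w @ [i]) = 0)"
    by blast
  then show ?case by (intro bexI[of _ "\<lambda>x. a * F x"]) (auto simp: Specht_scale)
next
  case (polyt r c)
  obtain k where k: "addable r c l k"
    using addable_exists[OF polyt(1)] l polyt(2) by auto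
  show ?case
    using polyt_in_Specht[OF tableau_append[OF polyt(1) k]] polyt_append[OF polyt(1) k] polyt(2)
    by (intro bexI[of _ "polyt (r @ [l]) (c @ [k])"]) auto
qed

text \<open>Induction on the number of letters. Split \<open>f\<close> by the last letter \<open>i\<close> into functions \<open>f\<^sub>i\<close> of shorter words, and let
  \<open>l\<close> be the largest letter that occurs. Then \<open>f\<^sub>l\<close> is killed by the raising operators, so it is a combination of
  polytabloids. If a box fits in row \<open>l\<close>, these extend to polytabloids with one letter more, and subtracting the
  extension makes \<open>l\<close> smaller. If no box fits, every column that reaches row \<open>l - 1\<close> also reaches row \<open>l\<close>. As \<open>f\<^sub>l\<close>
  is up to sign the raising of \<open>f\<close> at \<open>l - 1\<close>, it is orthogonal to all polytabloids by adjointness and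
  \<open>lower_polyt_eq_0\<close>, and hence is 0.\<close>

theorem highest_weight_in_Specht:
  assumes "supported \<kappa> f" "\<And>j w. shift j (Suc j) f w = 0"
  shows "f \<in> Specht \<kappa>"
  using assms
proof (induction "size \<kappa>" arbitrary: \<kappa> f)
  case 0
  have t: "tableau [] []"
    by (simp add: tableau_def)
  have "f w = f [] * polyt [] [] w" for w
    using polyt_self[OF t] polyt_eq_0[of "[]" "[]" w] 0 by (cases "w = []") (auto simp: supported_def)
  then have "f = (\<lambda>w. f [] * polyt [] [] w)"
    by (rule ext)
  moreover have "(\<lambda>w. f [] * polyt [] [] w) \<in> Specht \<kappa>"
    using Specht_scale[OF polyt_in_Specht[OF t], of "f []"] 0 by simp
  ultimately show ?case
    by metis
next
  case (Suc n)
  note IH = Suc.hyps(1) and size = Suc.hyps(2)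
  have "f \<in> Specht \<kappa>" if "supported \<kappa> f" "\<And>j w. shift j (Suc j) f w = 0" "\<And>i w. i \<ge> m \<Longrightarrow> f (w @ [i]) = 0" for m f
    using that
  proof (induction m arbitrary: f)
    case 0
    have "f w = 0" for w
    proof (cases w rule: rev_cases)
      case Nil
      then show ?thesis using 0(1) size by (auto simp: supported_def)
    qed (use 0(3) in auto)
    then have "f = 0" by (intro ext) simp
    then show ?case by (simp only: Specht_0)
  next
    case (Suc l)
    note IH' = Suc.IH and f = Suc.prems
    define h where "h = (\<lambda>w. f (w @ [l]))"
    show ?case
    proof (cases "\<forall>w. h w = 0")
      case True
      then have "f (w @ [i]) = 0" if "i \<ge> l" for i w
        using f(3)[of i] that by (cases "i = l") (auto simp: h_def)
      then show ?thesis using IH' f by blast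
    next
      case False
      then obtain w0 where "h w0 \<noteq> 0" by auto
      then have "mset (w0 @ [l]) = \<kappa>"
        using f(1) by (auto simp: supported_def h_def)
      then have l: "l \<in># \<kappa>" by auto
      define \<kappa>' where "\<kappa>' = \<kappa> - {#l#}"
      have \<kappa>: "\<kappa> = add_mset l \<kappa>'"
        using l by (simp add: \<kappa>'_def)
      have sup: "supported \<kappa>' h"
        using f(1) \<kappa> by (auto simp: supported_def h_def)
      have raise: "shift j (Suc j) h w = 0" for j w
        using f(2)[of j "w @ [l]"] f(3)[of "Suc l"] unfolding h_def raise_append by (auto split: if_splits)
      have hSp: "h \<in> Specht \<kappa>'"
        using IH[of \<kappa>' h] size sup raise \<kappa> by auto
      \<comment> \<open>Otherwise no box fits in row \<open>l\<close>, and \<open>h\<close> is orthogonal to the Specht space that contains it.\<close>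
      have good: "l = 0 \<or> count \<kappa>' l < count \<kappa>' (l - 1)"
      proof (rule ccontr)
        assume "\<not> ?thesis"
        then obtain j where j: "l = Suc j" and le: "count \<kappa>' j \<le> count \<kappa>' (Suc j)"
          by (cases l) auto
        define g where "g = (\<lambda>w. f (w @ [j]))"
        have hg: "h w = - shift j l g w" for w
          using f(2)[of j "w @ [j]"] unfolding raise_append g_def h_def j by (simp add: eq_neg_iff_add_eq_0 add.commute)
        have "h w = 0" for w
        proof (cases "j \<in># \<kappa>'")
          case True
          show ?thesis
          proof (rule dot_definite[OF hSp])
            fix r c assume rc: "tableau r c" "mset r = \<kappa>'"
            have "dot \<kappa>' h (polyt r c) = - dot \<kappa>' (shift j l g) (polyt r c)"
              by (simp add: dot_def hg sum_negf)
            also have "dot \<kappa>' (shift j l g) (polyt r c) =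
                dot (add_mset l (\<kappa>' - {#j#})) g (shift l j (polyt r c))"
              using True j by (intro dot_shift) auto
            also have "\<dots> = 0"
              using lower_polyt_eq_0[OF rc(1), of j] full_columns[OF rc(1), of j] le rc(2) j
              by (simp add: dot_def)
            finally show "dot \<kappa>' h (polyt r c) = 0" by simp
          qed
        next
          case False
          show ?thesis
          proof (rule ccontr)
            assume "h w \<noteq> 0"
            then have "mset w = \<kappa>'" using sup by (auto simp: supported_def)
            then have "j \<notin> set w" using False by auto
            then have "shift j l g w = 0"
              unfolding shift_def by (intro sum.neutral) auto
            then show False using hg \<open>h w \<noteq> 0\<close> by simp
          qed
        qed
        then show False using \<open>h w0 \<noteq> 0\<close> by simp
      qed
      obtain H where H: "H \<in> Specht \<kappa>" "\<And>w. H (w @ [l]) = h w" "\<And>w i. i > l \<Longrightarrow> H (w @ [i]) = 0"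
        using extend_Specht[OF hSp good] \<kappa> by blast
      define f' where "f' = (\<lambda>w. f w + (- 1) * H w)"
      have "f' \<in> Specht \<kappa>"
      proof (rule IH')
        show "supported \<kappa> f'"
          using f(1) supported_Specht[OF H(1)] by (auto simp: supported_def f'_def) metis
        show "shift j (Suc j) f' w = 0" for j w
          unfolding f'_def shift_add shift_scale using f(2) raise_Specht[OF H(1)] by simp
        show "f' (w @ [i]) = 0" if "i \<ge> l" for i w
          using that f(3)[of i] H by (cases "i = l") (auto simp: f'_def h_def)
      qed
      then have "f' + H \<in> Specht \<kappa>"
        using H(1) Specht_add by blast
      moreover have "f' + H = f"
        by (auto simp: f'_def)
      ultimately show ?thesis by simp
    qed
  qed
  moreover have "f (w @ [i]) = 0" if "i \<ge> Suc (Max (set_mset \<kappa>))" for i w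
  proof (rule ccontr)
    assume "f (w @ [i]) \<noteq> 0"
    then have "i \<in># \<kappa>"
      using Suc.prems(1) by (auto simp: supported_def)
    then show False
      using Max_ge[OF finite_set_mset \<open>i \<in># \<kappa>\<close>] that by linarith
  qed
  ultimately show ?case
    using Suc.prems by blast
qed

section \<open>Comparison with the Specht modules on tabloids\<close>

abbreviation cfun_linear :: "(('x \<Rightarrow> complex) \<Rightarrow> ('y \<Rightarrow> complex)) \<Rightarrow> bool" where
  "cfun_linear \<equiv> Vector_Spaces.linear (\<lambda>c f x. c * f x) (\<lambda>c f x. c * f x)"

lemma cfun_linear_iff:
  "cfun_linear \<Phi> \<longleftrightarrow> (\<forall>f g. \<Phi> (f + g) = \<Phi> f + \<Phi> g) \<and> (\<forall>a f. \<Phi> (\<lambda>x. a * f x) = (\<lambda>x. a * \<Phi> f x))"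
  unfolding Vector_Spaces.linear_iff by (auto intro: cfun.vector_space_axioms)

lemma permute_list_zip_same_length:
  "p permutes {..<length c} \<Longrightarrow> length r = length c \<Longrightarrow>
    permute_list p (zip r c) = zip (permute_list p r) (permute_list p c)"
  by (simp add: permute_list_zip)

lemma polyt_relabel:
  assumes "inj_on \<pi> (set c)"
  shows "polyt r (map \<pi> c) = polyt r c"
proof -
  have "permute_list p (map \<pi> c) = map \<pi> c \<longleftrightarrow> permute_list p c = c" if "p permutes {..<length c}" for p
    using that assms by (simp add: permute_list_map inj_on_map_eq_map)
  then have "stab (map \<pi> c) = stab c"
    by (auto simp: stab_def)
  then show ?thesis
    by (auto simp: polyt_def)
qed

lemma tableau_relabel:
  assumes rc: "tableau r c" and inj: "inj_on \<pi> (set c)"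
  shows "tableau r (map \<pi> c)"
proof -
  have len: "length r = length c"
    using rc by (simp add: tableau_def)
  have mem: "(i, \<pi> j) \<in> set (zip r (map \<pi> c)) \<longleftrightarrow> (i, j) \<in> set (zip r c)" if "j \<in> set c" for i j
    using inj that by (fastforce simp: zip_map2 dest: inj_onD set_zip_rightD)
  have "\<exists>j'\<in>set c. j = \<pi> j'" if "(i, j) \<in> set (zip r (map \<pi> c))" for i j
    using that by (auto dest!: set_zip_rightD)
  moreover have "distinct (zip r (map \<pi> c))"
    using rc inj by (auto simp: tableau_def distinct_zip_iff inj_on_eq_iff)
  ultimately show ?thesis
    using rc mem unfolding tableau_def by (metis length_map)
qed

lemma polyt_translate:
  assumes q: "q permutes {..<length c}" and len: "length r = length c" "length w = length c"
  shows "polyt (permute_list q r) (permute_list q c) (permute_list q w) = polyt r c w"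
proof -
  have q': "inv q permutes {..<length c}"
    using q by (rule permutes_inv)
  have perm: "permutation q" "permutation (inv q)"
    using q q' by (auto simp: permutation_permutes)
  have inv_cancel: "q (inv q x) = x" "inv q (q x) = x" for x
    using permutes_inverses[OF q] by auto
  have conj: "permute_list (inv q \<circ> p \<circ> q) (permute_list q v) = permute_list q (permute_list p v)"
    if "p permutes {..<length c}" "length v = length c" for p and v :: "nat list"
  proof -
    have "permute_list (inv q \<circ> p \<circ> q) (permute_list q v) =
        permute_list q (permute_list (inv q \<circ> p) (permute_list q v))"
      using q that by (intro permute_list_compose) auto
    also have "permute_list (inv q \<circ> p) (permute_list q v) =
        permute_list p (permute_list (inv q) (permute_list q v))"
      using that by (intro permute_list_compose) auto
    also have "permute_list (inv q) (permute_list q v) = v"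
      using q that by (intro permute_list_inv_cancel) auto
    finally show ?thesis .
  qed
  have inj: "permute_list q u = permute_list q v \<longleftrightarrow> u = v"
    if "length u = length c" "length v = length c" for u v :: "nat list"
    using permute_list_inv_cancel(2)[of q u] permute_list_inv_cancel(2)[of q v] q that by metis
  have "polyt r c w = (\<Sum>p\<in>{p \<in> stab (permute_list q c). permute_list p (permute_list q w) = permute_list q r}.
      of_int (sign p))"
    unfolding polyt_def
  proof (rule sum.reindex_bij_witness[where j = "\<lambda>p. inv q \<circ> p \<circ> q" and i = "\<lambda>p. q \<circ> p \<circ> inv q"])
    fix p assume p: "p \<in> {p \<in> stab c. permute_list p w = r}"
    show "q \<circ> (inv q \<circ> p \<circ> q) \<circ> inv q = p"
      by (auto simp: inv_cancel)
    have pp: "p permutes {..<length c}"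
      using p by (auto simp: stab_def)
    have "inv q \<circ> p \<circ> q permutes {..<length c}"
      using pp q q' by (intro permutes_compose)
    then show "inv q \<circ> p \<circ> q \<in> {p \<in> stab (permute_list q c). permute_list p (permute_list q w) = permute_list q r}"
      using p pp len by (auto simp: stab_def conj)
    have "permutation p"
      using pp by (auto simp: permutation_permutes)
    then have "sign (inv q \<circ> p \<circ> q) = sign q * sign p * sign q"
      using perm by (simp add: sign_compose permutation_compose sign_inverse)
    then have "sign (inv q \<circ> p \<circ> q) = sign p"
      by (cases q rule: sign_cases) auto
    then show "of_int (sign (inv q \<circ> p \<circ> q)) = (of_int (sign p) :: complex)"
      by simp
  next
    fix p assume p: "p \<in> {p \<in> stab (permute_list q c). permute_list p (permute_list q w) = permute_list q r}"
    show "inv q \<circ> (q \<circ> p \<circ> inv q) \<circ> q = p"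
      by (auto simp: inv_cancel)
    have pp: "p permutes {..<length c}"
      using p by (auto simp: stab_def)
    have p': "q \<circ> p \<circ> inv q permutes {..<length c}"
      using pp q q' by (intro permutes_compose)
    have "inv q \<circ> (q \<circ> p \<circ> inv q) \<circ> q = p"
      by (auto simp: inv_cancel)
    then have "permute_list q (permute_list (q \<circ> p \<circ> inv q) v) = permute_list p (permute_list q v)"
      if "length v = length c" for v :: "nat list"
      using conj[OF p' that] by simp
    then have "permute_list q (permute_list (q \<circ> p \<circ> inv q) c) = permute_list q c"
        "permute_list q (permute_list (q \<circ> p \<circ> inv q) w) = permute_list q r"
      using p len by (auto simp: stab_def)
    then show "q \<circ> p \<circ> inv q \<in> {p \<in> stab c. permute_list p w = r}"
      using p' len inj by (auto simp: stab_def)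
  qed
  then show ?thesis
    by (simp add: polyt_def)
qed

text \<open>Label a column by its rank in the order of decreasing height, ties broken by the old label. The columns that
  meet row \<open>i\<close> are then the first ones, and there are as many as letters \<open>i\<close> in \<open>r\<close>.\<close>

lemma sorted_columns:
  assumes rc: "tableau r c"
  obtains \<pi> where "inj_on \<pi> (set c)" "set (zip r (map \<pi> c)) = {(i, j). j < count (mset r) i}"
proof -
  define H where "H j = {i. (i, j) \<in> set (zip r c)}" for j
  define h where "h j = card (H j)" for j
  have fin: "finite (H j)" for j
    by (rule finite_subset[of _ "set r"]) (auto simp: H_def dest: set_zip_leftD)
  have H: "H j = {..<h j}" for j
    unfolding h_def using rc fin by (intro downward_closed_eq_lessThan) (auto simp: H_def tableau_def)
  have mem: "(i, j) \<in> set (zip r c) \<longleftrightarrow> i < h j" for i j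
    using H[of j] by (auto simp: H_def)
  \<comment> \<open>The columns that precede \<open>j\<close> in the order of decreasing height.\<close>
  define before where "before j = {j' \<in> set c. h j' > h j \<or> (h j' = h j \<and> j' < j)}" for j
  define \<pi> where "\<pi> j = card (before j)" for j
  have finb: "finite (before j)" for j
    by (simp add: before_def)
  have less: "\<pi> j < \<pi> j'" if "j \<in> before j'" for j j'
    unfolding \<pi>_def using that by (intro psubset_card_mono finb) (auto simp: before_def)
  have inj: "inj_on \<pi> (set c)"
  proof (rule inj_onI, rule ccontr)
    fix j j' assume "j \<in> set c" "j' \<in> set c" "\<pi> j = \<pi> j'" "j \<noteq> j'"
    moreover from this have "j \<in> before j' \<or> j' \<in> before j"
      by (auto simp: before_def)
    ultimately show False using less[of j j'] less[of j' j] by auto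
  qed
  have cols: "{j. (i, j) \<in> set (zip r c)} = {j \<in> set c. i < h j}" for i
    by (auto simp: mem dest: set_zip_rightD) (metis mem set_zip_rightD)
  then have count: "count (mset r) i = card {j \<in> set c. i < h j}" for i
    using count_row(1)[OF rc, of i] by simp
  have key: "\<pi> j < count (mset r) i \<longleftrightarrow> i < h j" if j: "j \<in> set c" for i j
  proof
    assume "i < h j"
    then have "before j \<subset> {j \<in> set c. i < h j}"
      using j by (auto simp: before_def)
    then show "\<pi> j < count (mset r) i"
      unfolding \<pi>_def count by (intro psubset_card_mono) auto
  next
    assume *: "\<pi> j < count (mset r) i"
    show "i < h j"
    proof (rule ccontr)
      assume "\<not> i < h j"
      then have "{j \<in> set c. i < h j} \<subseteq> before j"
        by (auto simp: before_def)
      then have "count (mset r) i \<le> \<pi> j"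
        unfolding \<pi>_def count by (intro card_mono finb)
      then show False using * by simp
    qed
  qed
  have len: "length r = length c"
    using rc by (simp add: tableau_def)
  have zip_map: "set (zip r (map \<pi> c)) = (\<lambda>(i, j). (i, \<pi> j)) ` set (zip r c)"
    by (simp add: zip_map2)
  have sub: "set (zip r (map \<pi> c)) \<subseteq> {(i, j). j < count (mset r) i}"
  proof
    fix z assume "z \<in> set (zip r (map \<pi> c))"
    then obtain i j where ij: "(i, j) \<in> set (zip r c)" "z = (i, \<pi> j)"
      unfolding zip_map by auto
    then show "z \<in> {(i, j). j < count (mset r) i}"
      using key[of j i] mem[of i j] set_zip_rightD[OF ij(1)] by simp
  qed
  have "{j. (i, j) \<in> set (zip r (map \<pi> c))} = {..<count (mset r) i}" for i
  proof (rule card_subset_eq)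
    show "card {j. (i, j) \<in> set (zip r (map \<pi> c))} = card {..<count (mset r) i}"
      using count_row(1)[OF tableau_relabel[OF rc inj], of i] by simp
  qed (use sub in auto)
  then have "set (zip r (map \<pi> c)) = {(i, j). j < count (mset r) i}"
    by (auto simp: set_eq_iff)
  with inj that show ?thesis by blast
qed

text \<open>After sorting columns both tableaux fill the same diagram, and renaming columns does not change a
  polytabloid.\<close>

lemma tableaux_conjugate:
  assumes rc: "tableau r c" and rc': "tableau r' c'" and eq: "mset r = mset r'"
  obtains q where "q permutes {..<length r}"
    "\<And>w. length w = length r \<Longrightarrow> polyt r' c' w = polyt r c (permute_list q w)"
proof -
  obtain \<pi> where \<pi>: "inj_on \<pi> (set c)" "set (zip r (map \<pi> c)) = {(i, j). j < count (mset r) i}"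
    by (rule sorted_columns[OF rc])
  obtain \<pi>' where \<pi>': "inj_on \<pi>' (set c')" "set (zip r' (map \<pi>' c')) = {(i, j). j < count (mset r') i}"
    by (rule sorted_columns[OF rc'])
  have len: "length r = length c" "length r' = length c'" "length r' = length r"
    using rc rc' mset_eq_length[OF eq] by (auto simp: tableau_def)
  have "distinct (zip r (map \<pi> c))" "distinct (zip r' (map \<pi>' c'))"
    using tableau_relabel[OF rc \<pi>(1)] tableau_relabel[OF rc' \<pi>'(1)] by (simp_all only: tableau_def)
  then have "mset (zip r (map \<pi> c)) = mset (zip r' (map \<pi>' c'))"
    using \<pi>(2) \<pi>'(2) eq set_eq_iff_mset_eq_distinct by metis
  then obtain q where q: "q permutes {..<length (zip r' (map \<pi>' c'))}"
      "permute_list q (zip r' (map \<pi>' c')) = zip r (map \<pi> c)"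
    by (rule mset_eq_permutation)
  then have qp: "q permutes {..<length r}"
    using len by simp
  have "zip (permute_list q r') (permute_list q (map \<pi>' c')) = zip r (map \<pi> c)"
    using q len by (subst permute_list_zip_same_length[symmetric]) auto
  then have eqs: "permute_list q r' = r" "permute_list q (map \<pi>' c') = map \<pi> c"
    using len by (metis length_map length_permute_list map_fst_zip map_snd_zip)+
  have "polyt r' c' w = polyt r c (permute_list q w)" if "length w = length r" for w
  proof -
    have "polyt r' c' w = polyt r' (map \<pi>' c') w"
      by (simp add: polyt_relabel \<pi>')
    also have "\<dots> = polyt (permute_list q r') (permute_list q (map \<pi>' c')) (permute_list q w)"
      using qp len that by (intro polyt_translate[symmetric]) auto
    also have "\<dots> = polyt r c (permute_list q w)"
      unfolding eqs by (simp add: polyt_relabel \<pi>)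
    finally show ?thesis .
  qed
  with qp that show ?thesis by blast
qed

definition row_content :: "nat list \<Rightarrow> nat multiset" where
  "row_content l = (\<Sum>i<length l. replicate_mset (l ! i) i)"

lemma count_row_content: "count (row_content l) i = (if i < length l then l ! i else 0)"
proof -
  have "count (row_content l) i = (\<Sum>j<length l. count (replicate_mset (l ! j) j) i)"
    unfolding row_content_def by (rule count_sum)
  also have "\<dots> = (\<Sum>j<length l. if j = i then l ! j else 0)"
    by (intro sum.cong) auto
  finally show ?thesis by simp
qed

lemma size_row_content: "size (row_content l) = sum_list l"
proof -
  have "size (\<Sum>i\<in>A. replicate_mset (l ! i) i) = (\<Sum>i\<in>A. l ! i)" if "finite A" for A
    using that by induction auto
  then show ?thesis
    by (simp add: row_content_def sum_list_sum_nth atLeast0LessThan)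
qed

lemma cells_eq: "cells l = {(i, j). j < count (row_content l) i}"
  by (auto simp: cells_def count_row_content split: if_splits)

definition row_word :: "nat list \<Rightarrow> (nat \<times> nat \<Rightarrow> nat) \<Rightarrow> nat list" where
  "row_word l t = map (\<lambda>x. fst (inv_into (cells l) t x)) [0..<sum_list l]"

definition col_word :: "nat list \<Rightarrow> (nat \<times> nat \<Rightarrow> nat) \<Rightarrow> nat list" where
  "col_word l t = map (\<lambda>x. snd (inv_into (cells l) t x)) [0..<sum_list l]"

lemma length_words [simp]: "length (row_word l t) = sum_list l" "length (col_word l t) = sum_list l"
  by (simp_all add: row_word_def col_word_def)

lemma bij_tableau: "t \<in> tableaux l \<Longrightarrow> bij_betw t (cells l) {..<sum_list l}"
  by (simp add: tableaux_def)

lemma word_nth: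
  assumes t: "t \<in> tableaux l" and ij: "(i, j) \<in> cells l"
  shows "row_word l t ! t (i, j) = i" "col_word l t ! t (i, j) = j" "t (i, j) < sum_list l"
proof -
  show *: "t (i, j) < sum_list l"
    using bij_tableau[OF t] ij by (auto simp: bij_betw_def)
  have "inv_into (cells l) t (t (i, j)) = (i, j)"
    using bij_tableau[OF t] ij by (auto simp: bij_betw_def)
  then show "row_word l t ! t (i, j) = i" "col_word l t ! t (i, j) = j"
    using * by (simp_all add: row_word_def col_word_def)
qed

lemma cell_of_letter:
  assumes t: "t \<in> tableaux l" and x: "x < sum_list l"
  shows "(row_word l t ! x, col_word l t ! x) \<in> cells l" "t (row_word l t ! x, col_word l t ! x) = x"
proof -
  have "x \<in> t ` cells l"
    using bij_tableau[OF t] x by (auto simp: bij_betw_def)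
  then show "(row_word l t ! x, col_word l t ! x) \<in> cells l" "t (row_word l t ! x, col_word l t ! x) = x"
    using x inv_into_into[of x t "cells l"] f_inv_into_f[of x t "cells l"]
    by (simp_all add: row_word_def col_word_def)
qed

lemma set_zip_words: "t \<in> tableaux l \<Longrightarrow> set (zip (row_word l t) (col_word l t)) = cells l"
proof (intro set_eqI iffI)
  fix z assume t: "t \<in> tableaux l"
  {
    assume "z \<in> set (zip (row_word l t) (col_word l t))"
    then obtain x where "x < sum_list l" "z = (row_word l t ! x, col_word l t ! x)"
      by (auto simp: set_zip)
    then show "z \<in> cells l"
      using cell_of_letter(1)[OF t] by simp
  next
    assume "z \<in> cells l"
    moreover obtain i j where "z = (i, j)" by (cases z)
    ultimately show "z \<in> set (zip (row_word l t) (col_word l t))"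
      using word_nth[OF t, of i j] by (auto simp: set_zip intro!: exI[of _ "t (i, j)"])
  }
qed

lemma tableau_words:
  assumes l: "is_partition l" and t: "t \<in> tableaux l"
  shows "tableau (row_word l t) (col_word l t)"
proof -
  have "x = y" if "x < sum_list l" "y < sum_list l"
    "row_word l t ! x = row_word l t ! y" "col_word l t ! x = col_word l t ! y" for x y
    using cell_of_letter(2)[OF t that(1)] cell_of_letter(2)[OF t that(2)] that(3,4) by metis
  then have "distinct (zip (row_word l t) (col_word l t))"
    by (intro iffD2[OF distinct_zip_iff]) auto
  moreover have "(i', j) \<in> cells l" if "(i, j) \<in> cells l" "i' < i" for i j i'
  proof -
    have "l ! i \<le> l ! i'"
      using l that by (auto simp: is_partition_def cells_def sorted_wrt_iff_nth_less)
    then show ?thesis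
      using that by (auto simp: cells_def)
  qed
  ultimately show ?thesis
    by (simp add: tableau_def set_zip_words[OF t])
qed

lemma mset_row_word:
  assumes l: "is_partition l" and t: "t \<in> tableaux l"
  shows "mset (row_word l t) = row_content l"
proof (rule multiset_eqI)
  fix i
  have "{k. (i, k) \<in> cells l} = {..<count (row_content l) i}"
    by (auto simp: cells_eq)
  then show "count (mset (row_word l t)) i = count (row_content l) i"
    using count_row(1)[OF tableau_words[OF l t], of i] set_zip_words[OF t] by simp
qed

lemma tableau_from_words:
  assumes rc: "tableau r c" and set: "set (zip r c) = cells l" and r: "mset r = row_content l"
  obtains t where "t \<in> tableaux l" "row_word l t = r" "col_word l t = c"
proof -
  have len: "length r = length c" "length r = sum_list l"
    using rc arg_cong[OF r, of size] by (simp_all add: tableau_def size_row_content)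
  have d: "distinct (zip r c)"
    using rc by (simp add: tableau_def)
  define u where "u = (\<lambda>x. (r ! x, c ! x))"
  have u: "bij_betw u {..<sum_list l} (cells l)"
  proof (rule bij_betw_imageI)
    show "inj_on u {..<sum_list l}"
      using d len by (auto simp: u_def inj_on_def distinct_zip_iff)
    show "u ` {..<sum_list l} = cells l"
      unfolding set[symmetric] using len by (auto simp: u_def set_zip)
  qed
  define t where "t = restrict (inv_into {..<sum_list l} u) (cells l)"
  have "bij_betw t (cells l) {..<sum_list l} \<longleftrightarrow> bij_betw (inv_into {..<sum_list l} u) (cells l) {..<sum_list l}"
    by (intro bij_betw_cong) (simp add: t_def)
  then have t: "t \<in> tableaux l"
    using bij_betw_inv_into[OF u] by (auto simp: tableaux_def t_def)
  have "u x \<in> cells l" "t (u x) = x" if "x < sum_list l" for x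
    using u that by (auto simp: t_def bij_betw_def inv_into_f_f)
  then have "row_word l t ! x = r ! x" "col_word l t ! x = c ! x" if "x < sum_list l" for x
    using word_nth(1,2)[OF t, of "r ! x" "c ! x"] that by (auto simp: u_def)
  then have "row_word l t = r" "col_word l t = c"
    using len by (auto intro!: nth_equalityI)
  with t that show ?thesis by blast
qed

lemma tableaux_nonempty: "tableaux l \<noteq> {}"
proof -
  have "cells l = (SIGMA i:{..<length l}. {..<l ! i})"
    by (auto simp: cells_def)
  then have "finite (cells l)" "card (cells l) = sum_list l"
    by (simp_all add: sum_list_sum_nth atLeast0LessThan)
  then obtain u where "bij_betw u (cells l) {..<sum_list l}"
    using ex_bij_betw_finite_nat[of "cells l"] by (auto simp: atLeast0LessThan)
  then have "restrict u (cells l) \<in> tableaux l"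
    unfolding tableaux_def by (simp add: bij_betw_cong[of "cells l" "restrict u (cells l)" u])
  then show ?thesis by auto
qed

lemma finite_tableaux: "finite (tableaux l)"
proof (rule finite_subset)
  have "cells l = (SIGMA i:{..<length l}. {..<l ! i})"
    by (auto simp: cells_def)
  then have "finite (cells l)"
    by simp
  then show "finite (cells l \<rightarrow>\<^sub>E {..<sum_list l})"
    by (intro finite_PiE) auto
  show "tableaux l \<subseteq> cells l \<rightarrow>\<^sub>E {..<sum_list l}"
    by (auto simp: tableaux_def bij_betw_def PiE_def)
qed

definition tabloid_of_word :: "nat list \<Rightarrow> nat list \<Rightarrow> nat set list" where
  "tabloid_of_word l w = map (\<lambda>i. {x. x < length w \<and> w ! x = i}) [0..<length l]"

lemma tabloid_of_word_permute:
  assumes p: "p permutes {..<length w}"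
  shows "map (image (inv p)) (tabloid_of_word l w) = tabloid_of_word l (permute_list p w)"
proof -
  have "inv p ` {x. x < length w \<and> w ! x = i} = {x. x < length w \<and> permute_list p w ! x = i}" for i
  proof (intro set_eqI iffI)
    fix y assume "y \<in> inv p ` {x. x < length w \<and> w ! x = i}"
    then show "y \<in> {x. x < length w \<and> permute_list p w ! x = i}"
      using p permutes_in_image[OF permutes_inv[OF p]] permutes_inverses[OF p]
      by (auto simp: permute_list_nth)
  next
    fix y assume "y \<in> {x. x < length w \<and> permute_list p w ! x = i}"
    then have "y = inv p (p y)" "p y < length w" "w ! p y = i"
      using p permutes_in_image[OF p] permutes_inverses[OF p] by (auto simp: permute_list_nth)
    then show "y \<in> inv p ` {x. x < length w \<and> w ! x = i}"
      by blast
  qed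
  then show ?thesis
    by (simp add: tabloid_of_word_def)
qed

lemma column_stabilizer_eq:
  assumes t: "t \<in> tableaux l"
  shows "column_stabilizer l t = stab (col_word l t)"
proof -
  have "(\<forall>(i, j)\<in>cells l. \<exists>i'. (i', j) \<in> cells l \<and> s (t (i, j)) = t (i', j)) \<longleftrightarrow>
      permute_list s (col_word l t) = col_word l t" (is "?A \<longleftrightarrow> ?B") if s: "s permutes {..<sum_list l}" for s
  proof
    assume A: ?A
    show ?B
    proof (rule nth_equalityI)
      fix x assume "x < length (permute_list s (col_word l t))"
      then have x: "x < sum_list l" by simp
      from cell_of_letter[OF t x] A obtain i' where
        "(i', col_word l t ! x) \<in> cells l" "s x = t (i', col_word l t ! x)"
        by fastforce
      then have "col_word l t ! s x = col_word l t ! x"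
        using word_nth(2)[OF t] by simp
      then show "permute_list s (col_word l t) ! x = col_word l t ! x"
        using s x by (simp add: permute_list_nth)
    qed simp
  next
    assume B: ?B
    have "\<exists>i'. (i', j) \<in> cells l \<and> s (t (i, j)) = t (i', j)" if ij: "(i, j) \<in> cells l" for i j
    proof -
      define x where "x = t (i, j)"
      have x: "x < sum_list l" "s x < sum_list l"
        using word_nth(3)[OF t ij] permutes_in_image[OF s] by (auto simp: x_def)
      have "col_word l t ! s x = j"
        using permute_list_nth[of s "col_word l t" x] B s x word_nth(2)[OF t ij] by (simp add: x_def)
      then show ?thesis
        using cell_of_letter[OF t x(2)] by (auto simp: x_def)
    qed
    then show ?A by auto
  qed
  then show ?thesis
    unfolding column_stabilizer_def stab_def length_words by (intro Collect_cong conj_cong refl)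
qed

lemma tabloid_eq_iff:
  assumes t: "t \<in> tableaux l" and w: "mset w = row_content l" and s: "s permutes {..<sum_list l}"
  shows "tabloid l (s \<circ> t) = tabloid_of_word l w \<longleftrightarrow> permute_list s w = row_word l t"
proof -
  have len: "length w = sum_list l"
    using arg_cong[OF w, of size] by (simp add: size_row_content)
  have "tabloid l (s \<circ> t) = tabloid_of_word l w \<longleftrightarrow>
      (\<forall>i<length l. {s (t (i, j)) | j. j < l ! i} = {x. x < length w \<and> w ! x = i})"
    by (simp add: tabloid_def tabloid_of_word_def Ball_def)
  also have "\<dots> \<longleftrightarrow> permute_list s w = row_word l t"
  proof
    assume A: "\<forall>i<length l. {s (t (i, j)) | j. j < l ! i} = {x. x < length w \<and> w ! x = i}"
    show "permute_list s w = row_word l t"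
    proof (rule nth_equalityI)
      fix x assume "x < length (permute_list s w)"
      then have x: "x < sum_list l" using len by simp
      define i j where "i = row_word l t ! x" and "j = col_word l t ! x"
      have ij: "i < length l" "j < l ! i" "t (i, j) = x"
        using cell_of_letter[OF t x] by (auto simp: i_def j_def cells_def)
      then have "s x \<in> {s (t (i, j)) | j. j < l ! i}"
        by auto
      then have "w ! s x = i"
        using A ij by auto
      then show "permute_list s w ! x = row_word l t ! x"
        using s x len by (simp add: permute_list_nth i_def)
    qed (simp add: len)
  next
    assume B: "permute_list s w = row_word l t"
    have B': "w ! s x = row_word l t ! x" "s x < sum_list l" if "x < sum_list l" for x
      using B permute_list_nth[of s w x] s len that permutes_in_image[OF s] by auto
    show "\<forall>i<length l. {s (t (i, j)) | j. j < l ! i} = {x. x < length w \<and> w ! x = i}"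
    proof (intro allI impI set_eqI iffI)
      fix i y assume i: "i < length l" and "y \<in> {s (t (i, j)) | j. j < l ! i}"
      then obtain j where "(i, j) \<in> cells l" "y = s (t (i, j))"
        by (auto simp: cells_def)
      then show "y \<in> {x. x < length w \<and> w ! x = i}"
        using word_nth[OF t] B' len by auto
    next
      fix i y assume i: "i < length l" and "y \<in> {x. x < length w \<and> w ! x = i}"
      then have y: "y < sum_list l" "w ! y = i"
        using len by auto
      define x where "x = inv s y"
      have x: "s x = y" "x < sum_list l"
        using permutes_inverses[OF s] permutes_in_image[OF permutes_inv[OF s]] y by (auto simp: x_def)
      then have "row_word l t ! x = i"
        using B' y by auto
      then show "y \<in> {s (t (i, j)) | j. j < l ! i}"
        using cell_of_letter[OF t x(2)] x by (auto simp: cells_def intro!: exI[of _ "col_word l t ! x"])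
    qed
  qed
  finally show ?thesis .
qed

lemma polytabloid_eq_polyt:
  assumes t: "t \<in> tableaux l" and w: "mset w = row_content l"
  shows "polytabloid l t (tabloid_of_word l w) = polyt (row_word l t) (col_word l t) w"
proof -
  have "{s \<in> column_stabilizer l t. tabloid l (s \<circ> t) = tabloid_of_word l w} =
      {p \<in> stab (col_word l t). permute_list p w = row_word l t}"
    using tabloid_eq_iff[OF t w] by (auto simp: column_stabilizer_eq[OF t] stab_def)
  then show ?thesis
    by (simp only: polytabloid_def polyt_def)
qed

lemma polytabloid_support:
  assumes l: "is_partition l" and t: "t \<in> tableaux l" and nz: "polytabloid l t T \<noteq> 0"
  shows "\<exists>w. mset w = row_content l \<and> T = tabloid_of_word l w"
proof -
  obtain s where s: "s \<in> column_stabilizer l t" "tabloid l (s \<circ> t) = T"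
    using nz unfolding polytabloid_def by (auto elim: sum.not_neutral_contains_not_neutral)
  then have sp: "s permutes {..<sum_list l}"
    by (simp add: column_stabilizer_def)
  define w where "w = permute_list (inv s) (row_word l t)"
  have "mset w = row_content l"
    using mset_row_word[OF l t] permutes_inv[OF sp] by (simp add: w_def)
  moreover have "permute_list s w = row_word l t"
    using sp by (simp add: w_def permute_list_inv_cancel)
  ultimately have "tabloid l (s \<circ> t) = tabloid_of_word l w"
    using tabloid_eq_iff[OF t _ sp, of w] by simp
  then show ?thesis
    using s(2) \<open>mset w = row_content l\<close> by (intro exI[of _ w]) simp
qed

lemma specht_span: "rep_space (specht l) = cfun.span (polytabloid l ` tableaux l)"
proof
  show "rep_space (specht l) \<subseteq> cfun.span (polytabloid l ` tableaux l)"
  proof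
    fix f assume "f \<in> rep_space (specht l)"
    then obtain a where "f = (\<lambda>T. \<Sum>t\<in>tableaux l. a t * polytabloid l t T)"
      by (auto simp: specht_def)
    then have "f = (\<Sum>t\<in>tableaux l. (\<lambda>T. a t * polytabloid l t T))"
      by (auto simp: sum_fun_apply)
    also have "\<dots> \<in> cfun.span (polytabloid l ` tableaux l)"
      by (intro cfun.span_sum cfun.span_scale cfun.span_base) auto
    finally show "f \<in> cfun.span (polytabloid l ` tableaux l)" .
  qed
  show "cfun.span (polytabloid l ` tableaux l) \<subseteq> rep_space (specht l)"
  proof (rule cfun.span_minimal)
    show "polytabloid l ` tableaux l \<subseteq> rep_space (specht l)"
    proof
      fix f assume "f \<in> polytabloid l ` tableaux l"
      then obtain t where t: "t \<in> tableaux l" "f = polytabloid l t" by auto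
      have "f = (\<lambda>T. \<Sum>t'\<in>tableaux l. (if t' = t then 1 else 0) * polytabloid l t' T)"
        using t finite_tableaux by (auto simp: if_distrib[of "\<lambda>x. x * _"] sum.delta cong: if_cong)
      then show "f \<in> rep_space (specht l)"
        by (auto simp: specht_def)
    qed
    show "cfun.subspace (rep_space (specht l))"
      unfolding cfun.subspace_def
    proof (intro conjI ballI allI)
      show "0 \<in> rep_space (specht l)"
        by (auto simp: specht_def intro!: exI[of _ "\<lambda>_. 0"])
    next
      fix f g assume "f \<in> rep_space (specht l)" "g \<in> rep_space (specht l)"
      then obtain a b where "f = (\<lambda>T. \<Sum>t\<in>tableaux l. a t * polytabloid l t T)"
          "g = (\<lambda>T. \<Sum>t\<in>tableaux l. b t * polytabloid l t T)"
        by (auto simp: specht_def)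
      then show "f + g \<in> rep_space (specht l)"
        by (auto simp: specht_def algebra_simps sum.distrib intro!: exI[of _ "\<lambda>t. a t + b t"])
    next
      fix k f assume "f \<in> rep_space (specht l)"
      then obtain a where "f = (\<lambda>T. \<Sum>t\<in>tableaux l. a t * polytabloid l t T)"
        by (auto simp: specht_def)
      then show "(\<lambda>x. k * f x) \<in> rep_space (specht l)"
        by (auto simp: specht_def sum_distrib_left mult.assoc intro!: exI[of _ "\<lambda>t. k * a t"])
    qed
  qed
qed

lemma mset_permute_list_iff:
  assumes "p permutes {..<size \<kappa>}"
  shows "mset (permute_list p w) = \<kappa> \<longleftrightarrow> mset w = \<kappa>"
proof (cases "length w = size \<kappa>")
  case False
  then have "mset v \<noteq> \<kappa>" if "length v = length w" for v
    using that by (metis size_mset)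
  then show ?thesis by simp
qed (use assms in simp)

lemma tableau_permute:
  assumes "tableau r c" "p permutes {..<length c}"
  shows "tableau (permute_list p r) (permute_list p c)"
proof -
  have len: "length r = length c"
    using assms by (simp add: tableau_def)
  have "distinct (permute_list p (zip r c))" "set (permute_list p (zip r c)) = set (zip r c)"
    using assms len by (auto simp: tableau_def)
  then show ?thesis
    using assms len by (simp add: tableau_def permute_list_zip_same_length)
qed

lemma polyt_permute:
  assumes rc: "tableau r c" and p: "p permutes {..<length c}"
  shows "(\<lambda>w. polyt r c (permute_list p w)) = polyt (permute_list (inv p) r) (permute_list (inv p) c)"
proof
  fix w
  have len: "length r = length c"
    using rc by (simp add: tableau_def)
  have ip: "inv p permutes {..<length c}"
    using p by (rule permutes_inv)
  show "polyt r c (permute_list p w) = polyt (permute_list (inv p) r) (permute_list (inv p) c) w"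
  proof (cases "length w = length c")
    case True
    then have "polyt r c (permute_list p w) =
        polyt (permute_list (inv p) r) (permute_list (inv p) c) (permute_list (inv p) (permute_list p w))"
      using ip len by (intro polyt_translate[symmetric]) auto
    then show ?thesis
      using True p by (simp add: permute_list_inv_cancel)
  next
    case False
    then have "mset (permute_list p w) \<noteq> mset r" "mset w \<noteq> mset (permute_list (inv p) r)"
      using len by (auto dest!: mset_eq_length)
    then show ?thesis
      using len by (simp add: polyt_eq_0)
  qed
qed

lemma Specht_permute:
  assumes f: "f \<in> Specht \<kappa>" and p: "p permutes {..<size \<kappa>}"
  shows "(\<lambda>w. f (permute_list p w)) \<in> Specht \<kappa>"
  using f
proof (induction rule: Specht_induct)
  case zero
  then show ?case using Specht_0 by (simp add: zero_fun_def)
next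
  case (add f g)
  then show ?case using Specht_add[OF add] by (simp add: plus_fun_def)
next
  case (scale a f)
  then show ?case by (rule Specht_scale)
next
  case (polyt r c)
  then have len: "length r = length c" "length c = size \<kappa>"
    by (auto simp: tableau_def)
  have ip: "inv p permutes {..<length c}"
    using p len by (simp add: permutes_inv)
  have "polyt (permute_list (inv p) r) (permute_list (inv p) c) \<in> Specht (mset (permute_list (inv p) r))"
    by (intro polyt_in_Specht tableau_permute polyt(1) ip)
  then show ?case
    using polyt_permute[OF polyt(1)] polyt(2) p ip len by simp
qed

definition wspecht :: "nat list \<Rightarrow> nat list perm_rep" where
  "wspecht l = \<lparr>rep_space = Specht (row_content l), pt_act = (\<lambda>p. permute_list (inv p))\<rparr>"

lemma rep_act_wspecht:
  assumes "p permutes A"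
  shows "rep_act (wspecht l) p f w = f (permute_list p w)"
  using permutes_inv_inv[OF assms] by (simp add: rep_act_def wspecht_def)

text \<open>The isomorphism evaluates a function at the tabloids of words; it takes polytabloids to polytabloids. That
  permutations preserve the module of tabloids is pulled back from words, where it is
  \<open>Specht_permute\<close>.\<close>

theorem specht_iso_wspecht:
  assumes l: "is_partition l"
  shows "rep_iso (sum_list l) (specht l) (wspecht l)"
    and "f \<in> rep_space (specht l) \<Longrightarrow> p permutes {..<sum_list l} \<Longrightarrow>
      rep_act (specht l) p f \<in> rep_space (specht l)"
proof -
  define \<Phi> where "\<Phi> f = (\<lambda>w. if mset w = row_content l then f (tabloid_of_word l w) else 0)"
    for f :: "nat set list \<Rightarrow> complex"
  have lin: "cfun_linear \<Phi>"
    by (auto simp: cfun_linear_iff \<Phi>_def)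
  have \<Phi>: "\<Phi> (polytabloid l t) = polyt (row_word l t) (col_word l t)" if "t \<in> tableaux l" for t
    using polytabloid_eq_polyt[OF that] polyt_eq_0[of "row_word l t" "col_word l t"] mset_row_word[OF l that]
    by (auto simp: \<Phi>_def)
  have "\<Phi> ` (polytabloid l ` tableaux l) = {polyt r c | r c. tableau r c \<and> mset r = row_content l}"
  proof (intro set_eqI iffI)
    fix f assume "f \<in> \<Phi> ` (polytabloid l ` tableaux l)"
    then obtain t where "t \<in> tableaux l" "f = polyt (row_word l t) (col_word l t)"
      using \<Phi> by auto
    then show "f \<in> {polyt r c | r c. tableau r c \<and> mset r = row_content l}"
      using tableau_words[OF l] mset_row_word[OF l] by blast
  next
    fix f assume "f \<in> {polyt r c | r c. tableau r c \<and> mset r = row_content l}"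
    then obtain r c where f: "f = polyt r c" "tableau r c" "mset r = row_content l" by blast
    obtain \<pi> where \<pi>: "inj_on \<pi> (set c)" "set (zip r (map \<pi> c)) = {(i, j). j < count (mset r) i}"
      using sorted_columns[OF f(2)] .
    then obtain t where "t \<in> tableaux l" "row_word l t = r" "col_word l t = map \<pi> c"
      using tableau_from_words[OF tableau_relabel[OF f(2) \<pi>(1)], of l] f(3) by (auto simp: cells_eq)
    then have "f = \<Phi> (polytabloid l t)" "t \<in> tableaux l"
      using \<Phi> polyt_relabel[OF \<pi>(1)] f(1) by auto
    then show "f \<in> \<Phi> ` (polytabloid l ` tableaux l)"
      by blast
  qed
  then have im: "\<Phi> ` rep_space (specht l) = Specht (row_content l)"
    using cfun_pair.linear_span_image[OF lin, of "polytabloid l ` tableaux l"]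
    unfolding specht_span Specht_def by metis
  have supp: "\<exists>w. mset w = row_content l \<and> T = tabloid_of_word l w"
    if f: "f \<in> rep_space (specht l)" and nz: "f T \<noteq> 0" for f T
  proof -
    obtain a where "f = (\<lambda>T. \<Sum>t\<in>tableaux l. a t * polytabloid l t T)"
      using f by (auto simp: specht_def)
    then obtain t where "t \<in> tableaux l" "polytabloid l t T \<noteq> 0"
      using nz by (auto elim: sum.not_neutral_contains_not_neutral)
    then show ?thesis
      using polytabloid_support[OF l] by blast
  qed
  have eq: "f = g" if sup: "\<And>T. f T \<noteq> 0 \<or> g T \<noteq> 0 \<Longrightarrow> \<exists>w. mset w = row_content l \<and> T = tabloid_of_word l w"
    and fg: "\<Phi> f = \<Phi> g" for f g
  proof
    fix T
    show "f T = g T"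
    proof (cases "f T \<noteq> 0 \<or> g T \<noteq> 0")
      case True
      then obtain w where w: "mset w = row_content l" "T = tabloid_of_word l w"
        using sup by blast
      then show ?thesis
        using fun_cong[OF fg, of w] by (simp add: \<Phi>_def)
    qed auto
  qed
  have inj: "inj_on \<Phi> (rep_space (specht l))"
    using supp by (intro inj_onI eq) auto
  have "bij_betw \<Phi> (rep_space (specht l)) (rep_space (wspecht l))"
    using im inj by (simp add: bij_betw_def wspecht_def)
  moreover have act: "\<Phi> (rep_act (specht l) p f) = rep_act (wspecht l) p (\<Phi> f)"
    if p: "p permutes {..<sum_list l}" for p f
  proof
    fix w
    have len: "length w = sum_list l" if "mset w = row_content l"
      using arg_cong[OF that, of size] by (simp add: size_row_content)
    have iff: "mset (permute_list p w) = row_content l \<longleftrightarrow> mset w = row_content l"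
    proof (cases "length w = sum_list l")
      case False
      then have "mset v \<noteq> row_content l" if "length v = length w" for v :: "nat list"
        using that by (metis size_row_content size_mset)
      then show ?thesis by simp
    qed (use p in simp)
    show "\<Phi> (rep_act (specht l) p f) w = rep_act (wspecht l) p (\<Phi> f) w"
      unfolding rep_act_wspecht[OF p]
      using len iff p by (auto simp: \<Phi>_def rep_act_def specht_def tabloid_of_word_permute)
  qed
  ultimately show "rep_iso (sum_list l) (specht l) (wspecht l)"
    unfolding rep_iso_def by (intro exI[of _ \<Phi>]) (auto simp: \<Phi>_def)
  assume f: "f \<in> rep_space (specht l)" and p: "p permutes {..<sum_list l}"
  have "\<Phi> f \<in> Specht (row_content l)"
    using im f by blast
  moreover have "\<Phi> (rep_act (specht l) p f) = (\<lambda>w. \<Phi> f (permute_list p w))"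
    unfolding act[OF p] by (rule ext) (rule rep_act_wspecht[OF p])
  ultimately have "\<Phi> (rep_act (specht l) p f) \<in> \<Phi> ` rep_space (specht l)"
    using Specht_permute[of "\<Phi> f" "row_content l" p] p im by (simp add: size_row_content)
  then obtain g where g: "g \<in> rep_space (specht l)" "\<Phi> (rep_act (specht l) p f) = \<Phi> g"
    by blast
  have "\<exists>w. mset w = row_content l \<and> T = tabloid_of_word l w" if nz: "rep_act (specht l) p f T \<noteq> 0" for T
  proof -
    have "f (map (image (inv p)) T) \<noteq> 0"
      using nz by (simp add: rep_act_def specht_def)
    then obtain w where w: "mset w = row_content l" "map (image (inv p)) T = tabloid_of_word l w"
      using supp[OF f] by blast
    have len: "length w = sum_list l"
      using arg_cong[OF w(1), of size] by (simp add: size_row_content)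
    have "T = map (image p) (map (image (inv p)) T)"
      by (simp add: image_comp permutes_inv_o[OF p] map_idI)
    also have "\<dots> = map (image (inv (inv p))) (tabloid_of_word l w)"
      by (simp add: w(2) permutes_inv_inv[OF p])
    also have "\<dots> = tabloid_of_word l (permute_list (inv p) w)"
      using len permutes_inv[OF p] by (intro tabloid_of_word_permute) simp
    finally show ?thesis
      using len permutes_inv[OF p] w(1) by (intro exI[of _ "permute_list (inv p) w"]) simp
  qed
  then have "rep_act (specht l) p f = g"
    using supp[OF g(1)] by (intro eq[OF _ g(2)]) blast
  then show "rep_act (specht l) p f \<in> rep_space (specht l)"
    using g(1) by simp
qed

section \<open>Representations on function spaces\<close>

text \<open>The action laws are demanded on the space only: permutations of \<open>n\<close> letters do not act on words of other
  lengths.\<close>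

definition is_rep :: "nat \<Rightarrow> 'x perm_rep \<Rightarrow> bool" where
  "is_rep n V \<longleftrightarrow> cfun.subspace (rep_space V) \<and>
    (\<forall>f\<in>rep_space V. rep_act V id f = f \<and>
      (\<forall>p. p permutes {..<n} \<longrightarrow> rep_act V p f \<in> rep_space V \<and>
        (\<forall>q. q permutes {..<n} \<longrightarrow> rep_act V (p \<circ> q) f = rep_act V p (rep_act V q f))))"

lemma is_repD:
  assumes "is_rep n V"
  shows "cfun.subspace (rep_space V)"
    and "f \<in> rep_space V \<Longrightarrow> rep_act V id f = f"
    and "f \<in> rep_space V \<Longrightarrow> p permutes {..<n} \<Longrightarrow> rep_act V p f \<in> rep_space V"
    and "f \<in> rep_space V \<Longrightarrow> p permutes {..<n} \<Longrightarrow> q permutes {..<n} \<Longrightarrow>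
      rep_act V (p \<circ> q) f = rep_act V p (rep_act V q f)"
  using assms by (auto simp: is_rep_def)

lemma rep_act_linear: "cfun_linear (rep_act V p)"
  by (auto simp: cfun_linear_iff rep_act_def)

lemma cfun_linearD:
  assumes "cfun_linear \<Phi>"
  shows "\<Phi> (f + g) = \<Phi> f + \<Phi> g" "\<Phi> (\<lambda>x. a * f x) = (\<lambda>x. a * \<Phi> f x)" "\<Phi> 0 = 0"
proof -
  show "\<Phi> (f + g) = \<Phi> f + \<Phi> g" for f g
    using assms by (auto simp: cfun_linear_iff)
  show *: "\<Phi> (\<lambda>x. a * f x) = (\<lambda>x. a * \<Phi> f x)" for f a
    using assms by (auto simp: cfun_linear_iff)
  show "\<Phi> 0 = 0"
    using *[of 0 0] by (simp add: zero_fun_def)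
qed

lemma cfun_linear_sum:
  assumes "cfun_linear \<Phi>"
  shows "\<Phi> (\<Sum>i\<in>A. F i) = (\<Sum>i\<in>A. \<Phi> (F i))"
  using cfun_linearD[OF assms] by (induction A rule: infinite_finite_induct) auto

lemma cfun_linear_eq_on_span:
  assumes "cfun_linear \<Phi>" "cfun_linear \<Psi>" "\<And>f. f \<in> S \<Longrightarrow> \<Phi> f = \<Psi> f" "f \<in> cfun.span S"
  shows "\<Phi> f = \<Psi> f"
  using assms(4)
proof (induction rule: cfun.span_induct)
  case base
  show ?case
    unfolding cfun.subspace_def using cfun_linearD[OF assms(1)] cfun_linearD[OF assms(2)] by simp
qed (use assms(3) in auto)

text \<open>Isomorphisms of representations are linear on a subspace only, whereas linear algebra over the type of all
  functions wants total maps.\<close>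

lemma extend_to_linear:
  fixes \<phi> :: "('x \<Rightarrow> complex) \<Rightarrow> ('y \<Rightarrow> complex)"
  assumes V: "cfun.subspace V"
    and add: "\<And>u v. u \<in> V \<Longrightarrow> v \<in> V \<Longrightarrow> \<phi> (\<lambda>x. u x + v x) = (\<lambda>y. \<phi> u y + \<phi> v y)"
    and scale: "\<And>c v. v \<in> V \<Longrightarrow> \<phi> (\<lambda>x. c * v x) = (\<lambda>y. c * \<phi> v y)"
  obtains \<Phi> where "cfun_linear \<Phi>" "\<And>v. v \<in> V \<Longrightarrow> \<Phi> v = \<phi> v"
proof -
  obtain B where B: "B \<subseteq> V" "cfun.independent B" "V \<subseteq> cfun.span B"
    using cfun.basis_exists[of V] by metis
  obtain \<Phi> where \<Phi>: "cfun_linear \<Phi>" "\<forall>x\<in>B. \<Phi> x = \<phi> x"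
    using cfun_pair.linear_independent_extend[OF B(2), of \<phi>] by blast
  have "\<Phi> v = \<phi> v \<and> v \<in> V" if "v \<in> cfun.span B" for v
    using that
  proof (induction rule: cfun.span_induct)
    case base
    have "\<phi> 0 = 0"
      using scale[of 0 0] cfun.subspace_0[OF V] by (simp add: zero_fun_def)
    then show ?case
      unfolding cfun.subspace_def
      using cfun_linearD[OF \<Phi>(1)] add scale cfun.subspace_add[OF V] cfun.subspace_scale[OF V] cfun.subspace_0[OF V]
      by (simp add: plus_fun_def)
  qed (use \<Phi> B in auto)
  then have "\<Phi> v = \<phi> v" if "v \<in> V" for v
    using that B(3) by blast
  with \<Phi>(1) that show ?thesis by blast
qed

definition equivariant :: "nat \<Rightarrow> 'x perm_rep \<Rightarrow> 'y perm_rep \<Rightarrow> (('x \<Rightarrow> complex) \<Rightarrow> ('y \<Rightarrow> complex)) \<Rightarrow> bool" where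
  "equivariant n V W \<Phi> \<longleftrightarrow> cfun_linear \<Phi> \<and>
    (\<forall>f\<in>rep_space V. \<forall>p. p permutes {..<n} \<longrightarrow> \<Phi> (rep_act V p f) = rep_act W p (\<Phi> f))"

definition iso_pair ::
    "nat \<Rightarrow> 'x perm_rep \<Rightarrow> 'y perm_rep \<Rightarrow> (('x \<Rightarrow> complex) \<Rightarrow> ('y \<Rightarrow> complex)) \<Rightarrow> (('y \<Rightarrow> complex) \<Rightarrow> ('x \<Rightarrow> complex)) \<Rightarrow> bool" where
  "iso_pair n V W \<Phi> \<Psi> \<longleftrightarrow> equivariant n V W \<Phi> \<and> equivariant n W V \<Psi> \<and>
    (\<forall>f\<in>rep_space V. \<Phi> f \<in> rep_space W \<and> \<Psi> (\<Phi> f) = f) \<and>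
    (\<forall>f\<in>rep_space W. \<Psi> f \<in> rep_space V \<and> \<Phi> (\<Psi> f) = f)"

lemma iso_pair_bij: "iso_pair n V W \<Phi> \<Psi> \<Longrightarrow> bij_betw \<Phi> (rep_space V) (rep_space W)"
  by (rule bij_betwI[where g = \<Psi>]) (auto simp: iso_pair_def)

lemma iso_pair_imp_rep_iso: "iso_pair n V W \<Phi> \<Psi> \<Longrightarrow> rep_iso n V W"
  unfolding rep_iso_def
  by (rule exI[of _ \<Phi>])
    (auto simp: iso_pair_bij, auto simp: iso_pair_def equivariant_def cfun_linear_iff plus_fun_def)

lemma rep_iso_imp_iso_pair:
  fixes V :: "'x perm_rep" and W :: "'y perm_rep"
  assumes V: "is_rep n V" and iso: "rep_iso n V W"
  obtains \<Phi> \<Psi> where "iso_pair n V W \<Phi> \<Psi>"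
proof -
  obtain \<phi> where \<phi>: "bij_betw \<phi> (rep_space V) (rep_space W)"
    and add: "\<And>u v. u \<in> rep_space V \<Longrightarrow> v \<in> rep_space V \<Longrightarrow> \<phi> (\<lambda>x. u x + v x) = (\<lambda>y. \<phi> u y + \<phi> v y)"
    and scale: "\<And>c v. v \<in> rep_space V \<Longrightarrow> \<phi> (\<lambda>x. c * v x) = (\<lambda>y. c * \<phi> v y)"
    and act: "\<And>p v. p permutes {..<n} \<Longrightarrow> v \<in> rep_space V \<Longrightarrow> \<phi> (rep_act V p v) = rep_act W p (\<phi> v)"
    using iso unfolding rep_iso_def by blast
  obtain \<Phi> where \<Phi>: "cfun_linear \<Phi>" "\<And>v. v \<in> rep_space V \<Longrightarrow> \<Phi> v = \<phi> v"
    using extend_to_linear[OF is_repD(1)[OF V], of \<phi>] add scale by blast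
  have bij: "bij_betw \<Phi> (rep_space V) (rep_space W)"
    using \<phi> \<Phi>(2) by (simp cong: bij_betw_cong)
  obtain \<Psi> where \<Psi>: "\<Psi> ` UNIV \<subseteq> rep_space V" "cfun_linear \<Psi>" "\<forall>v\<in>rep_space V. \<Psi> (\<Phi> v) = v"
    using cfun_pair.linear_exists_left_inverse_on[OF \<Phi>(1) is_repD(1)[OF V]] bij
    by (auto simp: bij_betw_def)
  have im: "\<Phi> ` rep_space V = rep_space W"
    using bij by (simp add: bij_betw_def)
  have \<Phi>act: "\<Phi> (rep_act V p v) = rep_act W p (\<Phi> v)" if "p permutes {..<n}" "v \<in> rep_space V" for p v
    using \<Phi>(2) act that is_repD(3)[OF V] by simp
  have "\<Psi> (rep_act W p w) = rep_act V p (\<Psi> w)" if p: "p permutes {..<n}" and w: "w \<in> rep_space W" for p w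
  proof -
    obtain v where v: "v \<in> rep_space V" "w = \<Phi> v"
      using im w by blast
    then show ?thesis
      using \<Psi>(3) \<Phi>act[OF p v(1), symmetric] is_repD(3)[OF V v(1) p] by simp
  qed
  moreover have "\<Phi> (\<Psi> w) = w" if "w \<in> rep_space W" for w
    using that im \<Psi>(3) by force
  ultimately have "iso_pair n V W \<Phi> \<Psi>"
    unfolding iso_pair_def equivariant_def using \<Phi>(1) \<Psi> im \<Phi>act by auto
  then show ?thesis using that by blast
qed

lemma iso_pair_sym: "iso_pair n V W \<Phi> \<Psi> \<Longrightarrow> iso_pair n W V \<Psi> \<Phi>"
  by (auto simp: iso_pair_def)

lemma rep_iso_trans:
  assumes "rep_iso n U V" "rep_iso n V W"
  shows "rep_iso n U W"
proof -
  from assms obtain \<phi> \<psi> where \<phi>: "bij_betw \<phi> (rep_space U) (rep_space V)"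
      "\<forall>u\<in>rep_space U. \<forall>v\<in>rep_space U. \<phi> (\<lambda>x. u x + v x) = (\<lambda>y. \<phi> u y + \<phi> v y)"
      "\<forall>c. \<forall>v\<in>rep_space U. \<phi> (\<lambda>x. c * v x) = (\<lambda>y. c * \<phi> v y)"
      "\<forall>p. p permutes {..<n} \<longrightarrow> (\<forall>v\<in>rep_space U. \<phi> (rep_act U p v) = rep_act V p (\<phi> v))"
    and \<psi>: "bij_betw \<psi> (rep_space V) (rep_space W)"
      "\<forall>u\<in>rep_space V. \<forall>v\<in>rep_space V. \<psi> (\<lambda>x. u x + v x) = (\<lambda>y. \<psi> u y + \<psi> v y)"
      "\<forall>c. \<forall>v\<in>rep_space V. \<psi> (\<lambda>x. c * v x) = (\<lambda>y. c * \<psi> v y)"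
      "\<forall>p. p permutes {..<n} \<longrightarrow> (\<forall>v\<in>rep_space V. \<psi> (rep_act V p v) = rep_act W p (\<psi> v))"
    unfolding rep_iso_def by (elim exE conjE) blast
  have "\<phi> u \<in> rep_space V" if "u \<in> rep_space U" for u
    using \<phi>(1) that by (auto simp: bij_betw_def)
  then show ?thesis
    unfolding rep_iso_def using \<phi> \<psi> bij_betw_trans[OF \<phi>(1) \<psi>(1)]
    by (intro exI[of _ "\<psi> \<circ> \<phi>"]) simp
qed

lemma rep_iso_sym:
  assumes "is_rep n V" "rep_iso n V W"
  shows "rep_iso n W V"
  using rep_iso_imp_iso_pair[OF assms] iso_pair_sym iso_pair_imp_rep_iso by metis

definition outer :: "('x \<Rightarrow> complex) \<Rightarrow> ('y \<Rightarrow> complex) \<Rightarrow> 'x \<times> 'y \<Rightarrow> complex" where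
  "outer v w = (\<lambda>(x, y). v x * w y)"

lemma rep_space_tensor:
  assumes V: "cfun.subspace (rep_space V)"
  shows "rep_space (tensor_rep V W) = cfun.span {outer v w | v w. v \<in> rep_space V \<and> w \<in> rep_space W}"
    (is "?L = cfun.span ?G")
proof
  show "?L \<subseteq> cfun.span ?G"
  proof
    fix F assume "F \<in> ?L"
    then obtain m v w where F: "F = (\<lambda>(x, y). \<Sum>k<(m::nat). v k x * w k y)"
      and vw: "\<forall>k<m. v k \<in> rep_space V \<and> w k \<in> rep_space W"
      by (auto simp: tensor_rep_def)
    have "F = (\<Sum>k<m. outer (v k) (w k))"
      by (auto simp: F sum_fun_apply outer_def)
    also have "\<dots> \<in> cfun.span ?G"
      by (intro cfun.span_sum cfun.span_base) (use vw in auto)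
    finally show "F \<in> cfun.span ?G" .
  qed
  show "cfun.span ?G \<subseteq> ?L"
  proof (rule cfun.span_minimal)
    have single: "outer v w \<in> ?L" if "v \<in> rep_space V" "w \<in> rep_space W" for v w
      unfolding tensor_rep_def using that
      by (auto simp: outer_def intro!: exI[of _ "1::nat"] exI[of _ "\<lambda>_. v"] exI[of _ "\<lambda>_. w"])
    then show "?G \<subseteq> ?L" by auto
    show "cfun.subspace ?L"
      unfolding cfun.subspace_def
    proof (intro conjI ballI allI)
      have "(\<lambda>(x, y). 0) \<in> ?L"
        by (auto simp: tensor_rep_def intro!: exI[of _ "0::nat"])
      moreover have "(\<lambda>(x, y). 0) = (0 :: 'a \<times> 'b \<Rightarrow> complex)"
        by (rule ext) auto
      ultimately show "0 \<in> ?L"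
        by simp
    next
      fix F G assume "F \<in> ?L" "G \<in> ?L"
      then obtain m v w m' v' w' where F: "F = (\<lambda>(x, y). \<Sum>k<(m::nat). v k x * w k y)"
        and vw: "\<forall>k<m. v k \<in> rep_space V \<and> w k \<in> rep_space W"
        and G: "G = (\<lambda>(x, y). \<Sum>k<(m'::nat). v' k x * w' k y)"
        and vw': "\<forall>k<m'. v' k \<in> rep_space V \<and> w' k \<in> rep_space W"
        unfolding tensor_rep_def by auto
      define v'' where "v'' k = (if k < m then v k else v' (k - m))" for k
      define w'' where "w'' k = (if k < m then w k else w' (k - m))" for k
      have split: "(\<Sum>k<m + m'. h k) = (\<Sum>k<m. h k) + (\<Sum>k<m'. h (m + k))" for h :: "nat \<Rightarrow> complex"
        by (induction m') (simp_all add: add.assoc)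
      have "(\<Sum>k<m + m'. v'' k x * w'' k y) = (\<Sum>k<m. v k x * w k y) + (\<Sum>k<m'. v' k x * w' k y)" for x y
        unfolding split by (intro arg_cong2[where f = "(+)"] sum.cong) (auto simp: v''_def w''_def)
      then have "F + G = (\<lambda>(x, y). \<Sum>k<m + m'. v'' k x * w'' k y)"
        by (auto simp: F G)
      moreover have "\<forall>k<m + m'. v'' k \<in> rep_space V \<and> w'' k \<in> rep_space W"
        using vw vw' by (auto simp: v''_def w''_def)
      ultimately show "F + G \<in> ?L"
        unfolding tensor_rep_def by auto
    next
      fix a F assume "F \<in> ?L"
      then obtain m v w where F: "F = (\<lambda>(x, y). \<Sum>k<(m::nat). v k x * w k y)"
        and vw: "\<forall>k<m. v k \<in> rep_space V \<and> w k \<in> rep_space W"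
        by (auto simp: tensor_rep_def)
      have "(\<lambda>x. a * F x) = (\<lambda>(x, y). \<Sum>k<m. (a * v k x) * w k y)"
        by (auto simp: F sum_distrib_left mult.assoc)
      moreover have "\<forall>k<m. (\<lambda>x. a * v k x) \<in> rep_space V \<and> w k \<in> rep_space W"
        using vw cfun.subspace_scale[OF V] by auto
      ultimately show "(\<lambda>x. a * F x) \<in> ?L"
        unfolding tensor_rep_def by (auto intro!: exI[of _ m] exI[of _ "\<lambda>k x. a * v k x"] exI[of _ w])
    qed
  qed
qed

lemma outer_in_tensor:
  assumes "is_rep n V" "v \<in> rep_space V" "w \<in> rep_space W"
  shows "outer v w \<in> rep_space (tensor_rep V W)"
  unfolding rep_space_tensor[OF is_repD(1)[OF assms(1)]] using assms by (intro cfun.span_base) auto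

lemma rep_act_outer: "rep_act (tensor_rep V W) p (outer v w) = outer (rep_act V p v) (rep_act W p w)"
  by (auto simp: rep_act_def tensor_rep_def outer_def)

lemma cfun_linear_compose: "cfun_linear \<Phi> \<Longrightarrow> cfun_linear \<Psi> \<Longrightarrow> cfun_linear (\<lambda>f. \<Psi> (\<Phi> f))"
  by (simp add: cfun_linear_iff)

lemma cfun_linear_id: "cfun_linear (\<lambda>f. f)"
  by (simp add: cfun_linear_iff)

lemma cfun_linear_image_span:
  assumes "cfun_linear \<Phi>" "\<And>f. f \<in> S \<Longrightarrow> \<Phi> f \<in> cfun.span T" "f \<in> cfun.span S"
  shows "\<Phi> f \<in> cfun.span T"
  using assms(3)
proof (induction rule: cfun.span_induct)
  case base
  show ?case
    unfolding cfun.subspace_def using cfun_linearD[OF assms(1)]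
    by (simp add: cfun.span_zero cfun.span_add cfun.span_scale)
qed (use assms(2) in auto)

lemma is_rep_tensor:
  assumes V: "is_rep n V" and W: "is_rep n W"
  shows "is_rep n (tensor_rep V W)"
  unfolding is_rep_def rep_space_tensor[OF is_repD(1)[OF V]]
proof (intro conjI ballI allI impI)
  let ?G = "{outer v w | v w. v \<in> rep_space V \<and> w \<in> rep_space W}"
  fix F assume F: "F \<in> cfun.span ?G"
  show "rep_act (tensor_rep V W) id F = F"
    by (rule cfun_linear_eq_on_span[OF rep_act_linear cfun_linear_id _ F])
      (auto simp: rep_act_outer is_repD(2)[OF V] is_repD(2)[OF W])
  fix p assume p: "p permutes {..<n}"
  show "rep_act (tensor_rep V W) p F \<in> cfun.span ?G"
  proof (rule cfun_linear_image_span[OF rep_act_linear _ F])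
    fix f assume "f \<in> ?G"
    then obtain v w where "f = outer v w" "v \<in> rep_space V" "w \<in> rep_space W" by blast
    then show "rep_act (tensor_rep V W) p f \<in> cfun.span ?G"
      using is_repD(3)[OF V _ p, of v] is_repD(3)[OF W _ p, of w]
      unfolding rep_act_outer by (intro cfun.span_base) (auto simp: rep_act_outer)
  qed
  fix q assume q: "q permutes {..<n}"
  show "rep_act (tensor_rep V W) (p \<circ> q) F = rep_act (tensor_rep V W) p (rep_act (tensor_rep V W) q F)"
    by (rule cfun_linear_eq_on_span[OF rep_act_linear cfun_linear_compose[OF rep_act_linear rep_act_linear] _ F])
      (use is_repD(4)[OF V _ p q] is_repD(4)[OF W _ p q] in \<open>auto simp: rep_act_outer\<close>)
qed simp

text \<open>The tensor product of two linear maps, applied to one variable after the other.\<close>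

definition tensor_map :: "(('x \<Rightarrow> complex) \<Rightarrow> ('x' \<Rightarrow> complex)) \<Rightarrow> (('y \<Rightarrow> complex) \<Rightarrow> ('y' \<Rightarrow> complex)) \<Rightarrow>
    ('x \<times> 'y \<Rightarrow> complex) \<Rightarrow> ('x' \<times> 'y' \<Rightarrow> complex)" where
  "tensor_map \<phi> \<psi> F = (\<lambda>(x', y'). \<psi> (\<lambda>y. \<phi> (\<lambda>x. F (x, y)) x') y')"

lemma tensor_map_linear:
  assumes "cfun_linear \<phi>" "cfun_linear \<psi>"
  shows "cfun_linear (tensor_map \<phi> \<psi>)"
proof -
  have "\<phi> (\<lambda>x. F x + G x) = (\<lambda>x. \<phi> F x + \<phi> G x)" "\<psi> (\<lambda>x. F' x + G' x) = (\<lambda>x. \<psi> F' x + \<psi> G' x)" for F G F' G'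
    using assms by (simp_all add: cfun_linear_iff plus_fun_def)
  then show ?thesis
    using cfun_linearD(2)[OF assms(1)] cfun_linearD(2)[OF assms(2)]
    by (auto simp: cfun_linear_iff tensor_map_def)
qed

lemma tensor_map_outer:
  assumes "cfun_linear \<phi>" "cfun_linear \<psi>"
  shows "tensor_map \<phi> \<psi> (outer v w) = outer (\<phi> v) (\<psi> w)"
proof -
  have \<phi>: "\<phi> (\<lambda>x. v x * a) = (\<lambda>x. a * \<phi> v x)" for a
    using cfun_linearD(2)[OF assms(1), of a v] by (simp add: mult.commute)
  have "tensor_map \<phi> \<psi> (outer v w) (x, y) = outer (\<phi> v) (\<psi> w) (x, y)" for x y
  proof -
    have "tensor_map \<phi> \<psi> (outer v w) (x, y) = \<psi> (\<lambda>y. w y * \<phi> v x) y"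
      by (simp add: tensor_map_def outer_def \<phi>)
    also have "(\<lambda>y. w y * \<phi> v x) = (\<lambda>y. \<phi> v x * w y)"
      by (simp add: mult.commute)
    also have "\<psi> (\<lambda>y. \<phi> v x * w y) y = outer (\<phi> v) (\<psi> w) (x, y)"
      using cfun_linearD(2)[OF assms(2), of "\<phi> v x" w] by (simp add: outer_def)
    finally show ?thesis .
  qed
  then show ?thesis by (intro ext) auto
qed

lemma iso_pair_tensor:
  assumes reps: "is_rep n V" "is_rep n W" "is_rep n V'" "is_rep n W'"
    and \<phi>: "iso_pair n V V' \<phi> \<phi>'" and \<psi>: "iso_pair n W W' \<psi> \<psi>'"
  shows "iso_pair n (tensor_rep V W) (tensor_rep V' W') (tensor_map \<phi> \<psi>) (tensor_map \<phi>' \<psi>')"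
proof -
  have half: "equivariant n (tensor_rep V W) (tensor_rep V' W') (tensor_map \<phi> \<psi>) \<and>
      (\<forall>F\<in>rep_space (tensor_rep V W). tensor_map \<phi> \<psi> F \<in> rep_space (tensor_rep V' W') \<and>
        tensor_map \<phi>' \<psi>' (tensor_map \<phi> \<psi> F) = F)"
    if V: "is_rep n V" and V': "is_rep n V'" and \<phi>: "iso_pair n V V' \<phi> \<phi>'" and \<psi>: "iso_pair n W W' \<psi> \<psi>'"
    for V :: "'x perm_rep" and W :: "'y perm_rep" and V' :: "'z perm_rep" and W' :: "'u perm_rep"
      and \<phi> \<psi> \<phi>' \<psi>'
  proof -
    have lin: "cfun_linear \<phi>" "cfun_linear \<psi>" "cfun_linear \<phi>'" "cfun_linear \<psi>'"
      using \<phi> \<psi> by (auto simp: iso_pair_def equivariant_def)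
    note tlin = tensor_map_linear[OF lin(1,2)] tensor_map_linear[OF lin(3,4)]
    let ?G = "{outer v w | v w. v \<in> rep_space V \<and> w \<in> rep_space W}"
    have gen: "tensor_map \<phi> \<psi> (rep_act (tensor_rep V W) p f) = rep_act (tensor_rep V' W') p (tensor_map \<phi> \<psi> f)"
        "tensor_map \<phi> \<psi> f \<in> cfun.span {outer v w | v w. v \<in> rep_space V' \<and> w \<in> rep_space W'}"
        "tensor_map \<phi>' \<psi>' (tensor_map \<phi> \<psi> f) = f"
      if f: "f \<in> ?G" and p: "p permutes {..<n}" for f p
    proof -
      obtain v w where vw: "f = outer v w" "v \<in> rep_space V" "w \<in> rep_space W"
        using f by blast
      have v: "\<phi> (rep_act V p v) = rep_act V' p (\<phi> v)" "\<phi> v \<in> rep_space V'" "\<phi>' (\<phi> v) = v"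
        using \<phi> vw(2) p by (simp_all add: iso_pair_def equivariant_def)
      have w: "\<psi> (rep_act W p w) = rep_act W' p (\<psi> w)" "\<psi> w \<in> rep_space W'" "\<psi>' (\<psi> w) = w"
        using \<psi> vw(3) p by (simp_all add: iso_pair_def equivariant_def)
      show "tensor_map \<phi> \<psi> (rep_act (tensor_rep V W) p f) = rep_act (tensor_rep V' W') p (tensor_map \<phi> \<psi> f)"
        by (simp only: vw rep_act_outer tensor_map_outer[OF lin(1,2)] v w)
      show "tensor_map \<phi>' \<psi>' (tensor_map \<phi> \<psi> f) = f"
        by (simp only: vw tensor_map_outer[OF lin(1,2)] tensor_map_outer[OF lin(3,4)] v w)
      show "tensor_map \<phi> \<psi> f \<in> cfun.span {outer v w | v w. v \<in> rep_space V' \<and> w \<in> rep_space W'}"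
        unfolding vw tensor_map_outer[OF lin(1,2)] using v w by (intro cfun.span_base) blast
    qed
    have "tensor_map \<phi> \<psi> (rep_act (tensor_rep V W) p F) = rep_act (tensor_rep V' W') p (tensor_map \<phi> \<psi> F)"
      if F: "F \<in> cfun.span ?G" and p: "p permutes {..<n}" for F p
      by (rule cfun_linear_eq_on_span[OF cfun_linear_compose[OF rep_act_linear tlin(1)]
            cfun_linear_compose[OF tlin(1) rep_act_linear] _ F]) (rule gen(1)[OF _ p])
    moreover have "tensor_map \<phi> \<psi> F \<in> cfun.span {outer v w | v w. v \<in> rep_space V' \<and> w \<in> rep_space W'}"
      if F: "F \<in> cfun.span ?G" for F
      by (rule cfun_linear_image_span[OF tlin(1) _ F]) (rule gen(2)[OF _ permutes_id])
    moreover have "tensor_map \<phi>' \<psi>' (tensor_map \<phi> \<psi> F) = F" if F: "F \<in> cfun.span ?G" for F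
      by (rule cfun_linear_eq_on_span[OF cfun_linear_compose[OF tlin] cfun_linear_id _ F])
        (rule gen(3)[OF _ permutes_id])
    ultimately show ?thesis
      unfolding equivariant_def rep_space_tensor[OF is_repD(1)[OF V]] rep_space_tensor[OF is_repD(1)[OF V']]
      using tlin by blast
  qed
  show ?thesis
    unfolding iso_pair_def
    using half[OF reps(1,3) \<phi> \<psi>] half[OF reps(3,1) iso_pair_sym[OF \<phi>] iso_pair_sym[OF \<psi>]] by blast
qed

lemma rep_iso_multiple_sum:
  assumes "\<And>i. i \<in> I \<Longrightarrow> rep_iso n (R i) (R' i)"
  shows "rep_iso n (multiple_sum_rep I m R) (multiple_sum_rep I m R')"
proof -
  define P where "P i \<phi> \<longleftrightarrow> bij_betw \<phi> (rep_space (R i)) (rep_space (R' i)) \<and>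
      (\<forall>u\<in>rep_space (R i). \<forall>v\<in>rep_space (R i). \<phi> (\<lambda>x. u x + v x) = (\<lambda>y. \<phi> u y + \<phi> v y)) \<and>
      (\<forall>c. \<forall>v\<in>rep_space (R i). \<phi> (\<lambda>x. c * v x) = (\<lambda>y. c * \<phi> v y)) \<and>
      (\<forall>p. p permutes {..<n} \<longrightarrow> (\<forall>v\<in>rep_space (R i). \<phi> (rep_act (R i) p v) = rep_act (R' i) p (\<phi> v)))"
    for i \<phi>
  have "\<forall>i\<in>I. \<exists>\<phi>. P i \<phi>"
    using assms unfolding rep_iso_def P_def by blast
  then obtain \<phi> where P: "\<forall>i\<in>I. P i (\<phi> i)"
    using bchoice by metis
  have bij: "bij_betw (\<phi> i) (rep_space (R i)) (rep_space (R' i))" if "i \<in> I" for i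
    using P that unfolding P_def by blast
  have add: "\<phi> i (\<lambda>x. u x + v x) = (\<lambda>y. \<phi> i u y + \<phi> i v y)"
    if "i \<in> I" "u \<in> rep_space (R i)" "v \<in> rep_space (R i)" for i u v
    using P that unfolding P_def by blast
  have scale: "\<phi> i (\<lambda>x. c * v x) = (\<lambda>y. c * \<phi> i v y)" if "i \<in> I" "v \<in> rep_space (R i)" for i c v
    using P that unfolding P_def by blast
  have act: "\<phi> i (rep_act (R i) p v) = rep_act (R' i) p (\<phi> i v)"
    if "i \<in> I" "p permutes {..<n}" "v \<in> rep_space (R i)" for i p v
    using P that unfolding P_def by blast
  define \<psi> where "\<psi> i = inv_into (rep_space (R i)) (\<phi> i)" for i
  have \<psi>: "\<psi> i w \<in> rep_space (R i)" "\<phi> i (\<psi> i w) = w" if "i \<in> I" "w \<in> rep_space (R' i)" for i w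
    using bij_betw_inv_into_right[OF bij[OF that(1)] that(2)]
      bij_betw_apply[OF bij_betw_inv_into[OF bij[OF that(1)]] that(2)] by (simp_all add: \<psi>_def)
  have \<phi>: "\<phi> i v \<in> rep_space (R' i)" "\<psi> i (\<phi> i v) = v" if "i \<in> I" "v \<in> rep_space (R i)" for i v
    using bij[OF that(1)] that(2) unfolding \<psi>_def bij_betw_def by auto
  let ?S = "multiple_sum_rep I m R" and ?S' = "multiple_sum_rep I m R'"
  have comp: "(\<lambda>x. f (i, k, x)) \<in> rep_space (R i)" if "f \<in> rep_space ?S" "i \<in> I" "k < m i" for f i k
    using that by (simp add: multiple_sum_rep_def)
  have comp': "(\<lambda>x. f (i, k, x)) \<in> rep_space (R' i)" if "f \<in> rep_space ?S'" "i \<in> I" "k < m i" for f i k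
    using that by (simp add: multiple_sum_rep_def)
  have zero: "f (i, k, x) = 0" if "f \<in> rep_space ?S" "\<not> (i \<in> I \<and> k < m i)" for f i k x
    using that by (simp add: multiple_sum_rep_def)
  have zero': "f (i, k, x) = 0" if "f \<in> rep_space ?S'" "\<not> (i \<in> I \<and> k < m i)" for f i k x
    using that by (simp add: multiple_sum_rep_def)
  define \<Phi> where "\<Phi> f = (\<lambda>(i, k, y). if i \<in> I \<and> k < m i then \<phi> i (\<lambda>x. f (i, k, x)) y else 0)" for f
  define \<Psi> where "\<Psi> f = (\<lambda>(i, k, y). if i \<in> I \<and> k < m i then \<psi> i (\<lambda>x. f (i, k, x)) y else 0)" for f
  have "bij_betw \<Phi> (rep_space ?S) (rep_space ?S')"
  proof (rule bij_betwI[where g = \<Psi>])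
    show "\<Phi> \<in> rep_space ?S \<rightarrow> rep_space ?S'"
      using comp \<phi>(1) by (auto simp: \<Phi>_def multiple_sum_rep_def)
    show "\<Psi> \<in> rep_space ?S' \<rightarrow> rep_space ?S"
      using comp' \<psi>(1) by (auto simp: \<Psi>_def multiple_sum_rep_def)
    show "\<Psi> (\<Phi> f) = f" if "f \<in> rep_space ?S" for f
      using comp[OF that] zero[OF that] \<phi>(2) by (auto simp: \<Phi>_def \<Psi>_def)
    show "\<Phi> (\<Psi> f) = f" if "f \<in> rep_space ?S'" for f
      using comp'[OF that] zero'[OF that] \<psi>(2) by (auto simp: \<Phi>_def \<Psi>_def)
  qed
  moreover have "\<Phi> (\<lambda>x. f x + g x) = (\<lambda>y. \<Phi> f y + \<Phi> g y)" if "f \<in> rep_space ?S" "g \<in> rep_space ?S" for f g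
    using comp[OF that(1)] comp[OF that(2)] by (auto simp: \<Phi>_def add)
  moreover have "\<Phi> (\<lambda>x. c * f x) = (\<lambda>y. c * \<Phi> f y)" if "f \<in> rep_space ?S" for c f
    using comp[OF that] by (auto simp: \<Phi>_def scale)
  moreover have "\<Phi> (rep_act ?S p f) = rep_act ?S' p (\<Phi> f)" if p: "p permutes {..<n}" and f: "f \<in> rep_space ?S" for p f
  proof -
    have "\<phi> i (\<lambda>x. f (i, k, pt_act (R i) (inv p) x)) y = \<phi> i (\<lambda>x. f (i, k, x)) (pt_act (R' i) (inv p) y)"
      if "i \<in> I" "k < m i" for i k y
      using fun_cong[OF act[OF that(1) p comp[OF f that]], of y] by (simp add: rep_act_def)
    then show ?thesis
      by (auto simp: \<Phi>_def rep_act_def multiple_sum_rep_def)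
  qed
  ultimately show ?thesis
    unfolding rep_iso_def by blast
qed

lemma supported_permute_compose:
  assumes f: "supported \<kappa> f" and p: "p permutes {..<size \<kappa>}" and q: "q permutes {..<size \<kappa>}"
  shows "f (permute_list (p \<circ> q) w) = f (permute_list q (permute_list p w))"
proof (cases "length w = size \<kappa>")
  case False
  then have "mset v \<noteq> \<kappa>" if "length v = length w" for v
    using that by (metis size_mset)
  then have "f v = 0" if "length v = length w" for v
    using that f by (auto simp: supported_def)
  then show ?thesis by simp
qed (use q in \<open>simp add: permute_list_compose\<close>)

lemma is_rep_wspecht: "is_rep (sum_list l) (wspecht l)"
  unfolding is_rep_def
proof (intro conjI ballI allI impI)
  fix f assume f: "f \<in> rep_space (wspecht l)"
  then have f': "f \<in> Specht (row_content l)"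
    by (simp add: wspecht_def)
  note act = rep_act_wspecht[where l = l]
  show "rep_act (wspecht l) id f = f"
    using act[OF permutes_id] by auto
  fix p assume p: "p permutes {..<sum_list l}"
  show "rep_act (wspecht l) p f \<in> rep_space (wspecht l)"
  proof -
    have "rep_act (wspecht l) p f = (\<lambda>w. f (permute_list p w))"
      by (rule ext) (rule act[OF p])
    then show ?thesis
      using Specht_permute[OF f', of p] p by (simp add: size_row_content) (simp add: wspecht_def)
  qed
  fix q assume q: "q permutes {..<sum_list l}"
  show "rep_act (wspecht l) (p \<circ> q) f = rep_act (wspecht l) p (rep_act (wspecht l) q f)"
    using supported_permute_compose[OF supported_Specht[OF f'], of p q] p q
    by (auto simp: act[OF p] act[OF q] act[OF permutes_compose[OF q p]] size_row_content)
qed (simp add: wspecht_def subspace_Specht)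

section \<open>Irreducibility and complete decomposition\<close>

lemma sum_permutations_inv:
  "(\<Sum>p\<in>stab c. h (inv p)) = (\<Sum>p\<in>stab c. h p)"
proof -
  have "inv (inv p) = p" if "p \<in> stab c" for p
    using that by (auto simp: stab_def permutes_inv_inv)
  then show ?thesis
    by (intro sum.reindex_bij_witness[where i = inv and j = inv]) (simp_all add: stab_inv)
qed

lemma antisymmetrizer_eq_dot:
  assumes r: "mset r = \<kappa>" "length r = length c"
  shows "(\<Sum>p\<in>stab c. of_int (sign p) * f (permute_list p r)) = dot \<kappa> f (polyt r c)"
proof -
  have "dot \<kappa> f (polyt r c) = (\<Sum>w\<in>permutations_of_multiset \<kappa>. \<Sum>p\<in>stab c.
      if permute_list p w = r then of_int (sign p) * f w else 0)"
    unfolding dot_def polyt_def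
    by (intro sum.cong refl) (simp add: sum.inter_filter[OF finite_stab] sum_distrib_left if_distrib mult.commute cong: if_cong)
  also have "\<dots> = (\<Sum>p\<in>stab c. \<Sum>w\<in>permutations_of_multiset \<kappa>.
      if permute_list p w = r then of_int (sign p) * f w else 0)"
    by (rule sum.swap)
  also have "\<dots> = (\<Sum>p\<in>stab c. of_int (sign (inv p)) * f (permute_list (inv p) r))"
  proof (rule sum.cong[OF refl])
    fix p assume p: "p \<in> stab c"
    then have pp: "p permutes {..<length c}" by (simp add: stab_def)
    have mem: "permute_list (inv p) r \<in> permutations_of_multiset \<kappa>"
      using permutes_inv[OF pp] r by (simp add: permutations_of_multiset_def)
    have len: "length w = length c" if "w \<in> permutations_of_multiset \<kappa>" for w
      using that r by (metis mset_eq_length permutations_of_multisetD)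
    have "permute_list p w = r \<longleftrightarrow> w = permute_list (inv p) r" if "w \<in> permutations_of_multiset \<kappa>" for w
      using permute_list_inv_cancel[of p w] permute_list_inv_cancel[of p r] pp r len[OF that] by auto
    then have "(\<Sum>w\<in>permutations_of_multiset \<kappa>. if permute_list p w = r then of_int (sign p) * f w else 0) =
        (\<Sum>w\<in>permutations_of_multiset \<kappa>. if w = permute_list (inv p) r then of_int (sign p) * f w else 0)"
      by (intro sum.cong) auto
    also have "\<dots> = of_int (sign p) * f (permute_list (inv p) r)"
      using mem by simp
    finally show "(\<Sum>w\<in>permutations_of_multiset \<kappa>. if permute_list p w = r then of_int (sign p) * f w else 0) =
        of_int (sign (inv p)) * f (permute_list (inv p) r)"
      using stab_permutation[OF p] by (simp add: sign_inverse)
  qed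
  also have "\<dots> = (\<Sum>p\<in>stab c. of_int (sign p) * f (permute_list p r))"
    by (rule sum_permutations_inv)
  finally show ?thesis by simp
qed

definition antisym :: "nat list \<Rightarrow> (nat list \<Rightarrow> complex) \<Rightarrow> nat list \<Rightarrow> complex" where
  "antisym c f w = (\<Sum>p\<in>stab c. of_int (sign p) * f (permute_list p w))"

lemma alternating_antisym: "alternating c (antisym c f)"
  unfolding alternating_def
proof (intro ballI allI impI)
  fix q and w :: "nat list" assume q: "q \<in> stab c" and w: "length w = length c"
  have "antisym c f w = (\<Sum>p\<in>stab c. of_int (sign (q \<circ> p)) * f (permute_list (q \<circ> p) w))"
    unfolding antisym_def by (rule sum.reindex_bij_betw[OF bij_betw_stab_compose[OF q], symmetric])
  also have "\<dots> = (\<Sum>p\<in>stab c. of_int (sign q) * (of_int (sign p) * f (permute_list p (permute_list q w))))"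
    using w stab_permutation[OF q]
    by (intro sum.cong) (auto simp: sign_compose stab_permutation permute_list_compose stab_def)
  also have "\<dots> = of_int (sign q) * antisym c f (permute_list q w)"
    by (simp add: antisym_def sum_distrib_left)
  finally show "antisym c f (permute_list q w) = of_int (sign q) * antisym c f w"
    by (cases q rule: sign_cases) auto
qed

text \<open>The antisymmetrisation alternates, hence is a multiple of the polytabloid; its value at \<open>r\<close> is the factor.\<close>

lemma antisym_eq:
  assumes rc: "tableau r c" and f: "supported (mset r) f"
  shows "antisym c f = (\<lambda>w. dot (mset r) f (polyt r c) * polyt r c w)"
proof
  fix w
  have len: "length r = length c"
    using rc by (simp add: tableau_def)
  have size: "size (mset r) = length c"
    using len by simp
  show "antisym c f w = dot (mset r) f (polyt r c) * polyt r c w"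
  proof (cases "mset w = mset r")
    case True
    then have w: "length w = length c" "sum_list w = sum_list r"
      using len by (metis size_mset, metis sum_mset_sum_list)
    then have "antisym c f w = antisym c f r * polyt r c w"
      by (intro alternating_eq_polyt alternating_antisym rc) auto
    then show ?thesis
      using antisymmetrizer_eq_dot[OF refl len] by (simp add: antisym_def)
  next
    case False
    have "f (permute_list p w) = 0" if "p \<in> stab c" for p
      using that f False mset_permute_list_iff[of p "mset r" w] unfolding size
      by (auto simp: supported_def stab_def)
    then show ?thesis
      using polyt_eq_0[OF len False] by (simp add: antisym_def)
  qed
qed

text \<open>A nonzero \<open>f\<close> is not orthogonal to some polytabloid, which then is a multiple of an antisymmetrisation of \<open>f\<close>
  and lies in \<open>U\<close>. All other polytabloids are its translates.\<close>

theorem Specht_irreducible: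
  assumes U: "cfun.subspace U" "U \<subseteq> Specht \<kappa>"
    and inv: "\<And>f p. f \<in> U \<Longrightarrow> p permutes {..<size \<kappa>} \<Longrightarrow> (\<lambda>w. f (permute_list p w)) \<in> U"
    and f: "f \<in> U" "f w \<noteq> 0"
  shows "U = Specht \<kappa>"
proof -
  obtain r c where rc: "tableau r c" "mset r = \<kappa>" "dot \<kappa> f (polyt r c) \<noteq> 0"
    using dot_definite[of f \<kappa> w] f U by blast
  have len: "length r = length c" "length c = size \<kappa>"
    using rc by (auto simp: tableau_def)
  have sup: "supported (mset r) f"
    using supported_Specht[of f \<kappa>] U f rc by auto
  have "antisym c f = (\<Sum>p\<in>stab c. (\<lambda>w. of_int (sign p) * f (permute_list p w)))"
    by (auto simp: antisym_def sum_fun_apply)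
  also have "\<dots> \<in> U"
    using inv[OF f(1)] len by (intro cfun.subspace_sum[OF U(1)] cfun.subspace_scale[OF U(1)]) (auto simp: stab_def)
  finally have "(\<lambda>w. inverse (dot \<kappa> f (polyt r c)) * antisym c f w) \<in> U"
    by (rule cfun.subspace_scale[OF U(1)])
  then have P: "polyt r c \<in> U"
    using rc unfolding antisym_eq[OF rc(1) sup] by (simp add: mult.assoc[symmetric])
  have "polyt r' c' \<in> U" if rc': "tableau r' c'" "mset r' = \<kappa>" for r' c'
  proof -
    obtain q where q: "q permutes {..<length r}"
        "\<And>w. length w = length r \<Longrightarrow> polyt r' c' w = polyt r c (permute_list q w)"
      using tableaux_conjugate[OF rc(1) rc'(1)] rc rc' by auto
    have "polyt r' c' w = polyt r c (permute_list q w)" for w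
    proof (cases "length w = length r")
      case False
      have "length r' = length r"
        using rc rc' by (metis mset_eq_length)
      then have "mset (permute_list q w) \<noteq> mset r" "mset w \<noteq> mset r'"
        using False by (auto dest!: mset_eq_length)
      then show ?thesis
        using rc' len by (simp add: polyt_eq_0 tableau_def)
    qed (use q in auto)
    then have "polyt r' c' = (\<lambda>w. polyt r c (permute_list q w))"
      by (rule ext)
    then show ?thesis
      using inv[OF P, of q] q(1) len by simp
  qed
  then have "Specht \<kappa> \<subseteq> U"
    unfolding Specht_def by (intro cfun.span_minimal U) auto
  then show ?thesis
    using U by auto
qed

lemma tableau_partition:
  assumes rc: "tableau r c"
  obtains l where "is_partition l" "row_content l = mset r" "sum_list l = length r"
proof -
  define \<kappa> where "\<kappa> = mset r"
  have anti: "count \<kappa> j \<le> count \<kappa> i" if "i \<le> j" for i j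
    using that by (induction rule: dec_induct) (auto simp: \<kappa>_def intro: order_trans[OF count_row_antimono[OF rc]])
  define m where "m = (LEAST i. count \<kappa> i = 0)"
  obtain i where "i \<notin> set r"
    using ex_new_if_finite[OF infinite_UNIV_nat, of "set r"] by auto
  then have "count \<kappa> i = 0"
    by (simp add: \<kappa>_def)
  then have m: "count \<kappa> m = 0"
    unfolding m_def by (rule LeastI)
  have pos: "count \<kappa> i > 0" if "i < m" for i
    using not_less_Least[of i "\<lambda>i. count \<kappa> i = 0"] that by (simp add: m_def)
  define l where "l = map (count \<kappa>) [0..<m]"
  have "is_partition l"
    unfolding is_partition_def l_def using anti pos
    by (auto simp: sorted_wrt_map sorted_wrt_iff_nth_less)
  moreover have content: "row_content l = \<kappa>"
  proof (rule multiset_eqI)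
    fix i show "count (row_content l) i = count \<kappa> i"
      using m anti[of m i] by (auto simp: count_row_content l_def)
  qed
  moreover have "sum_list l = length r"
    using arg_cong[OF content, of size] by (simp add: size_row_content \<kappa>_def)
  ultimately show ?thesis
    using that by (simp add: \<kappa>_def)
qed

definition word_perm :: "nat \<Rightarrow> nat list \<Rightarrow> nat \<Rightarrow> nat" where
  "word_perm n w = (\<lambda>i. if i < n then w ! i else i)"

lemma word_perm_permutes:
  assumes "mset w = mset [0..<n]"
  shows "word_perm n w permutes {..<n}"
proof -
  have "length w = n"
    using mset_eq_length[OF assms] by simp
  moreover have "distinct w"
    using mset_eq_imp_distinct_iff[OF assms] by simp
  moreover have "set w = {..<n}"
    using mset_eq_setD[OF assms] by (simp add: atLeast0LessThan)
  ultimately have w: "length w = n" "distinct w" "set w = {..<n}" .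
  have "bij_betw ((!) w) {..<n} {..<n}"
    using bij_betw_nth[OF w(2)] w by blast
  moreover have "bij_betw (word_perm n w) {..<n} {..<n} \<longleftrightarrow> bij_betw ((!) w) {..<n} {..<n}"
    by (intro bij_betw_cong) (simp add: word_perm_def)
  ultimately show ?thesis
    by (intro bij_imp_permutes) (auto simp: word_perm_def)
qed

lemma word_perm_permute:
  assumes "mset w = mset [0..<n]" "p permutes {..<n}"
  shows "word_perm n (permute_list p w) = word_perm n w \<circ> p"
proof
  fix i
  have "length w = n"
    using mset_eq_length[OF assms(1)] by simp
  then show "word_perm n (permute_list p w) i = (word_perm n w \<circ> p) i"
    using permutes_in_image[OF assms(2), of i] permutes_not_in[OF assms(2), of i] assms(2)
    by (auto simp: word_perm_def permute_list_nth)
qed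

definition word_map :: "nat \<Rightarrow> 'x perm_rep \<Rightarrow> nat multiset \<Rightarrow> (('x \<Rightarrow> complex) \<Rightarrow> nat list \<Rightarrow> complex) \<Rightarrow> bool" where
  "word_map n V \<kappa> \<phi> \<longleftrightarrow> size \<kappa> = n \<and> cfun_linear \<phi> \<and>
    (\<forall>f\<in>rep_space V. supported \<kappa> (\<phi> f) \<and>
      (\<forall>p w. p permutes {..<n} \<longrightarrow> \<phi> (rep_act V p f) w = \<phi> f (permute_list p w)))"

text \<open>A word without repetitions is a permutation, so the values \<open>(p f) y\<close> at a fixed point \<open>y\<close> define a map to
  functions on such words.\<close>

lemma word_map_regular:
  assumes V: "is_rep n V" and f0: "f0 \<in> rep_space V" "f0 y \<noteq> 0"
  obtains \<phi> where "word_map n V (mset [0..<n]) \<phi>" "\<exists>w. \<phi> f0 w \<noteq> 0"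
proof -
  define \<phi> where "\<phi> f w = (if mset w = mset [0..<n] then rep_act V (word_perm n w) f y else 0)" for f w
  have "\<phi> (rep_act V p f) w = \<phi> f (permute_list p w)" if f: "f \<in> rep_space V" and p: "p permutes {..<n}" for f p w
  proof (cases "mset w = mset [0..<n]")
    case True
    then show ?thesis
      using mset_permute_list_iff[of p "mset [0..<n]" w] p is_repD(4)[OF V f word_perm_permutes[OF True] p]
      by (simp add: \<phi>_def word_perm_permute)
  next
    case False
    then show ?thesis
      using mset_permute_list_iff[of p "mset [0..<n]" w] p by (simp add: \<phi>_def)
  qed
  moreover have "cfun_linear \<phi>"
    by (auto simp: cfun_linear_iff \<phi>_def rep_act_def)
  ultimately have "word_map n V (mset [0..<n]) \<phi>"
    by (auto simp: word_map_def supported_def \<phi>_def)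
  moreover have "word_perm n [0..<n] = id"
    by (auto simp: word_perm_def)
  then have "\<phi> f0 [0..<n] \<noteq> 0"
    using f0 is_repD(2)[OF V f0(1)] by (simp add: \<phi>_def)
  ultimately show ?thesis
    using that by blast
qed

lemma word_map_raise:
  assumes \<phi>: "word_map n V \<kappa> \<phi>" and j: "Suc j \<in># \<kappa>"
  shows "word_map n V (add_mset j (\<kappa> - {#Suc j#})) (\<lambda>f. shift j (Suc j) (\<phi> f))"
  unfolding word_map_def
proof (intro conjI ballI allI impI)
  have lin: "cfun_linear \<phi>"
    using \<phi> by (simp add: word_map_def)
  have size: "size \<kappa> = n"
    using \<phi> by (simp add: word_map_def)
  show "size (add_mset j (\<kappa> - {#Suc j#})) = n"
    using size j by (simp add: size_Diff_singleton) (metis Suc_pred nonempty_has_size empty_iff set_mset_empty)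
  show "cfun_linear (\<lambda>f. shift j (Suc j) (\<phi> f))"
    using cfun_linearD[OF lin] shift_add shift_scale by (auto simp: cfun_linear_iff plus_fun_def)
  fix f assume f: "f \<in> rep_space V"
  have sup: "supported \<kappa> (\<phi> f)"
    using \<phi> f by (simp add: word_map_def)
  have sh: "mset w = add_mset j (\<kappa> - {#Suc j#})" if nz: "shift j (Suc j) (\<phi> f) w \<noteq> 0" for w
  proof -
    obtain x where x: "x < length w" "w ! x = j" "\<phi> f (w[x := Suc j]) \<noteq> 0"
      using nz unfolding shift_def by (rule sum.not_neutral_contains_not_neutral) auto
    then have "\<kappa> = add_mset (Suc j) (mset w - {#j#})" "j \<in># mset w"
      using sup by (auto simp: supported_def mset_list_update)
    then show ?thesis
      by simp
  qed
  then show "supported (add_mset j (\<kappa> - {#Suc j#})) (shift j (Suc j) (\<phi> f))"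
    by (simp add: supported_def)
  fix p w assume p: "p permutes {..<n}"
  have eq: "\<phi> (rep_act V p f) = (\<lambda>v. \<phi> f (permute_list p v))"
    using \<phi> f p by (auto simp: word_map_def)
  show "shift j (Suc j) (\<phi> (rep_act V p f)) w = shift j (Suc j) (\<phi> f) (permute_list p w)"
  proof (cases "length w = n")
    case True
    then show ?thesis
      using p by (simp add: eq shift_permute)
  next
    case False
    have "\<phi> f v = 0" if "length v = length w" for v
      using sup False size that by (auto simp: supported_def)
    then show ?thesis
      unfolding eq by (simp add: shift_def)
  qed
qed

text \<open>Take a nonzero equivariant map to words whose content has the least possible sum. Composed with a raising
  operator it goes to a content of smaller sum, so the composition is 0. The image is then in the Specht space,
  and is all of it by irreducibility.\<close>

lemma exists_map_to_Specht:
  assumes V: "is_rep n V" and f0: "f0 \<in> rep_space V" "f0 y \<noteq> 0"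
  obtains \<kappa> \<phi> where "word_map n V \<kappa> \<phi>" "\<phi> ` rep_space V = Specht \<kappa>" "\<exists>w. \<exists>f\<in>rep_space V. \<phi> f w \<noteq> 0"
proof -
  define Q where "Q s \<longleftrightarrow> (\<exists>\<kappa> \<phi>. word_map n V \<kappa> \<phi> \<and> sum_mset \<kappa> = s \<and> (\<exists>w. \<exists>f\<in>rep_space V. \<phi> f w \<noteq> 0))" for s
  have "Q (sum_mset (mset [0..<n]))"
    using word_map_regular[OF V f0] f0(1) unfolding Q_def by metis
  then have "Q (LEAST s. Q s)"
    by (rule LeastI)
  then obtain \<kappa> \<phi> where \<phi>: "word_map n V \<kappa> \<phi>" and sum: "sum_mset \<kappa> = (LEAST s. Q s)"
    and nz: "\<exists>w. \<exists>f\<in>rep_space V. \<phi> f w \<noteq> 0"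
    unfolding Q_def by blast
  have lin: "cfun_linear \<phi>" and size: "size \<kappa> = n"
    using \<phi> by (auto simp: word_map_def)
  have act: "\<phi> (rep_act V p f) = (\<lambda>w. \<phi> f (permute_list p w))"
    if "p permutes {..<n}" "f \<in> rep_space V" for p f
    using \<phi> that by (auto simp: word_map_def)
  have "shift j (Suc j) (\<phi> f) w = 0" if f: "f \<in> rep_space V" for j f w
  proof (rule ccontr)
    assume nz: "shift j (Suc j) (\<phi> f) w \<noteq> 0"
    then obtain x where "x < length w" "\<phi> f (w[x := Suc j]) \<noteq> 0"
      unfolding shift_def by (rule sum.not_neutral_contains_not_neutral) auto
    then have j: "Suc j \<in># \<kappa>"
      using \<phi> f by (force simp: word_map_def supported_def mset_list_update)
    have "Q (sum_mset (add_mset j (\<kappa> - {#Suc j#})))"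
      using word_map_raise[OF \<phi> j] nz f unfolding Q_def by blast
    moreover have "sum_mset (add_mset j (\<kappa> - {#Suc j#})) < sum_mset \<kappa>"
      using sum_mset.remove[OF j] by simp
    ultimately show False
      unfolding sum using not_less_Least by blast
  qed
  then have sub: "\<phi> ` rep_space V \<subseteq> Specht \<kappa>"
    using \<phi> by (auto intro!: highest_weight_in_Specht simp: word_map_def)
  have "\<phi> ` rep_space V = Specht \<kappa>"
  proof -
    obtain w f where "f \<in> rep_space V" "\<phi> f w \<noteq> 0" using nz by blast
    moreover have "cfun.subspace (\<phi> ` rep_space V)"
      using cfun_pair.linear_subspace_image[OF lin is_repD(1)[OF V]] .
    moreover have "(\<lambda>w. g (permute_list p w)) \<in> \<phi> ` rep_space V"
      if "g \<in> \<phi> ` rep_space V" "p permutes {..<size \<kappa>}" for g p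
      using that act size is_repD(3)[OF V] by (auto simp flip: act intro!: imageI)
    ultimately show ?thesis
      using Specht_irreducible[OF _ sub, of "\<phi> f" w] by blast
  qed
  then show ?thesis
    using that \<phi> nz by blast
qed

text \<open>Maschke: average a linear projection over the group.\<close>

lemma invariant_projection:
  fixes V :: "'x perm_rep"
  assumes V: "is_rep n V" and W: "cfun.subspace W" "W \<subseteq> rep_space V"
    and inv: "\<And>f p. f \<in> W \<Longrightarrow> p permutes {..<n} \<Longrightarrow> rep_act V p f \<in> W"
  obtains \<pi> where "cfun_linear \<pi>" "\<And>f. f \<in> W \<Longrightarrow> \<pi> f = f" "\<And>f. f \<in> rep_space V \<Longrightarrow> \<pi> f \<in> W"
    "\<And>f p. f \<in> rep_space V \<Longrightarrow> p permutes {..<n} \<Longrightarrow> \<pi> (rep_act V p f) = rep_act V p (\<pi> f)"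
proof -
  obtain \<rho> :: "('x \<Rightarrow> complex) \<Rightarrow> 'x \<Rightarrow> complex" where \<rho>: "\<rho> ` UNIV \<subseteq> W" "cfun_linear \<rho>" "\<forall>f\<in>W. \<rho> f = f"
    using cfun_pair.linear_exists_left_inverse_on[OF cfun_linear_id W(1)] by auto
  define G where "G = {p. p permutes {..<n}}"
  have fin: "finite G"
    by (simp add: G_def finite_permutations)
  have card: "card G \<noteq> 0"
    using fin permutes_id[of "{..<n}"] unfolding G_def by (metis card_0_eq emptyE mem_Collect_eq)
  define \<pi> where "\<pi> f = (\<lambda>x. inverse (of_nat (card G)) * (\<Sum>p\<in>G. rep_act V p (\<rho> (rep_act V (inv p) f))) x)" for f
  have summand: "cfun_linear (\<lambda>f. rep_act V p (\<rho> (rep_act V (inv p) f)))" for p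
    by (intro cfun_linear_compose[OF cfun_linear_compose[OF rep_act_linear \<rho>(2)] rep_act_linear])
  have lin: "cfun_linear \<pi>"
    unfolding cfun_linear_iff \<pi>_def
    by (auto simp: sum_fun_apply cfun_linearD[OF summand] sum.distrib algebra_simps sum_distrib_left)
  have id: "\<pi> f = f" if f: "f \<in> W" for f
  proof
    fix x
    have "rep_act V p (\<rho> (rep_act V (inv p) f)) = f" if p: "p \<in> G" for p
    proof -
      have pp: "p permutes {..<n}" "inv p permutes {..<n}"
        using p by (auto simp: G_def permutes_inv)
      have "rep_act V p (\<rho> (rep_act V (inv p) f)) = rep_act V p (rep_act V (inv p) f)"
        using \<rho>(3) inv[OF f pp(2)] by simp
      also have "\<dots> = rep_act V (p \<circ> inv p) f"
        using is_repD(4)[OF V, of f p "inv p"] f W pp by auto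
      also have "\<dots> = f"
        using is_repD(2)[OF V, of f] f W permutes_inv_o(1)[OF pp(1)] by auto
      finally show ?thesis .
    qed
    then have "(\<Sum>p\<in>G. rep_act V p (\<rho> (rep_act V (inv p) f))) x = of_nat (card G) * f x"
      by (simp add: sum_fun_apply)
    then show "\<pi> f x = f x"
      using card by (simp add: \<pi>_def)
  qed
  have into: "\<pi> f \<in> W" for f
    unfolding \<pi>_def using \<rho>(1) inv by (intro cfun.subspace_scale[OF W(1)] cfun.subspace_sum[OF W(1)]) (auto simp: G_def)
  have equi: "\<pi> (rep_act V q f) = rep_act V q (\<pi> f)" if f: "f \<in> rep_space V" and q: "q permutes {..<n}" for f q
  proof -
    have iq: "inv q permutes {..<n}"
      using q by (rule permutes_inv)
    have "(\<Sum>p\<in>G. rep_act V p (\<rho> (rep_act V (inv p) (rep_act V q f)))) =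
        (\<Sum>p\<in>G. rep_act V (q \<circ> p) (\<rho> (rep_act V (inv (q \<circ> p)) (rep_act V q f))))"
    proof (rule sum.reindex_bij_witness[where j = "\<lambda>p. inv q \<circ> p" and i = "\<lambda>p. q \<circ> p"])
      fix p :: "nat \<Rightarrow> nat"
      show "q \<circ> (inv q \<circ> p) = p" "inv q \<circ> (q \<circ> p) = p"
        using permutes_inverses[OF q] by auto
      then show "rep_act V (q \<circ> (inv q \<circ> p)) (\<rho> (rep_act V (inv (q \<circ> (inv q \<circ> p))) (rep_act V q f))) =
          rep_act V p (\<rho> (rep_act V (inv p) (rep_act V q f)))"
        by simp
    qed (use q iq in \<open>auto simp: G_def intro: permutes_compose\<close>)
    also have "\<dots> = (\<Sum>p\<in>G. rep_act V q (rep_act V p (\<rho> (rep_act V (inv p) f))))"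
    proof (rule sum.cong[OF refl])
      fix p assume "p \<in> G"
      then have p: "p permutes {..<n}" "inv p permutes {..<n}"
        by (auto simp: G_def permutes_inv)
      have "inv (q \<circ> p) = inv p \<circ> inv q"
        using p(1) q by (intro o_inv_distrib permutes_bij)
      then have "inv (q \<circ> p) \<circ> q = inv p"
        using permutes_inverses[OF q] by auto
      then have "rep_act V (inv (q \<circ> p)) (rep_act V q f) = rep_act V (inv p) f"
        using is_repD(4)[OF V f permutes_inv[OF permutes_compose[OF p(1) q]] q] by simp
      moreover have "\<rho> g \<in> rep_space V" for g
        using \<rho>(1) W(2) by auto
      ultimately show "rep_act V (q \<circ> p) (\<rho> (rep_act V (inv (q \<circ> p)) (rep_act V q f))) =
          rep_act V q (rep_act V p (\<rho> (rep_act V (inv p) f)))"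
        using is_repD(4)[OF V _ q p(1)] by simp
    qed
    also have "\<dots> = rep_act V q (\<Sum>p\<in>G. rep_act V p (\<rho> (rep_act V (inv p) f)))"
      by (rule cfun_linear_sum[OF rep_act_linear, symmetric])
    finally show ?thesis
      unfolding \<pi>_def by (simp add: cfun_linearD(2)[OF rep_act_linear])
  qed
  show ?thesis
    using that[OF lin id into equi] by blast
qed

lemma cfun_linear_diff:
  assumes "cfun_linear \<Phi>"
  shows "\<Phi> (f - g) = \<Phi> f - \<Phi> g"
proof -
  have "\<Phi> (f - g) + \<Phi> g = \<Phi> f"
    by (simp add: cfun_linearD(1)[OF assms, symmetric])
  then show ?thesis by (simp add: eq_diff_eq)
qed

lemma finite_support_span:
  assumes A: "finite A" and f: "\<And>x. x \<notin> A \<Longrightarrow> f x = (0 :: complex)"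
  shows "f \<in> cfun.span ((\<lambda>a x. if x = a then 1 else 0) ` A)"
proof -
  have "f = (\<Sum>a\<in>A. (\<lambda>x. f a * (if x = a then 1 else 0)))"
  proof
    fix x show "f x = (\<Sum>a\<in>A. (\<lambda>x. f a * (if x = a then 1 else 0))) x"
      using A f[of x] by (cases "x \<in> A") (auto simp: sum_fun_apply sum.delta' if_distrib[of "(*) _"] cong: if_cong)
  qed
  also have "\<dots> \<in> cfun.span ((\<lambda>a x. if x = a then 1 else 0) ` A)"
    by (intro cfun.span_sum cfun.span_scale cfun.span_base imageI)
  finally show ?thesis .
qed

text \<open>The measure for the induction in \<open>specht_decomposition\<close>; the type of all functions is not finite-dimensional, so
  finiteness comes from the spanning set \<open>E\<close>.\<close>

lemma dim_less_of_proper_subspace: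
  assumes W: "cfun.subspace W" "W \<subseteq> V" and f: "f \<in> V" "f \<notin> W"
    and E: "finite E" "V \<subseteq> cfun.span E"
  shows "cfun.dim W < cfun.dim V"
proof -
  obtain B where B: "B \<subseteq> W" "cfun.independent B" "W \<subseteq> cfun.span B" "card B = cfun.dim W"
    using cfun.basis_exists[of W] by metis
  obtain C where C: "C \<subseteq> V" "cfun.independent C" "V \<subseteq> cfun.span C" "card C = cfun.dim V"
    using cfun.basis_exists[of V] by metis
  have "finite C"
    using cfun.independent_span_bound[OF E(1) C(2)] C(1) E(2) by auto
  have "f \<notin> cfun.span B"
    using cfun.span_minimal[OF B(1) W(1)] f by blast
  then have ind: "cfun.independent (insert f B)"
    using B(2) by (rule cfun.independent_insertI)
  have "insert f B \<subseteq> cfun.span C"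
    using B(1) W(2) f C(3) by auto
  then have "finite (insert f B)" "card (insert f B) \<le> card C"
    using cfun.independent_span_bound[OF \<open>finite C\<close> ind] by simp_all
  moreover have "f \<notin> B"
    using B(1) f by auto
  ultimately show ?thesis
    using B(4) C(4) by simp
qed

lemma rep_act_multiple_sum:
  assumes "p permutes {..<n}"
  shows "rep_act (multiple_sum_rep I g wspecht) p F (i, k, w) = F (i, k, permute_list p w)"
  using permutes_inv_inv[OF assms] by (simp add: rep_act_def multiple_sum_rep_def wspecht_def)

lemma rep_act_rep_space_update: "rep_act (V\<lparr>rep_space := W\<rparr>) = rep_act V"
  by (auto simp: rep_act_def fun_eq_iff)

lemma nonzero_Specht_partition:
  assumes "f \<in> Specht \<kappa>" "f w \<noteq> 0"
  obtains l where "is_partition l" "row_content l = \<kappa>" "sum_list l = size \<kappa>"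
proof -
  have "\<exists>r c. tableau r c \<and> mset r = \<kappa>"
  proof (rule ccontr)
    assume "\<not> ?thesis"
    then have "{polyt r c | r c. tableau r c \<and> mset r = \<kappa>} = {}"
      by blast
    then have "Specht \<kappa> = cfun.span {}"
      unfolding Specht_def by (rule arg_cong)
    then have "f = 0"
      using assms(1) by simp
    then show False using assms(2) by simp
  qed
  then obtain r c where "tableau r c" "mset r = \<kappa>" by blast
  then show ?thesis
    using tableau_partition[of r c] that by (metis size_mset)
qed

text \<open>Split off the kernel of a surjection onto a Specht space by an invariant projection, and induct on the
  dimension. Finite support makes the space finite-dimensional.\<close>

theorem specht_decomposition:
  assumes "is_rep n V" and A: "finite A" "\<And>f x. f \<in> rep_space V \<Longrightarrow> x \<notin> A \<Longrightarrow> f x = 0"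
  shows "\<exists>g. (\<forall>r. r \<notin> partitions_of n \<longrightarrow> g r = 0) \<and>
    rep_iso n V (multiple_sum_rep (partitions_of n) g wspecht)"
  using assms(1,3)
proof (induction "cfun.dim (rep_space V)" arbitrary: V rule: less_induct)
  case less
  note V = less.prems(1) and supp = less.prems(2)
  define I where "I = partitions_of n"
  have span: "rep_space V \<subseteq> cfun.span ((\<lambda>a x. if x = a then 1 else 0) ` A)"
    using finite_support_span[OF A(1)] supp by blast
  show ?case
  proof (cases "\<exists>f\<in>rep_space V. \<exists>y. f y \<noteq> 0")
    case False
    then have zero: "f y = 0" if "f \<in> rep_space V" for f y
      using that by blast
    have "f = 0" if "f \<in> rep_space V" for f
      by (rule ext) (simp add: zero[OF that])
    then have "rep_space V = {0}"
      using cfun.subspace_0[OF is_repD(1)[OF V]] by blast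
    then have V0: "rep_space V = {\<lambda>_. 0}"
      by (simp only: zero_fun_def)
    have M0: "rep_space (multiple_sum_rep I (\<lambda>_. 0) wspecht) = {\<lambda>_. 0}"
      by (auto simp: multiple_sum_rep_def)
    have "rep_iso n V (multiple_sum_rep I (\<lambda>_. 0) wspecht)"
      unfolding rep_iso_def V0 M0 by (rule exI[of _ "\<lambda>_ _. 0"]) (auto simp: bij_betw_def rep_act_def)
    then show ?thesis
      unfolding I_def by (intro exI[of _ "\<lambda>_. 0"]) auto
  next
    case True
    then obtain f0 y where f0: "f0 \<in> rep_space V" "f0 y \<noteq> 0" by blast
    obtain \<kappa> \<phi> where \<phi>: "word_map n V \<kappa> \<phi>" and im: "\<phi> ` rep_space V = Specht \<kappa>"
      and nz: "\<exists>w. \<exists>f\<in>rep_space V. \<phi> f w \<noteq> 0"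
      using exists_map_to_Specht[OF V f0] .
    have lin: "cfun_linear \<phi>" and size: "size \<kappa> = n"
      using \<phi> by (auto simp: word_map_def)
    have act: "\<phi> (rep_act V p f) w = \<phi> f (permute_list p w)" if "p permutes {..<n}" "f \<in> rep_space V" for p f w
      using \<phi> that by (auto simp: word_map_def)
    obtain f1 w1 where f1: "f1 \<in> rep_space V" "\<phi> f1 w1 \<noteq> 0"
      using nz by blast
    obtain \<nu> where \<nu>: "is_partition \<nu>" "row_content \<nu> = \<kappa>" "sum_list \<nu> = size \<kappa>"
      using nonzero_Specht_partition[of "\<phi> f1" \<kappa> w1] f1 im by blast
    have \<nu>I: "\<nu> \<in> I"
      using \<nu> size by (simp add: I_def partitions_of_def)
    define W where "W = {f \<in> rep_space V. \<phi> f = 0}"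
    have W: "cfun.subspace W" "W \<subseteq> rep_space V"
      using is_repD(1)[OF V] cfun_linearD[OF lin] unfolding W_def cfun.subspace_def by auto
    have Winv: "rep_act V p f \<in> W" if "f \<in> W" "p permutes {..<n}" for f p
      using that act is_repD(3)[OF V] by (auto simp: W_def fun_eq_iff)
    obtain \<pi> where \<pi>: "cfun_linear \<pi>" "\<And>f. f \<in> W \<Longrightarrow> \<pi> f = f" "\<And>f. f \<in> rep_space V \<Longrightarrow> \<pi> f \<in> W"
        "\<And>f p. f \<in> rep_space V \<Longrightarrow> p permutes {..<n} \<Longrightarrow> \<pi> (rep_act V p f) = rep_act V p (\<pi> f)"
      using invariant_projection[OF V W Winv] by blast
    define V2 where "V2 = V\<lparr>rep_space := W\<rparr>"
    have V2: "rep_space V2 = W" "rep_act V2 = rep_act V"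
      by (simp_all add: V2_def rep_act_rep_space_update)
    have rep2: "is_rep n V2"
      unfolding is_rep_def V2 using W Winv is_repD[OF V] by auto
    have "f1 \<notin> W"
      using f1 by (auto simp: W_def)
    then have "cfun.dim W < cfun.dim (rep_space V)"
      using dim_less_of_proper_subspace[OF W f1(1) _ _ span] A(1) by simp
    moreover have "f x = 0" if "f \<in> rep_space V2" "x \<notin> A" for f x
      using supp[of f x] that W(2) V2(1) by blast
    ultimately have "\<exists>g. (\<forall>r. r \<notin> I \<longrightarrow> g r = 0) \<and> rep_iso n V2 (multiple_sum_rep I g wspecht)"
      unfolding I_def using less.hyps[of V2, OF _ rep2] V2(1) by simp
    then obtain g2 where g2: "\<And>r. r \<notin> I \<Longrightarrow> g2 r = 0" and iso2: "rep_iso n V2 (multiple_sum_rep I g2 wspecht)"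
      by blast
    define M2 where "M2 = multiple_sum_rep I g2 wspecht"
    obtain \<Phi> \<Psi> where iso: "iso_pair n V2 M2 \<Phi> \<Psi>"
      using rep_iso_imp_iso_pair[OF rep2 iso2] unfolding M2_def by blast
    have linP: "cfun_linear \<Phi>"
      using iso by (simp add: iso_pair_def equivariant_def)
    have \<Phi>: "\<Phi> f \<in> rep_space M2" "\<Psi> (\<Phi> f) = f" if "f \<in> W" for f
      using iso that V2 by (auto simp: iso_pair_def)
    have \<Psi>: "\<Psi> F \<in> W" "\<Phi> (\<Psi> F) = F" if "F \<in> rep_space M2" for F
      using iso that V2 by (auto simp: iso_pair_def)
    have \<Phi>act: "\<Phi> (rep_act V p f) = rep_act M2 p (\<Phi> f)" if "f \<in> W" "p permutes {..<n}" for f p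
      using iso that V2 by (auto simp: iso_pair_def equivariant_def)
    define g where "g = g2(\<nu> := Suc (g2 \<nu>))"
    define M where "M = multiple_sum_rep I g wspecht"
    have memM: "F \<in> rep_space M \<longleftrightarrow> (\<forall>i k. if i \<in> I \<and> k < g i then (\<lambda>x. F (i, k, x)) \<in> rep_space (wspecht i)
        else (\<forall>x. F (i, k, x) = 0))" for F
      by (simp add: M_def multiple_sum_rep_def)
    have memM2: "F \<in> rep_space M2 \<longleftrightarrow> (\<forall>i k. if i \<in> I \<and> k < g2 i then (\<lambda>x. F (i, k, x)) \<in> rep_space (wspecht i)
        else (\<forall>x. F (i, k, x) = 0))" for F
      by (simp add: M2_def multiple_sum_rep_def)
    have g_less: "k < g i \<longleftrightarrow> k < g2 i \<or> (i = \<nu> \<and> k = g2 \<nu>)" for i k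
      by (auto simp: g_def)
    have new: "F (\<nu>, g2 \<nu>, x) = 0" if "F \<in> rep_space M2" for F x
      using that unfolding memM2 by (auto dest!: spec[of _ \<nu>] spec[of _ "g2 \<nu>"])
    \<comment> \<open>The new copy of the Specht module \<open>\<nu>\<close> gets the first free index \<open>g2 \<nu>\<close>.\<close>
    define T where "T f = (\<lambda>(i, k, x). if i = \<nu> \<and> k = g2 \<nu> then \<phi> f x else \<Phi> (\<pi> f) (i, k, x))" for f
    have T_eq: "\<phi> f = \<phi> f'" "\<pi> f = \<pi> f'" if "f \<in> rep_space V" "f' \<in> rep_space V" "T f = T f'" for f f'
    proof -
      show "\<phi> f = \<phi> f'"
      proof
        fix x show "\<phi> f x = \<phi> f' x"
          using fun_cong[OF that(3), of "(\<nu>, g2 \<nu>, x)"] by (simp add: T_def)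
      qed
      have "\<Phi> (\<pi> f) = \<Phi> (\<pi> f')"
      proof
        fix z show "\<Phi> (\<pi> f) z = \<Phi> (\<pi> f') z"
        proof (cases z)
          case (fields i k x)
          show ?thesis
            using fun_cong[OF that(3), of "(i, k, x)"] new[OF \<Phi>(1)[OF \<pi>(3)[OF that(1)]], of x]
              new[OF \<Phi>(1)[OF \<pi>(3)[OF that(2)]], of x]
            by (cases "i = \<nu> \<and> k = g2 \<nu>") (simp_all add: T_def fields)
        qed
      qed
      then show "\<pi> f = \<pi> f'"
        using \<Phi>(2)[OF \<pi>(3)] that by metis
    qed
    have "bij_betw T (rep_space V) (rep_space M)"
    proof (rule bij_betw_imageI)
      show "inj_on T (rep_space V)"
      proof (rule inj_onI)
        fix f f' assume ff: "f \<in> rep_space V" "f' \<in> rep_space V" "T f = T f'"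
        have "\<phi> (f - f') = 0" "\<pi> (f - f') = 0"
          using T_eq[OF ff] by (simp_all add: cfun_linear_diff[OF lin] cfun_linear_diff[OF \<pi>(1)])
        moreover have "f - f' \<in> rep_space V"
          using cfun.subspace_diff[OF is_repD(1)[OF V] ff(1,2)] .
        ultimately have "f - f' = 0"
          using \<pi>(2)[of "f - f'"] by (simp add: W_def)
        then show "f = f'" by simp
      qed
      show "T ` rep_space V = rep_space M"
      proof (intro subset_antisym subsetI)
        fix F assume "F \<in> T ` rep_space V"
        then obtain f where f: "f \<in> rep_space V" "F = T f" by blast
        have P: "\<Phi> (\<pi> f) \<in> rep_space M2"
          using \<Phi>(1)[OF \<pi>(3)[OF f(1)]] .
        have "\<phi> f \<in> rep_space (wspecht \<nu>)"
          using im f(1) \<nu> by (auto simp: wspecht_def)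
        show "F \<in> rep_space M"
          unfolding memM
        proof (intro allI)
          fix i k
          show "if i \<in> I \<and> k < g i then (\<lambda>x. F (i, k, x)) \<in> rep_space (wspecht i) else (\<forall>x. F (i, k, x) = 0)"
            using P[unfolded memM2, rule_format, of i k] \<open>\<phi> f \<in> rep_space (wspecht \<nu>)\<close> \<nu>I
            by (cases "i = \<nu> \<and> k = g2 \<nu>") (auto simp: f(2) T_def g_less split: if_splits)
        qed
      next
        fix F assume F: "F \<in> rep_space M"
        have "(\<lambda>x. F (\<nu>, g2 \<nu>, x)) \<in> rep_space (wspecht \<nu>)"
          using F[unfolded memM, rule_format, of \<nu> "g2 \<nu>"] \<nu>I by (simp add: g_less)
        then have "(\<lambda>x. F (\<nu>, g2 \<nu>, x)) \<in> \<phi> ` rep_space V"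
          unfolding im using \<nu>(2) by (simp add: wspecht_def)
        then obtain h where h: "h \<in> rep_space V" "\<phi> h = (\<lambda>x. F (\<nu>, g2 \<nu>, x))"
          by (elim imageE) simp
        define F2 where "F2 = (\<lambda>(i, k, x). if i = \<nu> \<and> k = g2 \<nu> then 0 else F (i, k, x))"
        have F2: "F2 \<in> rep_space M2"
          unfolding memM2
        proof (intro allI)
          fix i k
          show "if i \<in> I \<and> k < g2 i then (\<lambda>x. F2 (i, k, x)) \<in> rep_space (wspecht i) else (\<forall>x. F2 (i, k, x) = 0)"
            using F[unfolded memM, rule_format, of i k]
            by (cases "i = \<nu> \<and> k = g2 \<nu>") (auto simp: F2_def g_less split: if_splits)
        qed
        \<comment> \<open>The first two terms have the required image under \<open>\<phi>\<close> and none under \<open>\<pi>\<close>.\<close>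
        define f where "f = h - \<pi> h + \<Psi> F2"
        have mem: "\<pi> h \<in> W" "\<Psi> F2 \<in> W"
          using \<pi>(3)[OF h(1)] \<Psi>(1)[OF F2] .
        then have f: "f \<in> rep_space V"
          unfolding f_def using h(1) W(2)
          by (intro cfun.subspace_add[OF is_repD(1)[OF V]] cfun.subspace_diff[OF is_repD(1)[OF V]]) auto
        have "\<phi> f = \<phi> h"
          using mem by (simp add: f_def cfun_linearD(1)[OF lin] cfun_linear_diff[OF lin] W_def)
        moreover have "\<pi> f = \<Psi> F2"
          using mem \<pi>(2) by (simp add: f_def cfun_linearD(1)[OF \<pi>(1)] cfun_linear_diff[OF \<pi>(1)])
        ultimately have "T f = F"
          using h(2) \<Psi>(2)[OF F2] by (auto simp: T_def F2_def)
        then show "F \<in> T ` rep_space V"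
          using f by blast
      qed
    qed
    moreover have "T (\<lambda>x. u x + v x) = (\<lambda>y. T u y + T v y)" for u v
    proof -
      have "\<phi> (\<lambda>x. u x + v x) = (\<lambda>x. \<phi> u x + \<phi> v x)"
        using cfun_linearD(1)[OF lin, of u v] by (simp add: plus_fun_def)
      moreover have "\<Phi> (\<pi> (\<lambda>x. u x + v x)) = (\<lambda>x. \<Phi> (\<pi> u) x + \<Phi> (\<pi> v) x)"
        using cfun_linearD(1)[OF cfun_linear_compose[OF \<pi>(1) linP], of u v] by (simp add: plus_fun_def)
      ultimately show ?thesis
        by (auto simp: T_def)
    qed
    moreover have "T (\<lambda>x. c * v x) = (\<lambda>y. c * T v y)" for c v
      using cfun_linearD(2)[OF lin, of c v] cfun_linearD(2)[OF cfun_linear_compose[OF \<pi>(1) linP], of c v]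
      by (auto simp: T_def)
    moreover have "T (rep_act V p f) = rep_act M p (T f)" if p: "p permutes {..<n}" and f: "f \<in> rep_space V" for p f
    proof
      fix z show "T (rep_act V p f) z = rep_act M p (T f) z"
      proof (cases z)
        case (fields i k x)
        have "\<Phi> (\<pi> (rep_act V p f)) = rep_act M2 p (\<Phi> (\<pi> f))"
          using \<pi>(3,4) f p \<Phi>act by simp
        then show ?thesis
          using act[OF p f] unfolding fields M_def M2_def rep_act_multiple_sum[OF p]
          by (simp add: T_def rep_act_multiple_sum[OF p])
      qed
    qed
    ultimately have "rep_iso n V M"
      unfolding rep_iso_def by blast
    moreover have "g r = 0" if "r \<notin> I" for r
      using that g2 \<nu>I by (auto simp: g_def)
    ultimately show ?thesis
      unfolding M_def I_def by blast
  qed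
qed

section \<open>Kronecker coefficients as dimensions of invariants\<close>

definition has_dim :: "('x \<Rightarrow> complex) set \<Rightarrow> nat \<Rightarrow> bool" where
  "has_dim S k \<longleftrightarrow> (\<exists>B. finite B \<and> card B = k \<and> cfun.independent B \<and> cfun.span B = S)"

lemma has_dim_image:
  assumes S: "has_dim S k" and lin: "cfun_linear \<Phi>" and inj: "inj_on \<Phi> S"
  shows "has_dim (\<Phi> ` S) k"
proof -
  obtain B where B: "finite B" "card B = k" "cfun.independent B" "cfun.span B = S"
    using S by (auto simp: has_dim_def)
  have "cfun.independent (\<Phi> ` B)"
    using cfun_pair.linear_independent_injective_image[OF lin B(3)] inj B(4) by simp
  moreover have "cfun.span (\<Phi> ` B) = \<Phi> ` S"
    using cfun_pair.linear_span_image[OF lin, of B] B(4) by simp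
  moreover have "card (\<Phi> ` B) = k"
    using B inj cfun.span_superset[of B] by (metis card_image inj_on_subset)
  ultimately show ?thesis
    using B(1) unfolding has_dim_def by blast
qed

lemma has_dim_mono:
  assumes "has_dim S k" "has_dim T m" "S \<subseteq> T"
  shows "k \<le> m"
proof -
  obtain B C where B: "card B = k" "cfun.independent B" "cfun.span B = S"
    and C: "finite C" "card C = m" "cfun.span C = T"
    using assms by (auto simp: has_dim_def)
  have "B \<subseteq> cfun.span C"
    using cfun.span_superset[of B] B C assms(3) by auto
  then show ?thesis
    using cfun.independent_span_bound[OF C(1) B(2)] B C by auto
qed

lemma has_dim_unique: "has_dim S k \<Longrightarrow> has_dim S m \<Longrightarrow> k = m"
  using has_dim_mono[of S k S m] has_dim_mono[of S m S k] by simp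

lemma has_dim_injection:
  assumes "has_dim S k" "has_dim T m" "cfun_linear \<Phi>" "inj_on \<Phi> S" "\<Phi> ` S \<subseteq> T"
  shows "k \<le> m"
  using has_dim_mono[OF has_dim_image[OF assms(1,3,4)] assms(2,5)] .

lemma has_dim_coordinates: "has_dim {a :: nat \<Rightarrow> complex. \<forall>i\<ge>k. a i = 0} k"
proof -
  define e :: "nat \<Rightarrow> nat \<Rightarrow> complex" where "e i = (\<lambda>j. if j = i then 1 else 0)" for i
  have zero: "a j = 0" if "a \<in> cfun.span (e ` {..<m})" "j \<ge> m" for a j m
    using that(1)
  proof (induction rule: cfun.span_induct)
    case base
    show ?case by (simp add: cfun.subspace_def)
  qed (use that(2) in \<open>auto simp: e_def\<close>)
  have inj: "inj_on e {..<m}" for m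
    by (auto simp: inj_on_def e_def fun_eq_iff)
  have ind: "cfun.independent (e ` {..<m})" for m
  proof (induction m)
    case 0
    then show ?case by (simp add: cfun.independent_empty)
  next
    case (Suc m)
    have "e m \<notin> cfun.span (e ` {..<m})"
      using zero[of "e m" m m] by (auto simp: e_def)
    then show ?case
      using cfun.independent_insertI[OF _ Suc] by (simp add: lessThan_Suc)
  qed
  have "cfun.span (e ` {..<k}) = {a. \<forall>i\<ge>k. a i = 0}"
  proof
    show "cfun.span (e ` {..<k}) \<subseteq> {a. \<forall>i\<ge>k. a i = 0}"
      using zero by auto
    show "{a. \<forall>i\<ge>k. a i = 0} \<subseteq> cfun.span (e ` {..<k})"
      using finite_support_span[of "{..<k}"] by (auto simp: e_def[abs_def] not_less)
  qed
  then show ?thesis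
    unfolding has_dim_def using ind inj by (intro exI[of _ "e ` {..<k}"]) (simp add: card_image)
qed

definition invariants :: "nat \<Rightarrow> 'x perm_rep \<Rightarrow> ('x \<Rightarrow> complex) set" where
  "invariants n V = {f \<in> rep_space V. \<forall>p. p permutes {..<n} \<longrightarrow> rep_act V p f = f}"

lemma has_dim_invariants_iso:
  assumes iso: "iso_pair n V W \<Phi> \<Psi>" and V: "has_dim (invariants n V) k"
  shows "has_dim (invariants n W) k"
proof -
  have "\<Phi> ` invariants n V = invariants n W"
  proof (intro subset_antisym subsetI)
    fix g assume "g \<in> \<Phi> ` invariants n V"
    then show "g \<in> invariants n W"
      using iso by (auto simp: invariants_def iso_pair_def equivariant_def)
  next
    fix g assume g: "g \<in> invariants n W"
    then have "\<Psi> g \<in> invariants n V" "\<Phi> (\<Psi> g) = g"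
      using iso by (auto simp: invariants_def iso_pair_def equivariant_def)
    then show "g \<in> \<Phi> ` invariants n V"
      by (metis imageI)
  qed
  moreover have "inj_on \<Phi> (invariants n V)"
    using iso by (intro inj_on_inverseI[of _ \<Psi>]) (auto simp: invariants_def iso_pair_def)
  ultimately show ?thesis
    using has_dim_image[OF V, of \<Phi>] iso by (auto simp: iso_pair_def equivariant_def)
qed

lemma tensor_sections:
  assumes V: "cfun.subspace (rep_space V)" and W: "cfun.subspace (rep_space W)"
    and F: "F \<in> rep_space (tensor_rep V W)"
  shows "(\<lambda>x. F (x, y)) \<in> rep_space V" "(\<lambda>y. F (x, y)) \<in> rep_space W"
proof -
  note V' = cfun.subspace_0[OF V] cfun.subspace_add[OF V] cfun.subspace_scale[OF V]
  note W' = cfun.subspace_0[OF W] cfun.subspace_add[OF W] cfun.subspace_scale[OF W]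
  have "(\<forall>y. (\<lambda>x. F (x, y)) \<in> rep_space V) \<and> (\<forall>x. (\<lambda>y. F (x, y)) \<in> rep_space W)"
    using F unfolding rep_space_tensor[OF V]
  proof (induction rule: cfun.span_induct)
    case base
    show ?case
      unfolding cfun.subspace_def using V' W' by (simp add: plus_fun_def zero_fun_def)
  next
    case (step F)
    then obtain v w where "F = outer v w" "v \<in> rep_space V" "w \<in> rep_space W"
      by blast
    then show ?case
      using V'(3)[of v] W'(3)[of w] by (simp add: outer_def mult.commute[of _ "w _"])
  qed
  then show "(\<lambda>x. F (x, y)) \<in> rep_space V" "(\<lambda>y. F (x, y)) \<in> rep_space W"
    by auto
qed

text \<open>The kernel functions of equivariant maps between two Specht spaces, in a form that is symmetric in both.\<close>

definition biSpecht :: "nat multiset \<Rightarrow> nat multiset \<Rightarrow> (nat list \<times> nat list \<Rightarrow> complex) \<Rightarrow> bool" where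
  "biSpecht \<kappa> \<rho> F \<longleftrightarrow> size \<kappa> = size \<rho> \<and> (\<forall>w. (\<lambda>u. F (u, w)) \<in> Specht \<kappa>) \<and> (\<forall>u. (\<lambda>w. F (u, w)) \<in> Specht \<rho>) \<and>
    (\<forall>p u w. p permutes {..<size \<kappa>} \<longrightarrow> F (permute_list p u, permute_list p w) = F (u, w))"

lemma biSpecht_swap: "biSpecht \<kappa> \<rho> F \<Longrightarrow> biSpecht \<rho> \<kappa> (\<lambda>(u, w). F (w, u))"
  by (simp add: biSpecht_def)

lemma biSpecht_diff:
  assumes "biSpecht \<kappa> \<rho> F" "biSpecht \<kappa> \<rho> G"
  shows "biSpecht \<kappa> \<rho> (\<lambda>x. F x - a * G x)"
  using assms cfun.subspace_diff[OF subspace_Specht] Specht_scale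
  unfolding biSpecht_def by (simp add: fun_diff_def[abs_def])

text \<open>The image of a polytabloid under the equivariant map with kernel \<open>F\<close>.\<close>

definition contraction :: "nat list \<Rightarrow> nat list \<Rightarrow> (nat list \<times> nat list \<Rightarrow> complex) \<Rightarrow> nat list \<Rightarrow> complex" where
  "contraction r c F w = dot (mset r) (\<lambda>u. F (u, w)) (polyt r c)"

lemma sum_permute_words:
  assumes "p permutes {..<size \<kappa>}"
  shows "(\<Sum>u\<in>permutations_of_multiset \<kappa>. h (permute_list p u)) = (\<Sum>u\<in>permutations_of_multiset \<kappa>. h u)"
proof -
  have len: "length u = size \<kappa>" if "u \<in> permutations_of_multiset \<kappa>" for u
    using that by (auto simp: permutations_of_multiset_def)
  have mem: "permute_list q u \<in> permutations_of_multiset \<kappa>"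
    if "u \<in> permutations_of_multiset \<kappa>" "q permutes {..<size \<kappa>}" for q u
    using that mset_permute_list_iff[of q \<kappa> u] by (simp add: permutations_of_multiset_def)
  show ?thesis
    by (rule sum.reindex_bij_witness[where i = "permute_list (inv p)" and j = "permute_list p"])
      (simp_all add: mem assms permutes_inv permute_list_inv_cancel len)
qed

lemma contraction_permute:
  assumes F: "biSpecht \<kappa> \<rho> F" and r: "mset r = \<kappa>" and p: "p permutes {..<size \<kappa>}"
  shows "contraction r c F (permute_list p w) =
    (\<Sum>u\<in>permutations_of_multiset \<kappa>. F (u, w) * polyt r c (permute_list p u))"
proof -
  have "contraction r c F (permute_list p w) =
      (\<Sum>u\<in>permutations_of_multiset \<kappa>. F (permute_list p u, permute_list p w) * polyt r c (permute_list p u))"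
    unfolding contraction_def dot_def r by (rule sum_permute_words[OF p, symmetric])
  then show ?thesis
    using F p by (simp add: biSpecht_def)
qed

lemma alternating_contraction:
  assumes F: "biSpecht \<kappa> \<rho> F" and rc: "tableau r c" "mset r = \<kappa>"
  shows "alternating c (contraction r c F)"
  unfolding alternating_def
proof (intro ballI allI impI)
  fix p and w :: "nat list" assume p: "p \<in> stab c" and w: "length w = length c"
  have len: "length r = length c" "length c = size \<kappa>"
    using rc by (auto simp: tableau_def)
  have pp: "p permutes {..<size \<kappa>}"
    using p len by (simp add: stab_def)
  have "contraction r c F (permute_list p w) =
      (\<Sum>u\<in>permutations_of_multiset \<kappa>. of_int (sign p) * (F (u, w) * polyt r c u))"
    unfolding contraction_permute[OF F rc(2) pp]
  proof (rule sum.cong[OF refl])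
    fix u assume "u \<in> permutations_of_multiset \<kappa>"
    then have "length u = length c"
      using len by (auto simp: permutations_of_multiset_def)
    then show "F (u, w) * polyt r c (permute_list p u) = of_int (sign p) * (F (u, w) * polyt r c u)"
      using alternating_polyt[OF len(1)] p by (simp add: alternating_def)
  qed
  then show "contraction r c F (permute_list p w) = of_int (sign p) * contraction r c F w"
    by (simp add: contraction_def dot_def rc(2) sum_distrib_left)
qed

text \<open>The image of a polytabloid under an equivariant map still alternates under its column stabiliser.\<close>

lemma contraction_eq:
  assumes F: "biSpecht \<kappa> \<rho> F" and rc: "tableau r c" "mset r = \<kappa>" and le: "sum_mset \<rho> \<le> sum_mset \<kappa>"
  shows "contraction r c F w = contraction r c F r * polyt r c w"
proof (cases "mset w = \<rho>")
  case True
  have "length w = length c"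
    using True F rc by (auto simp: biSpecht_def tableau_def)
  moreover have "sum_list w \<le> sum_list r"
    using True le rc(2) by (simp add: sum_mset_sum_list[symmetric])
  ultimately show ?thesis
    by (intro alternating_eq_polyt alternating_contraction[OF F] rc)
next
  case False
  have zero: "contraction r c F v = 0" if "mset v \<noteq> \<rho>" for v
  proof -
    have "F (u, v) = 0" for u
      using supported_Specht[of "\<lambda>w. F (u, w)" \<rho>] F that by (auto simp: biSpecht_def supported_def)
    then show ?thesis
      by (simp add: contraction_def dot_def)
  qed
  have "contraction r c F r * polyt r c w = 0"
    using zero[of r] polyt_eq_0[of r c w] rc False by (cases "\<rho> = \<kappa>") (auto simp: tableau_def)
  then show ?thesis
    using zero[OF False] by simp
qed

lemma biSpecht_eq_0I:
  assumes F: "biSpecht \<kappa> \<rho> F" and "\<And>r c w. tableau r c \<Longrightarrow> mset r = \<kappa> \<Longrightarrow> contraction r c F w = 0"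
  shows "F x = 0"
proof (cases x)
  case (Pair u w)
  have "(\<lambda>u. F (u, w)) u = 0"
    by (rule dot_definite[of _ \<kappa>]) (use assms in \<open>auto simp: biSpecht_def contraction_def\<close>)
  then show ?thesis by (simp add: Pair)
qed

text \<open>Schur's lemma for different shapes. By symmetry the second content may be assumed to have the smaller sum. Each
  contraction is then a multiple of a polytabloid of the wrong content.\<close>

lemma biSpecht_distinct:
  assumes F: "biSpecht \<kappa> \<rho> F" and neq: "\<kappa> \<noteq> \<rho>"
  shows "F x = 0"
proof -
  have *: "G x = 0" if G: "biSpecht \<mu> \<nu> G" and "\<mu> \<noteq> \<nu>" "sum_mset \<nu> \<le> sum_mset \<mu>" for \<mu> \<nu> G x
  proof (rule biSpecht_eq_0I[OF G])
    fix r c w assume rc: "tableau r c" "mset r = \<mu>"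
    have "G (u, r) = 0" for u
    proof -
      have "(\<lambda>w. G (u, w)) \<in> Specht \<nu>"
        using G by (simp add: biSpecht_def)
      then show ?thesis
        using supported_Specht[of "\<lambda>w. G (u, w)" \<nu>] rc(2) that(2) unfolding supported_def by blast
    qed
    then have "contraction r c G r = 0"
      by (simp add: contraction_def dot_def)
    then show "contraction r c G w = 0"
      using contraction_eq[OF G rc that(3), of w] by simp
  qed
  show ?thesis
  proof (cases "sum_mset \<rho> \<le> sum_mset \<kappa>")
    case True
    then show ?thesis using *[OF F neq] by simp
  next
    case False
    obtain u w where x: "x = (u, w)" by (cases x)
    show ?thesis
      using *[OF biSpecht_swap[OF F], of "(w, u)"] neq False by (simp add: x)
  qed
qed

text \<open>Schur's lemma for equal shapes: a contraction is determined by its value at \<open>r\<close>, and all contractions are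
  translates of a single one.\<close>

lemma biSpecht_determined:
  assumes F: "biSpecht \<kappa> \<kappa> F" and rc: "tableau r c" "mset r = \<kappa>" and zero: "contraction r c F r = 0"
  shows "F x = 0"
proof (rule biSpecht_eq_0I[OF F])
  fix r' c' w assume rc': "tableau r' c'" "mset r' = \<kappa>"
  have zero': "contraction r c F v = 0" for v
    using contraction_eq[OF F rc, of v] zero by simp
  obtain q where q: "q permutes {..<length r}"
      "\<And>w. length w = length r \<Longrightarrow> polyt r' c' w = polyt r c (permute_list q w)"
    using tableaux_conjugate[OF rc(1) rc'(1)] rc rc' by auto
  have qp: "q permutes {..<size \<kappa>}"
    using q(1) rc(2) by auto
  have "contraction r' c' F w = (\<Sum>u\<in>permutations_of_multiset \<kappa>. F (u, w) * polyt r c (permute_list q u))"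
    unfolding contraction_def dot_def rc'(2)
  proof (rule sum.cong[OF refl])
    fix u assume "u \<in> permutations_of_multiset \<kappa>"
    then have "length u = length r"
      using rc(2) by (metis mset_eq_length permutations_of_multisetD)
    then show "F (u, w) * polyt r' c' u = F (u, w) * polyt r c (permute_list q u)"
      using q(2) by simp
  qed
  also have "\<dots> = contraction r c F (permute_list q w)"
    by (rule contraction_permute[OF F rc(2) qp, symmetric])
  finally show "contraction r' c' F w = 0"
    using zero' by simp
qed

lemma polyt_int: "\<exists>z :: int. polyt r c w = of_int z"
  unfolding polyt_def by (rule exI[of _ "\<Sum>p \<in> {p \<in> stab c. permute_list p w = r}. sign p"]) simp

definition average :: "nat \<Rightarrow> 'x perm_rep \<Rightarrow> ('x \<Rightarrow> complex) \<Rightarrow> ('x \<Rightarrow> complex)" where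
  "average n V f = (\<Sum>p | p permutes {..<n}. rep_act V p f)"

lemma average_invariant:
  assumes V: "is_rep n V" and f: "f \<in> rep_space V"
  shows "average n V f \<in> invariants n V"
proof -
  have mem: "average n V f \<in> rep_space V"
    unfolding average_def using is_repD(3)[OF V f] by (intro cfun.subspace_sum[OF is_repD(1)[OF V]]) simp
  have inv: "rep_act V q (average n V f) = average n V f" if q: "q permutes {..<n}" for q
  proof -
    have "rep_act V q (average n V f) = (\<Sum>p | p permutes {..<n}. rep_act V (q \<circ> p) f)"
      unfolding average_def cfun_linear_sum[OF rep_act_linear]
      by (intro sum.cong refl) (simp add: is_repD(4)[OF V f q])
    also have "\<dots> = average n V f"
      unfolding average_def
    proof (rule sum.reindex_bij_witness[where i = "\<lambda>p. inv q \<circ> p" and j = "\<lambda>p. q \<circ> p"])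
      fix p :: "nat \<Rightarrow> nat"
      show "inv q \<circ> (q \<circ> p) = p" "q \<circ> (inv q \<circ> p) = p"
        using permutes_inverses[OF q] by auto
      show "q \<circ> p \<in> {p. p permutes {..<n}}" if "p \<in> {p. p permutes {..<n}}"
        using that q by (simp add: permutes_compose)
      show "inv q \<circ> p \<in> {p. p permutes {..<n}}" if "p \<in> {p. p permutes {..<n}}"
        using that permutes_inv[OF q] by (simp add: permutes_compose)
    qed simp
    finally show ?thesis .
  qed
  show ?thesis
    using mem inv by (simp add: invariants_def)
qed

text \<open>The average of \<open>e \<otimes> e\<close> for a polytabloid \<open>e\<close> is not 0: its value at \<open>(r, r)\<close> is a sum of squares of integers, one of
  which is \<open>e(r) = 1\<close>.\<close>

lemma wspecht_diagonal_invariant: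
  assumes l: "is_partition l" and n: "sum_list l = n"
  obtains F0 where "F0 \<in> invariants n (tensor_rep (wspecht l) (wspecht l))" "F0 \<noteq> 0"
proof -
  obtain t where t: "t \<in> tableaux l"
    using tableaux_nonempty by blast
  define r c where "r = row_word l t" and "c = col_word l t"
  have rc: "tableau r c" "mset r = row_content l"
    using tableau_words[OF l t] mset_row_word[OF l t] by (simp_all add: r_def c_def)
  define G where "G = {p. p permutes {..<n}}"
  have fin: "finite G"
    by (simp add: G_def finite_permutations)
  have V: "is_rep n (wspecht l)"
    using is_rep_wspecht[of l] n by simp
  have P: "polyt r c \<in> rep_space (wspecht l)"
    using polyt_in_Specht[OF rc(1)] rc(2) by (simp add: wspecht_def)
  define P0 where "P0 = outer (polyt r c) (polyt r c)"
  define T where "T = tensor_rep (wspecht l) (wspecht l)"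
  have T: "is_rep n T"
    unfolding T_def by (rule is_rep_tensor[OF V V])
  have P0: "P0 \<in> rep_space T"
    unfolding P0_def T_def by (rule outer_in_tensor[OF V P P])
  define F0 where "F0 = average n T P0"
  have "\<forall>w. \<exists>z :: int. polyt r c w = of_int z"
    using polyt_int by blast
  then obtain z :: "nat list \<Rightarrow> int" where z: "\<And>w. polyt r c w = of_int (z w)"
    by metis
  have "F0 (r, r) = (\<Sum>p\<in>G. of_int (z (permute_list p r)) * of_int (z (permute_list p r)))"
    unfolding F0_def average_def sum_fun_apply P0_def T_def rep_act_outer G_def
    by (intro sum.cong refl) (auto simp: outer_def G_def rep_act_wspecht z)
  also have "\<dots> = of_int (\<Sum>p\<in>G. z (permute_list p r) * z (permute_list p r))"
    by simp
  finally have F0: "F0 (r, r) = of_int (\<Sum>p\<in>G. z (permute_list p r) * z (permute_list p r))" .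
  have "z r = 1"
    using polyt_self[OF rc(1)] z[of r] by simp
  then have "0 < (\<Sum>p\<in>G. z (permute_list p r) * z (permute_list p r))"
    using permutes_id[of "{..<n}"] by (intro sum_pos2[OF fin, of id]) (auto simp: G_def)
  then have "of_int (\<Sum>p\<in>G. z (permute_list p r) * z (permute_list p r)) \<noteq> (0 :: complex)"
    by (simp only: of_int_eq_0_iff)
  then have "F0 (r, r) \<noteq> 0"
    unfolding F0 .
  then have "F0 \<noteq> 0"
    by auto
  moreover have "F0 \<in> invariants n T"
    unfolding F0_def by (rule average_invariant[OF T P0])
  ultimately show ?thesis
    using that unfolding T_def by blast
qed

lemma invariants_biSpecht:
  assumes n: "sum_list l = n" "sum_list m = n" and F: "F \<in> invariants n (tensor_rep (wspecht l) (wspecht m))"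
  shows "biSpecht (row_content l) (row_content m) F"
proof -
  have mem: "F \<in> rep_space (tensor_rep (wspecht l) (wspecht m))"
    using F by (simp add: invariants_def)
  have sub: "cfun.subspace (rep_space (wspecht l))" for l
    by (simp add: wspecht_def subspace_Specht)
  have "F (permute_list p u, permute_list p w) = F (u, w)" if p: "p permutes {..<n}" for p u w
  proof -
    have "rep_act (tensor_rep (wspecht l) (wspecht m)) p F (u, w) = F (permute_list p u, permute_list p w)"
      using permutes_inv_inv[OF p] by (simp add: rep_act_def tensor_rep_def wspecht_def)
    then show ?thesis
      using F p by (simp add: invariants_def)
  qed
  then show ?thesis
    using tensor_sections[OF sub sub mem] n by (simp add: biSpecht_def size_row_content) (simp add: wspecht_def)
qed

lemma row_content_inj:
  assumes l: "is_partition l" and m: "is_partition m" and eq: "row_content l = row_content m"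
  shows "l = m"
proof -
  have nth: "(if i < length l then l ! i else 0) = (if i < length m then m ! i else 0)" for i
    using arg_cong[OF eq, of "\<lambda>\<kappa>. count \<kappa> i"] by (simp add: count_row_content)
  have pos: "i < length l \<Longrightarrow> l ! i \<noteq> 0" "i < length m \<Longrightarrow> m ! i \<noteq> 0" for i
    using l m by (auto simp: is_partition_def)
  have iff: "i < length l \<longleftrightarrow> i < length m" for i
    using nth[of i] pos[of i] by (auto split: if_splits)
  have "length l = length m"
    using iff[of "length l"] iff[of "length m"] by simp
  moreover have "l ! i = m ! i" if "i < length l" for i
    using nth[of i] that calculation by simp
  ultimately show ?thesis
    by (intro nth_equalityI)
qed

text \<open>By Schur's lemma only the copies of \<open>r\<close> itself contribute to the invariants, and each contributes the
  multiples of one invariant. A vector of \<open>g r\<close> coordinates therefore describes an invariant.\<close>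

lemma has_dim_invariants_multiple_sum:
  assumes r: "r \<in> partitions_of n"
  shows "has_dim (invariants n (tensor_rep (multiple_sum_rep (partitions_of n) g wspecht) (wspecht r))) (g r)"
proof -
  let ?I = "partitions_of n"
  let ?M = "multiple_sum_rep ?I g wspecht"
  have part: "is_partition l" "sum_list l = n" if "l \<in> ?I" for l
    using that by (simp_all add: partitions_of_def)
  obtain F0 where F0: "F0 \<in> invariants n (tensor_rep (wspecht r) (wspecht r))" "F0 \<noteq> 0"
    using wspecht_diagonal_invariant part[OF r] by blast
  obtain t where t: "t \<in> tableaux r"
    using tableaux_nonempty by blast
  define u c where "u = row_word r t" and "c = col_word r t"
  have uc: "tableau u c" "mset u = row_content r"
    using tableau_words[OF _ t] mset_row_word[OF _ t] part[OF r] by (simp_all add: u_def c_def)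
  have bi0: "biSpecht (row_content r) (row_content r) F0"
    using invariants_biSpecht[OF _ _ F0(1)] part[OF r] by simp
  have a0: "contraction u c F0 u \<noteq> 0"
    using biSpecht_determined[OF bi0 uc] F0(2) by (auto simp: fun_eq_iff)
  have multiple: "\<exists>a. \<forall>x. F x = a * F0 x" if bi: "biSpecht (row_content r) (row_content r) F" for F
  proof -
    define a where "a = contraction u c F u / contraction u c F0 u"
    have "contraction u c (\<lambda>x. F x - a * F0 x) u = contraction u c F u - a * contraction u c F0 u"
      by (simp add: contraction_def dot_def algebra_simps sum_subtractf sum_distrib_left)
    also have "\<dots> = 0"
      using a0 by (simp add: a_def)
    finally have "F x - a * F0 x = 0" for x
      using biSpecht_determined[OF biSpecht_diff[OF bi bi0] uc, of a x] by simp
    then show ?thesis by auto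
  qed
  have repM: "cfun.subspace (rep_space ?M)"
    unfolding cfun.subspace_def multiple_sum_rep_def
    by (auto simp: wspecht_def Specht_scale plus_fun_def zero_fun_def
        intro: Specht_add[unfolded plus_fun_def] Specht_0[unfolded zero_fun_def])
  have repr: "cfun.subspace (rep_space (wspecht r))"
    by (simp add: wspecht_def subspace_Specht)
  define \<Phi> where "\<Phi> a = (\<lambda>((i, k, v), w). if i = r then a k * F0 (v, w) else 0)" for a :: "nat \<Rightarrow> complex"
  have lin: "cfun_linear \<Phi>"
    by (auto simp: cfun_linear_iff \<Phi>_def algebra_simps)
  obtain v0 w0 where vw0: "F0 (v0, w0) \<noteq> 0"
    using F0(2) by (auto simp: fun_eq_iff)
  have inj: "inj \<Phi>"
  proof (rule injI, rule ext)
    fix a b k assume eq: "\<Phi> a = \<Phi> b"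
    show "a k = b k"
      using fun_cong[OF eq, of "((r, k, v0), w0)"] vw0 by (simp add: \<Phi>_def)
  qed
  have actM: "rep_act (tensor_rep ?M (wspecht r)) p F ((i, k, v), w) = F ((i, k, permute_list p v), permute_list p w)"
    if "p permutes {..<n}" for p F i k v w
    using permutes_inv_inv[OF that] by (simp add: rep_act_def tensor_rep_def multiple_sum_rep_def wspecht_def)
  have F0inv: "F0 (permute_list p v, permute_list p w) = F0 (v, w)" if "p permutes {..<n}" for p v w
    using bi0 that part(2)[OF r] by (simp add: biSpecht_def size_row_content)
  have "\<Phi> ` {a. \<forall>i\<ge>g r. a i = 0} = invariants n (tensor_rep ?M (wspecht r))"
  proof (intro subset_antisym subsetI)
    fix F assume "F \<in> \<Phi> ` {a. \<forall>i\<ge>g r. a i = 0}"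
    then obtain a where a: "\<forall>i\<ge>g r. a i = 0" "F = \<Phi> a" by blast
    define lift where "lift f = (\<lambda>((i, k, v), w). if i = r then a k * f (v, w) else 0)" for f :: "nat list \<times> nat list \<Rightarrow> complex"
    have "cfun_linear lift"
      by (auto simp: cfun_linear_iff lift_def algebra_simps)
    moreover have "lift f \<in> cfun.span {outer v w | v w. v \<in> rep_space ?M \<and> w \<in> rep_space (wspecht r)}"
      if "f \<in> {outer v w | v w. v \<in> rep_space (wspecht r) \<and> w \<in> rep_space (wspecht r)}" for f
    proof -
      obtain v w where f: "f = outer v w" "v \<in> rep_space (wspecht r)" "w \<in> rep_space (wspecht r)"
        using \<open>f \<in> _\<close> by blast
      define v' where "v' = (\<lambda>(i, k, x). if i = r then a k * v x else 0)"
      have "lift f = outer v' w"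
        by (auto simp: lift_def f outer_def v'_def)
      moreover have "v' \<in> rep_space ?M"
      proof -
        have "if i \<in> ?I \<and> k < g i then (\<lambda>x. v' (i, k, x)) \<in> rep_space (wspecht i) else (\<forall>x. v' (i, k, x) = 0)" for i k
          using cfun.subspace_scale[OF repr f(2), of "a k"] r a(1) Specht_0[of "row_content i"]
          by (cases "i = r") (auto simp: v'_def wspecht_def zero_fun_def not_less)
        then show ?thesis
          by (simp add: multiple_sum_rep_def)
      qed
      ultimately show ?thesis
        using f(3) by (intro cfun.span_base) blast
    qed
    moreover have "F0 \<in> cfun.span {outer v w | v w. v \<in> rep_space (wspecht r) \<and> w \<in> rep_space (wspecht r)}"
      using F0(1) unfolding invariants_def rep_space_tensor[OF repr] by blast
    ultimately have "lift F0 \<in> cfun.span {outer v w | v w. v \<in> rep_space ?M \<and> w \<in> rep_space (wspecht r)}"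
      by (rule cfun_linear_image_span)
    moreover have "lift F0 = F"
      by (simp add: lift_def a \<Phi>_def)
    ultimately have "F \<in> rep_space (tensor_rep ?M (wspecht r))"
      unfolding rep_space_tensor[OF repM] by simp
    moreover have "rep_act (tensor_rep ?M (wspecht r)) p F = F" if p: "p permutes {..<n}" for p
      using actM[OF p] F0inv[OF p] by (auto simp: a(2) \<Phi>_def fun_eq_iff)
    ultimately show "F \<in> invariants n (tensor_rep ?M (wspecht r))"
      by (simp add: invariants_def)
  next
    fix F assume F: "F \<in> invariants n (tensor_rep ?M (wspecht r))"
    then have mem: "F \<in> rep_space (tensor_rep ?M (wspecht r))"
      by (simp add: invariants_def)
    note sec = tensor_sections[OF repM repr mem]
    have zero: "F ((i, k, v), w) = 0" if "\<not> (i \<in> ?I \<and> k < g i)" for i k v w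
      using sec(1)[of w] that by (simp add: multiple_sum_rep_def)
    have bi: "biSpecht (row_content i) (row_content r) (\<lambda>(v, w). F ((i, k, v), w))" if ik: "i \<in> ?I" "k < g i" for i k
      unfolding biSpecht_def
    proof (intro conjI allI impI)
      show "size (row_content i) = size (row_content r)"
        using part ik r by (simp add: size_row_content)
      have "(\<lambda>u. F ((i, k, u), w)) \<in> rep_space (wspecht i)" for w
        using sec(1)[of w] ik by (simp add: multiple_sum_rep_def)
      then show "(\<lambda>u. (\<lambda>(v, w). F ((i, k, v), w)) (u, w)) \<in> Specht (row_content i)" for w
        by (simp add: wspecht_def)
      show "(\<lambda>w. (\<lambda>(v, w). F ((i, k, v), w)) (u, w)) \<in> Specht (row_content r)" for u
        using sec(2)[of "(i, k, u)"] by (simp add: wspecht_def)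
      fix p u w assume "p permutes {..<size (row_content i)}"
      then have p: "p permutes {..<n}"
        using part ik by (simp add: size_row_content)
      show "(\<lambda>(v, w). F ((i, k, v), w)) (permute_list p u, permute_list p w) = (\<lambda>(v, w). F ((i, k, v), w)) (u, w)"
        using actM[OF p, of F i k u w] F p by (simp add: invariants_def)
    qed
    have off: "F ((i, k, v), w) = 0" if "i \<noteq> r" for i k v w
    proof (cases "i \<in> ?I \<and> k < g i")
      case True
      then have "row_content i \<noteq> row_content r"
        using row_content_inj part r that by blast
      then show ?thesis
        using biSpecht_distinct[OF bi, of i k "(v, w)"] True by simp
    next
      case False
      show ?thesis by (rule zero[OF False])
    qed
    have "\<exists>a. \<forall>v w. F ((r, k, v), w) = a * F0 (v, w)" if "k < g r" for k
      using multiple[OF bi[OF r that]] by fastforce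
    then obtain a where a: "\<And>k v w. k < g r \<Longrightarrow> F ((r, k, v), w) = a k * F0 (v, w)"
      by metis
    define b where "b k = (if k < g r then a k else 0)" for k
    have "F = \<Phi> b"
    proof
      fix x show "F x = \<Phi> b x"
      proof (cases x)
        case (Pair y w)
        obtain i k v where "y = (i, k, v)" by (cases y)
        then show ?thesis
          using off[of i k v w] zero[of r k v w] a[of k v w]
          by (cases "i = r"; cases "k < g r") (simp_all add: \<Phi>_def b_def Pair)
      qed
    qed
    then show "F \<in> \<Phi> ` {a. \<forall>i\<ge>g r. a i = 0}"
      by (auto simp: b_def)
  qed
  then show ?thesis
    using has_dim_image[OF has_dim_coordinates[of "g r"] lin inj_on_subset[OF inj]] by simp
qed

lemma is_rep_multiple_sum: "is_rep n (multiple_sum_rep (partitions_of n) g wspecht)"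
  unfolding is_rep_def
proof (intro conjI ballI allI impI)
  let ?M = "multiple_sum_rep (partitions_of n) g wspecht"
  have rep: "is_rep n (wspecht i)" if "i \<in> partitions_of n" for i
    using that is_rep_wspecht[of i] by (simp add: partitions_of_def)
  have comp: "(\<lambda>x. rep_act ?M p f (i, k, x)) = rep_act (wspecht i) p (\<lambda>x. f (i, k, x))" for p f i k
    by (simp add: rep_act_def multiple_sum_rep_def)
  show "cfun.subspace (rep_space ?M)"
    unfolding cfun.subspace_def multiple_sum_rep_def
    by (auto simp: wspecht_def Specht_scale plus_fun_def zero_fun_def
        intro: Specht_add[unfolded plus_fun_def] Specht_0[unfolded zero_fun_def])
  fix f assume f: "f \<in> rep_space ?M"
  have mem: "(\<lambda>x. f (i, k, x)) \<in> rep_space (wspecht i)" if "i \<in> partitions_of n" "k < g i" for i k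
    using f that by (simp add: multiple_sum_rep_def)
  have zero: "(\<lambda>x. f (i, k, x)) = (\<lambda>_. 0)" if "\<not> (i \<in> partitions_of n \<and> k < g i)" for i k
    using f that by (auto simp: multiple_sum_rep_def)
  have act0: "rep_act V p (\<lambda>_. 0) = (\<lambda>_. 0)" for V :: "nat list perm_rep" and p
    by (simp add: rep_act_def)
  have eqI: "F = G" if "\<And>i k. (\<lambda>x. F (i, k, x)) = (\<lambda>x. G (i, k, x))"
    for F G :: "nat list \<times> nat \<times> nat list \<Rightarrow> complex"
    using that by (auto simp: fun_eq_iff)
  show "rep_act ?M id f = f"
  proof (rule eqI)
    fix i k show "(\<lambda>x. rep_act ?M id f (i, k, x)) = (\<lambda>x. f (i, k, x))"
      unfolding comp using is_repD(2)[OF rep mem] zero act0 by metis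
  qed
  fix p assume p: "p permutes {..<n}"
  show "rep_act ?M p f \<in> rep_space ?M"
  proof -
    have "if i \<in> partitions_of n \<and> k < g i then (\<lambda>x. rep_act ?M p f (i, k, x)) \<in> rep_space (wspecht i)
        else (\<forall>x. rep_act ?M p f (i, k, x) = 0)" for i k
    proof (cases "i \<in> partitions_of n \<and> k < g i")
      case True
      then show ?thesis
        unfolding comp using is_repD(3)[OF rep mem p] by simp
    next
      case False
      have "(\<lambda>x. rep_act ?M p f (i, k, x)) = (\<lambda>_. 0)"
        unfolding comp zero[OF False] act0 ..
      then have "\<forall>x. rep_act ?M p f (i, k, x) = 0"
        by (auto dest: fun_cong)
      then show ?thesis
        using False by (simp only: if_False simp_thms)
    qed
    then show ?thesis
      by (subst (2) multiple_sum_rep_def) simp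
  qed
  fix q assume q: "q permutes {..<n}"
  show "rep_act ?M (p \<circ> q) f = rep_act ?M p (rep_act ?M q f)"
  proof (rule eqI)
    fix i k
    show "(\<lambda>x. rep_act ?M (p \<circ> q) f (i, k, x)) = (\<lambda>x. rep_act ?M p (rep_act ?M q f) (i, k, x))"
      unfolding comp using is_repD(4)[OF rep mem p q] zero act0 by metis
  qed
qed

lemma is_rep_specht:
  assumes "is_partition l"
  shows "is_rep (sum_list l) (specht l)"
  unfolding is_rep_def
proof (intro conjI ballI allI impI)
  show "cfun.subspace (rep_space (specht l))"
    by (simp add: specht_span)
  fix f assume f: "f \<in> rep_space (specht l)"
  show "rep_act (specht l) id f = f"
    by (simp add: rep_act_def specht_def)
  fix p assume p: "p permutes {..<sum_list l}"
  show "rep_act (specht l) p f \<in> rep_space (specht l)"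
    using specht_iso_wspecht(2)[OF assms f p] .
  fix q assume q: "q permutes {..<sum_list l}"
  have "inv (p \<circ> q) = inv q \<circ> inv p"
    using p q by (intro o_inv_distrib permutes_bij)
  then show "rep_act (specht l) (p \<circ> q) f = rep_act (specht l) p (rep_act (specht l) q f)"
    by (simp add: rep_act_def specht_def image_comp o_def)
qed

text \<open>The multiplicities in the definition of \<open>kronecker\<close> exist by \<open>specht_decomposition\<close>. They are unique since each is the
  dimension of a space of invariants that only depends on the isomorphism class.\<close>

theorem has_dim_kronecker:
  assumes l: "l \<in> partitions_of n" and m: "m \<in> partitions_of n"
  shows "r \<notin> partitions_of n \<Longrightarrow> kronecker l m r = 0"
    and "r \<in> partitions_of n \<Longrightarrow> has_dim (invariants n (tensor_rep (tensor_rep (wspecht l) (wspecht m)) (wspecht r))) (kronecker l m r)"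
proof -
  let ?I = "partitions_of n"
  define A where "A = tensor_rep (wspecht l) (wspecht m)"
  define A' where "A' = tensor_rep (specht l) (specht m)"
  have part: "is_partition i" "sum_list i = n" if "i \<in> ?I" for i
    using that by (simp_all add: partitions_of_def)
  have rep: "is_rep n (wspecht i)" if "i \<in> ?I" for i
    using is_rep_wspecht[of i] part[OF that] by simp
  have rep': "is_rep n (specht i)" if "i \<in> ?I" for i
    using is_rep_specht[of i] part[OF that] by simp
  have iso: "rep_iso n (specht i) (wspecht i)" if "i \<in> ?I" for i
    using specht_iso_wspecht[of i] part[OF that] by simp
  have repA: "is_rep n A" and repA': "is_rep n A'"
    unfolding A_def A'_def using rep rep' l m by (simp_all add: is_rep_tensor)
  have isoA: "rep_iso n A' A"
  proof -
    obtain \<phi> \<phi>' \<psi> \<psi>' where "iso_pair n (specht l) (wspecht l) \<phi> \<phi>'" "iso_pair n (specht m) (wspecht m) \<psi> \<psi>'"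
      using rep_iso_imp_iso_pair[OF rep'[OF l] iso[OF l]] rep_iso_imp_iso_pair[OF rep'[OF m] iso[OF m]] by metis
    then show ?thesis
      unfolding A_def A'_def using iso_pair_tensor[OF rep'[OF l] rep'[OF m] rep[OF l] rep[OF m]]
      by (blast intro: iso_pair_imp_rep_iso)
  qed
  have isoM: "rep_iso n (multiple_sum_rep ?I g specht) (multiple_sum_rep ?I g wspecht)"
      "rep_iso n (multiple_sum_rep ?I g wspecht) (multiple_sum_rep ?I g specht)" for g
    by (intro rep_iso_multiple_sum iso rep_iso_sym[OF rep' iso]; assumption)+
  have dim: "has_dim (invariants n (tensor_rep A (wspecht i))) (g i)"
    if g: "rep_iso n A' (multiple_sum_rep ?I g specht)" and i: "i \<in> ?I" for g i
  proof -
    have "rep_iso n (multiple_sum_rep ?I g wspecht) A"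
      using rep_iso_trans[OF isoM(2) rep_iso_trans[OF rep_iso_sym[OF repA' g] isoA]] .
    then obtain \<Phi> \<Psi> where \<Phi>: "iso_pair n (multiple_sum_rep ?I g wspecht) A \<Phi> \<Psi>"
      using rep_iso_imp_iso_pair[OF is_rep_multiple_sum] by blast
    have id: "iso_pair n (wspecht i) (wspecht i) (\<lambda>f. f) (\<lambda>f. f)"
      by (simp add: iso_pair_def equivariant_def cfun_linear_id)
    show ?thesis
      using has_dim_invariants_iso[OF iso_pair_tensor[OF is_rep_multiple_sum rep[OF i] repA rep[OF i] \<Phi> id]
          has_dim_invariants_multiple_sum[OF i, of g]] .
  qed
  have "\<exists>g. (\<forall>i. i \<notin> ?I \<longrightarrow> g i = 0) \<and> rep_iso n A (multiple_sum_rep ?I g wspecht)"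
  proof (rule specht_decomposition[OF repA])
    let ?S = "permutations_of_multiset (row_content l) \<times> permutations_of_multiset (row_content m)"
    show "finite ?S" by simp
    fix F x assume F: "F \<in> rep_space A" and x: "x \<notin> ?S"
    obtain u w where uw: "x = (u, w)" by (cases x)
    have "(\<lambda>u. F (u, w)) \<in> Specht (row_content l)" "(\<lambda>w. F (u, w)) \<in> Specht (row_content m)"
      using tensor_sections[OF is_repD(1)[OF rep[OF l]] is_repD(1)[OF rep[OF m]], of F] F
      by (simp_all add: A_def wspecht_def)
    then show "F x = 0"
      using x uw by (auto dest!: supported_Specht simp: supported_def permutations_of_multiset_def)
  qed
  then obtain g where g: "\<forall>i. i \<notin> ?I \<longrightarrow> g i = 0" "rep_iso n A' (multiple_sum_rep ?I g specht)"
    using rep_iso_trans[OF isoA] rep_iso_trans[OF _ isoM(2)] by blast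
  have "(THE g. (\<forall>i. i \<notin> ?I \<longrightarrow> g i = 0) \<and> rep_iso n A' (multiple_sum_rep ?I g specht)) = g"
  proof (rule the_equality)
    fix h assume h: "(\<forall>i. i \<notin> ?I \<longrightarrow> h i = 0) \<and> rep_iso n A' (multiple_sum_rep ?I h specht)"
    show "h = g"
    proof
      fix i show "h i = g i"
        using has_dim_unique[OF dim dim, of h i g] h g by (cases "i \<in> ?I") auto
    qed
  qed (use g in blast)
  then have "kronecker l m = g"
    using part[OF l] part[OF m] by (simp add: kronecker_def A'_def)
  then show "r \<notin> ?I \<Longrightarrow> kronecker l m r = 0"
      "r \<in> ?I \<Longrightarrow> has_dim (invariants n (tensor_rep (tensor_rep (wspecht l) (wspecht m)) (wspecht r))) (kronecker l m r)"
    using dim[OF g(2)] g(1) by (simp_all add: A_def)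
qed

lemma kronecker_nonzero_imp:
  assumes "kronecker l m r \<noteq> 0"
  shows "l \<in> partitions_of (sum_list l)" "m \<in> partitions_of (sum_list l)" "r \<in> partitions_of (sum_list l)"
proof -
  show "l \<in> partitions_of (sum_list l)" "m \<in> partitions_of (sum_list l)"
    using assms by (auto simp: kronecker_def partitions_of_def split: if_splits)
  then show "r \<in> partitions_of (sum_list l)"
    using has_dim_kronecker(1)[of l "sum_list l" m r] assms by (metis (full_types))
qed

section \<open>Products of invariants\<close>

lemma permute_list_append_left:
  assumes p: "p permutes {..<length u}"
  shows "permute_list p (u @ v) = permute_list p u @ v"
proof (rule nth_equalityI)
  fix i assume i: "i < length (permute_list p (u @ v))"
  have pp: "p permutes {..<length (u @ v)}"
    using p by (rule permutes_subset) auto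
  show "permute_list p (u @ v) ! i = (permute_list p u @ v) ! i"
    using i permutes_in_image[OF p, of i] permutes_not_in[OF p, of i] p
    by (cases "i < length u") (auto simp: permute_list_nth[OF pp] permute_list_nth nth_append)
qed simp

lemma permute_list_append_right:
  assumes q: "q permutes {..<m}"
  obtains q' where "q' permutes {..<n + m}" "sign q' = sign q"
    "\<And>u v :: nat list. length u = n \<Longrightarrow> length v = m \<Longrightarrow> permute_list q' (u @ v) = u @ permute_list q v"
proof -
  define q' where "q' = map_permutation {..<m} ((+) n) q"
  have inj: "inj_on ((+) n) {..<m}"
    by simp
  have im: "(+) n ` {..<m} = {n..<n + m}"
    by (auto simp: image_iff intro: le_Suc_ex[THEN exE])
  then have p: "q' permutes {n..<n + m}"
    unfolding q'_def using q by (intro map_permutation_permutes) (auto simp: bij_betw_def)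
  have p': "q' permutes {..<n + m}"
    using p by (rule permutes_subset) auto
  have low: "q' i = i" if "i < n" for i
    using permutes_not_in[OF p] that by simp
  have high: "q' (n + i) = n + q i" "q i < m" if "i < m" for i
    using map_permutation_apply[OF inj, of i q] that permutes_in_image[OF q, of i] by (simp_all add: q'_def)
  have "permute_list q' (u @ v) = u @ permute_list q v" if uv: "length u = n" "length v = m" for u v :: "nat list"
  proof (rule nth_equalityI)
    fix i assume i: "i < length (permute_list q' (u @ v))"
    show "permute_list q' (u @ v) ! i = (u @ permute_list q v) ! i"
    proof (cases "i < n")
      case True
      then show ?thesis
        using i uv p' low by (simp add: permute_list_nth nth_append)
    next
      case False
      then obtain k where "i = n + k" "k < m"
        using i uv by (metis add_diff_inverse_nat length_append length_permute_list nat_add_left_cancel_less)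
      then show ?thesis
        using i uv p' q high by (simp add: permute_list_nth nth_append)
    qed
  qed simp
  moreover have "sign q' = sign q"
    unfolding q'_def by (rule sign_map_permutation[OF inj q]) simp
  ultimately show ?thesis
    using that p' by blast
qed

lemma tableau_append_disjoint:
  assumes rc: "tableau r c" and sd: "tableau s d" and disj: "set c \<inter> set d = {}"
  shows "tableau (r @ s) (c @ d)"
proof -
  have "set (zip r c) \<inter> set (zip s d) = {}"
    using disj by (auto dest!: set_zip_rightD)
  then show ?thesis
    using rc sd unfolding tableau_def by (auto simp: zip_append)
qed

text \<open>For fixed \<open>v\<close> the left side alternates in \<open>u\<close>, and vice versa. The total letter sum is prescribed, so one of
  the two words has a letter sum small enough for \<open>alternating_eq_polyt\<close>, and comparing contents then settles the
  other one.\<close>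

lemma polyt_append_disjoint:
  assumes rc: "tableau r c" and sd: "tableau s d" and disj: "set c \<inter> set d = {}"
    and u: "length u = length c" and v: "length v = length d"
  shows "polyt (r @ s) (c @ d) (u @ v) = polyt r c u * polyt s d v"
proof -
  define L where "L x y = polyt (r @ s) (c @ d) (x @ y)" for x y
  have len: "length r = length c" "length s = length d"
    using rc sd by (auto simp: tableau_def)
  note t = tableau_append_disjoint[OF rc sd disj]
  have alt: "alternating (c @ d) (polyt (r @ s) (c @ d))"
    using len by (intro alternating_polyt) simp
  have left: "alternating c (\<lambda>x. L x y)" if y: "length y = length d" for y
    unfolding alternating_def
  proof (intro ballI allI impI)
    fix p and x :: "nat list" assume p: "p \<in> stab c" and x: "length x = length c"
    then have pp: "p permutes {..<length c}" "p permutes {..<length (c @ d)}"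
      by (auto simp: stab_def intro: permutes_subset)
    then have "p \<in> stab (c @ d)"
      using p by (simp add: stab_def permute_list_append_left)
    then have "polyt (r @ s) (c @ d) (permute_list p (x @ y)) = of_int (sign p) * polyt (r @ s) (c @ d) (x @ y)"
      using alt x y by (simp add: alternating_def)
    then show "L (permute_list p x) y = of_int (sign p) * L x y"
      using pp x by (simp add: L_def permute_list_append_left)
  qed
  have right: "alternating d (\<lambda>y. L x y)" if x: "length x = length c" for x
    unfolding alternating_def
  proof (intro ballI allI impI)
    fix q and y :: "nat list" assume q: "q \<in> stab d" and y: "length y = length d"
    obtain q' where q': "q' permutes {..<length c + length d}" "sign q' = sign q"
        "\<And>u v :: nat list. length u = length c \<Longrightarrow> length v = length d \<Longrightarrow> permute_list q' (u @ v) = u @ permute_list q v"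
      using permute_list_append_right[of q "length d" "length c"] q by (auto simp: stab_def)
    have "q' \<in> stab (c @ d)"
      using q q' by (simp add: stab_def)
    then have "polyt (r @ s) (c @ d) (permute_list q' (x @ y)) = of_int (sign q') * polyt (r @ s) (c @ d) (x @ y)"
      using alt x y by (simp add: alternating_def)
    then show "L x (permute_list q y) = of_int (sign q) * L x y"
      using q' x y by (simp add: L_def)
  qed
  have L0: "L x y = 0" if "mset x + mset y \<noteq> mset r + mset s" for x y
    unfolding L_def using that len by (intro polyt_eq_0) simp_all
  have "L u v = polyt r c u * polyt s d v"
  proof (cases "mset u + mset v = mset r + mset s")
    case False
    then have "mset u \<noteq> mset r \<or> mset v \<noteq> mset s"
      by auto
    then have "polyt r c u * polyt s d v = 0"
      using polyt_eq_0[OF len(1), of u] polyt_eq_0[OF len(2), of v] by auto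
    then show ?thesis using L0[OF False] by simp
  next
    case True
    have sum: "sum_list u + sum_list v = sum_list r + sum_list s"
      using arg_cong[OF True, of sum_mset] by (simp add: sum_mset_sum_list)
    show ?thesis
    proof (cases "sum_list u \<le> sum_list r")
      case le: True
      have 1: "L u v = L r v * polyt r c u"
        by (rule alternating_eq_polyt[OF left[OF v] rc u le])
      show ?thesis
      proof (cases "mset u = mset r")
        case True
        then have "sum_list v \<le> sum_list s"
          using sum by (metis add_left_cancel order_refl sum_mset_sum_list)
        then have "L r v = L r s * polyt s d v"
          using len by (intro alternating_eq_polyt[OF right sd v]) auto
        moreover have "L r s = 1"
          unfolding L_def by (rule polyt_self[OF t])
        ultimately show ?thesis
          using 1 by simp
      next
        case False
        then show ?thesis
          using 1 polyt_eq_0[OF len(1) False] by simp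
      qed
    next
      case False
      then have lt: "sum_list v < sum_list s" "sum_list u \<noteq> sum_list r"
        using sum by linarith+
      then have "L u v = L u s * polyt s d v"
        by (intro alternating_eq_polyt[OF right[OF u] sd v]) simp
      moreover have "polyt s d v = 0" "polyt r c u = 0"
        using lt by (intro polyt_eq_0 len mset_ne_sum_list; simp)+
      ultimately show ?thesis by simp
    qed
  qed
  then show ?thesis
    by (simp add: L_def)
qed

definition concat_prod :: "nat \<Rightarrow> (nat list \<Rightarrow> complex) \<Rightarrow> (nat list \<Rightarrow> complex) \<Rightarrow> nat list \<Rightarrow> complex" where
  "concat_prod n f g = (\<lambda>u. f (take n u) * g (drop n u))"

text \<open>Columns of the second tableau get labels above all labels of the first, which makes the juxtaposition a
  tableau.\<close>

lemma concat_prod_polyt: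
  assumes rc: "tableau r c" and sd: "tableau s d"
  shows "concat_prod (length r) (polyt r c) (polyt s d) \<in> Specht (mset r + mset s)"
proof -
  define \<pi> where "\<pi> = (\<lambda>j. j + Suc (Max (insert 0 (set c))))"
  have inj: "inj_on \<pi> (set d)"
    by (auto simp: \<pi>_def inj_on_def)
  have "\<pi> j \<notin> set c" for j
  proof
    assume "\<pi> j \<in> set c"
    then have "\<pi> j \<le> Max (insert 0 (set c))"
      by (intro Max_ge) auto
    then show False
      by (simp add: \<pi>_def)
  qed
  then have disj: "set c \<inter> set (map \<pi> d) = {}"
    by auto
  have len: "length r = length c" "length s = length d"
    using rc sd by (auto simp: tableau_def)
  have sd': "tableau s (map \<pi> d)"
    using tableau_relabel[OF sd inj] .
  have "concat_prod (length r) (polyt r c) (polyt s d) u = polyt (r @ s) (c @ map \<pi> d) u" for u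
  proof (cases "length u = length c + length d")
    case True
    then show ?thesis
      using polyt_append_disjoint[OF rc sd' disj, of "take (length c) u" "drop (length c) u"] len
      by (simp add: concat_prod_def polyt_relabel[OF inj])
  next
    case False
    then have "mset (take (length r) u) \<noteq> mset r \<or> mset (drop (length r) u) \<noteq> mset s"
      using len by (auto dest!: mset_eq_length)
    then have "concat_prod (length r) (polyt r c) (polyt s d) u = 0"
      using polyt_eq_0 len by (auto simp: concat_prod_def)
    moreover have "mset u \<noteq> mset (r @ s)"
      using False len by (metis length_append mset_eq_length)
    ultimately show ?thesis
      using len by (simp add: polyt_eq_0)
  qed
  then have "concat_prod (length r) (polyt r c) (polyt s d) = polyt (r @ s) (c @ map \<pi> d)"
    by (rule ext)
  then show ?thesis
    using polyt_in_Specht[OF tableau_append_disjoint[OF rc sd' disj]] by simp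
qed

lemma concat_prod_Specht:
  assumes f: "f \<in> Specht \<kappa>" and g: "g \<in> Specht \<rho>"
  shows "concat_prod (size \<kappa>) f g \<in> Specht (\<kappa> + \<rho>)"
proof -
  let ?P = "\<lambda>\<kappa>. {polyt r c | r c. tableau r c \<and> mset r = \<kappa>}"
  have 1: "cfun_linear (\<lambda>f. concat_prod n f g)" "cfun_linear (concat_prod n f)" for n f g
    by (auto simp: cfun_linear_iff concat_prod_def algebra_simps)
  have base: "concat_prod (size \<kappa>) f g \<in> Specht (\<kappa> + \<rho>)" if "f \<in> ?P \<kappa>" "g \<in> ?P \<rho>" for f g
    using that concat_prod_polyt by auto
  have half: "concat_prod (size \<kappa>) f g \<in> cfun.span (?P (\<kappa> + \<rho>))" if "f \<in> ?P \<kappa>" "g \<in> cfun.span (?P \<rho>)" for f g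
    by (rule cfun_linear_image_span[OF 1(2) base[unfolded Specht_def, OF that(1)] that(2)])
  show ?thesis
    using f g unfolding Specht_def by (intro cfun_linear_image_span[OF 1(1) half])
qed

abbreviation triple_rep :: "nat list \<Rightarrow> nat list \<Rightarrow> nat list \<Rightarrow> ((nat list \<times> nat list) \<times> nat list) perm_rep" where
  "triple_rep l m r \<equiv> tensor_rep (tensor_rep (wspecht l) (wspecht m)) (wspecht r)"

definition triple_prod :: "nat \<Rightarrow> ((nat list \<times> nat list) \<times> nat list \<Rightarrow> complex) \<Rightarrow>
    ((nat list \<times> nat list) \<times> nat list \<Rightarrow> complex) \<Rightarrow> (nat list \<times> nat list) \<times> nat list \<Rightarrow> complex" where
  "triple_prod n F H = (\<lambda>((u, v), w).
    F ((take n u, take n v), take n w) * H ((drop n u, drop n v), drop n w))"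

lemma triple_rep_space:
  assumes "cfun.subspace (rep_space U)" "cfun.subspace (rep_space (tensor_rep U V))"
  shows "rep_space (tensor_rep (tensor_rep U V) W) =
    cfun.span {outer (outer a b) c | a b c. a \<in> rep_space U \<and> b \<in> rep_space V \<and> c \<in> rep_space W}"
    (is "_ = cfun.span ?G")
proof -
  have lin: "cfun_linear (\<lambda>A :: 'd \<Rightarrow> complex. outer A c)" for c :: "'c \<Rightarrow> complex"
    unfolding cfun_linear_iff
  proof (intro conjI allI ext)
    fix f g :: "'d \<Rightarrow> complex" and a and z :: "'d \<times> 'c"
    obtain x y where z: "z = (x, y)" by (cases z)
    show "outer (f + g) c z = (outer f c + outer g c) z"
      by (simp add: outer_def z distrib_right)
    show "outer (\<lambda>x. a * f x) c z = a * outer f c z"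
      by (simp add: outer_def z)
  qed
  have outer: "outer A c \<in> cfun.span ?G" if "A \<in> rep_space (tensor_rep U V)" "c \<in> rep_space W" for A c
  proof (rule cfun_linear_image_span[OF lin _ that(1)[unfolded rep_space_tensor[OF assms(1)]]])
    fix f assume "f \<in> {outer v w | v w. v \<in> rep_space U \<and> w \<in> rep_space V}"
    then obtain a b where "f = outer a b" "a \<in> rep_space U" "b \<in> rep_space V"
      by blast
    then have "outer f c \<in> ?G"
      using that(2) by (intro CollectI exI[of _ a] exI[of _ b] exI[of _ c]) simp
    then show "outer f c \<in> cfun.span ?G"
      by (rule cfun.span_base)
  qed
  have "{outer A c | A c. A \<in> rep_space (tensor_rep U V) \<and> c \<in> rep_space W} \<subseteq> cfun.span ?G"
  proof
    fix f assume "f \<in> {outer A c | A c. A \<in> rep_space (tensor_rep U V) \<and> c \<in> rep_space W}"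
    then obtain A c where "f = outer A c" "A \<in> rep_space (tensor_rep U V)" "c \<in> rep_space W"
      by blast
    then show "f \<in> cfun.span ?G"
      using outer by simp
  qed
  then have "cfun.span {outer A c | A c. A \<in> rep_space (tensor_rep U V) \<and> c \<in> rep_space W} \<subseteq> cfun.span ?G"
    by (rule cfun.span_minimal) (rule cfun.subspace_span)
  moreover have "outer a b \<in> rep_space (tensor_rep U V)" if "a \<in> rep_space U" "b \<in> rep_space V" for a b
    unfolding rep_space_tensor[OF assms(1)] using that by (intro cfun.span_base) blast
  then have "?G \<subseteq> {outer A c | A c. A \<in> rep_space (tensor_rep U V) \<and> c \<in> rep_space W}"
    by blast
  then have "cfun.span ?G \<subseteq> cfun.span {outer A c | A c. A \<in> rep_space (tensor_rep U V) \<and> c \<in> rep_space W}"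
    by (rule cfun.span_mono)
  ultimately show ?thesis
    unfolding rep_space_tensor[OF assms(2)] by blast
qed

lemma subspace_wspecht: "cfun.subspace (rep_space (wspecht l))"
  by (simp add: wspecht_def subspace_Specht)

lemma subspace_tensor:
  assumes "cfun.subspace (rep_space V)"
  shows "cfun.subspace (rep_space (tensor_rep V W))"
  unfolding rep_space_tensor[OF assms] by simp

lemma triple_space:
  "rep_space (triple_rep l m r) = cfun.span {outer (outer a b) c | a b c.
    a \<in> Specht (row_content l) \<and> b \<in> Specht (row_content m) \<and> c \<in> Specht (row_content r)}"
proof -
  have "rep_space (wspecht i) = Specht (row_content i)" for i
    by (simp add: wspecht_def)
  then show ?thesis
    using triple_rep_space[where U = "wspecht l" and V = "wspecht m" and W = "wspecht r",
        OF subspace_wspecht subspace_tensor[OF subspace_wspecht]] by simp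
qed

lemma triple_prod_linear:
  "cfun_linear (\<lambda>F. triple_prod n F H)" "cfun_linear (triple_prod n F)"
  by (auto simp: cfun_linear_iff triple_prod_def algebra_simps)

lemma triple_prod_space:
  assumes n: "sum_list l = n" "sum_list m = n" "sum_list r = n"
    and add: "row_content l'' = row_content l + row_content l'" "row_content m'' = row_content m + row_content m'"
      "row_content r'' = row_content r + row_content r'"
    and F: "F \<in> rep_space (triple_rep l m r)" and H: "H \<in> rep_space (triple_rep l' m' r')"
  shows "triple_prod n F H \<in> rep_space (triple_rep l'' m'' r'')"
proof -
  let ?G = "\<lambda>l m r. {outer (outer a b) c | a b c.
    a \<in> Specht (row_content l) \<and> b \<in> Specht (row_content m) \<and> c \<in> Specht (row_content r)}"
  have base: "triple_prod n F H \<in> cfun.span (?G l'' m'' r'')" if FG: "F \<in> ?G l m r" and HG: "H \<in> ?G l' m' r'" for F H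
  proof -
    obtain a b c where F: "F = outer (outer a b) c" "a \<in> Specht (row_content l)" "b \<in> Specht (row_content m)" "c \<in> Specht (row_content r)"
      using FG by blast
    obtain a' b' c' where H: "H = outer (outer a' b') c'" "a' \<in> Specht (row_content l')" "b' \<in> Specht (row_content m')" "c' \<in> Specht (row_content r')"
      using HG by blast
    have "triple_prod n F H = outer (outer (concat_prod n a a') (concat_prod n b b')) (concat_prod n c c')"
      by (auto simp: triple_prod_def F H outer_def concat_prod_def)
    moreover have "concat_prod n a a' \<in> Specht (row_content l'')" "concat_prod n b b' \<in> Specht (row_content m'')"
        "concat_prod n c c' \<in> Specht (row_content r'')"
      using concat_prod_Specht[OF F(2) H(2)] concat_prod_Specht[OF F(3) H(3)] concat_prod_Specht[OF F(4) H(4)] n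
      by (simp_all add: add size_row_content)
    ultimately show ?thesis
      by (intro cfun.span_base) blast
  qed
  have "triple_prod n F H \<in> cfun.span (?G l'' m'' r'')" if "F \<in> ?G l m r" "H \<in> cfun.span (?G l' m' r')" for F H
    by (rule cfun_linear_image_span[OF triple_prod_linear(2) base[OF that(1)] that(2)])
  then show ?thesis
    using H unfolding triple_space
    by (intro cfun_linear_image_span[OF triple_prod_linear(1) _ F[unfolded triple_space]])
qed

text \<open>The letters of the three words at one position are coded by one number. Monomials are then multisets over a
  linear order, and the multiset order is a linear order compatible with addition.\<close>

definition monomial :: "(nat list \<times> nat list) \<times> nat list \<Rightarrow> nat multiset" where
  "monomial = (\<lambda>((u, v), w). mset (map (\<lambda>((a, b), c). prod_encode (prod_encode (a, b), c)) (zip (zip u v) w)))"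

lemma rep_act_triple:
  assumes "p permutes A"
  shows "rep_act (triple_rep l m r) p F ((u, v), w) = F ((permute_list p u, permute_list p v), permute_list p w)"
  using permutes_inv_inv[OF assms] by (simp add: rep_act_def tensor_rep_def wspecht_def)

lemma triple_support:
  assumes F: "F \<in> rep_space (triple_rep l m r)" and nz: "F ((u, v), w) \<noteq> 0"
  shows "mset u = row_content l" "mset v = row_content m" "mset w = row_content r"
proof -
  note s1 = tensor_sections[OF subspace_tensor[OF subspace_wspecht] subspace_wspecht F]
  note s2 = tensor_sections[OF subspace_wspecht subspace_wspecht s1(1)]
  show "mset u = row_content l"
    using supported_Specht[of "\<lambda>u. F ((u, v), w)"] s2(1)[of v w] nz by (auto simp: supported_def wspecht_def)
  show "mset v = row_content m"
    using supported_Specht[of "\<lambda>v. F ((u, v), w)"] s2(2)[of u w] nz by (auto simp: supported_def wspecht_def)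
  show "mset w = row_content r"
    using supported_Specht[of "\<lambda>w. F ((u, v), w)"] s1(2)[of "(u, v)"] nz by (auto simp: supported_def wspecht_def)
qed

lemma invariant_monomial:
  assumes F: "F \<in> invariants n (triple_rep l m r)"
    and len: "length u = n" "length v = n" "length w = n" "length u' = n" "length v' = n" "length w' = n"
    and eq: "monomial ((u, v), w) = monomial ((u', v'), w')"
  shows "F ((u, v), w) = F ((u', v'), w')"
proof -
  \<comment> \<open>Undoing the coding of letter triples recovers the multiset of triples, so equal monomials differ by a permutation of the positions.\<close>
  define e where "e = (\<lambda>((a, b), c). prod_encode (prod_encode (a, b), c))"
  have "inj e"
    by (auto simp: inj_def e_def)
  then have cancel: "image_mset (inv e) (image_mset e M) = M" for M
    by (simp add: image_mset.compositionality comp_def inv_f_f)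
  have "image_mset e (mset (zip (zip u v) w)) = image_mset e (mset (zip (zip u' v') w'))"
    using eq by (simp add: monomial_def e_def)
  then have "mset (zip (zip u v) w) = mset (zip (zip u' v') w')"
    using cancel by metis
  then obtain p where p: "p permutes {..<length (zip (zip u' v') w')}"
      "permute_list p (zip (zip u' v') w') = zip (zip u v) w"
    by (rule mset_eq_permutation)
  then have pn: "p permutes {..<n}"
    using len by simp
  have "zip (zip (permute_list p u') (permute_list p v')) (permute_list p w') = zip (zip u v) w"
    using p(2) pn len by (simp add: permute_list_zip_same_length)
  then have "permute_list p u' = u" "permute_list p v' = v" "permute_list p w' = w"
    using len by (metis length_permute_list length_zip map_fst_zip map_snd_zip min.idem)+
  then show ?thesis
    using F rep_act_triple[OF pn, of l m r F u' v' w'] pn by (simp add: invariants_def)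
qed

lemma leading_monomial:
  assumes F: "F \<in> rep_space (triple_rep l m r)" and nz: "F \<noteq> 0"
  obtains x where "F x \<noteq> 0" "\<And>y. F y \<noteq> 0 \<Longrightarrow> monomial y \<le> monomial x"
proof -
  define S where "S = {x. F x \<noteq> 0}"
  have "S \<subseteq> (permutations_of_multiset (row_content l) \<times> permutations_of_multiset (row_content m)) \<times>
      permutations_of_multiset (row_content r)"
    using triple_support[OF F] by (auto simp: S_def permutations_of_multiset_def)
  then have fin: "finite S"
    by (rule finite_subset) simp
  have "S \<noteq> {}"
    using nz by (auto simp: S_def fun_eq_iff)
  then have "Max (monomial ` S) \<in> monomial ` S"
    using fin by simp
  then obtain x where x: "x \<in> S" "monomial x = Max (monomial ` S)"
    by auto
  moreover have "monomial y \<le> monomial x" if "y \<in> S" for y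
    using fin that x(2) by simp
  ultimately show ?thesis
    using that by (auto simp: S_def)
qed

lemma monomial_append:
  assumes "length u = n" "length v = n" "length w = n"
  shows "monomial ((u @ u', v @ v'), w @ w') = monomial ((u, v), w) + monomial ((u', v'), w')"
  using assms by (simp add: monomial_def)

text \<open>Evaluate the average at the concatenation of words that carry the leading monomials of \<open>F\<close> and \<open>H\<close>. A summand that
  is not 0 splits the product of the leading monomials into two monomials at most as large, so into the leading
  monomials themselves, and equals the product of the two leading coefficients. Nothing cancels.\<close>

lemma average_prod_nonzero:
  assumes n: "sum_list l = n" "sum_list m = n" "sum_list r = n"
    and n': "sum_list l' = n'" "sum_list m' = n'" "sum_list r' = n'"
    and F: "F \<in> invariants n (triple_rep l m r)" "F \<noteq> 0"
    and H: "H \<in> invariants n' (triple_rep l' m' r')" "H \<noteq> 0"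
  shows "average (n + n') (triple_rep l'' m'' r'') (triple_prod n F H) \<noteq> 0"
proof -
  have memF: "F \<in> rep_space (triple_rep l m r)" and memH: "H \<in> rep_space (triple_rep l' m' r')"
    using F H by (auto simp: invariants_def)
  have lenF: "length u = n" "length v = n" "length w = n" if "F ((u, v), w) \<noteq> 0" for u v w
    using triple_support[OF memF that] n by (metis size_mset size_row_content)+
  have lenH: "length u = n'" "length v = n'" "length w = n'" if "H ((u, v), w) \<noteq> 0" for u v w
    using triple_support[OF memH that] n' by (metis size_mset size_row_content)+
  obtain x where x: "F x \<noteq> 0" "\<And>y. F y \<noteq> 0 \<Longrightarrow> monomial y \<le> monomial x"
    using leading_monomial[OF memF F(2)] by blast
  obtain y where y: "H y \<noteq> 0" "\<And>z. H z \<noteq> 0 \<Longrightarrow> monomial z \<le> monomial y"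
    using leading_monomial[OF memH H(2)] by blast
  obtain u v w where xe: "x = ((u, v), w)" by (metis surj_pair)
  obtain u' v' w' where ye: "y = ((u', v'), w')" by (metis surj_pair)
  note lx = lenF[OF x(1)[unfolded xe]] and ly = lenH[OF y(1)[unfolded ye]]
  define U V W where "U = u @ u'" and "V = v @ v'" and "W = w @ w'"
  have L: "length U = n + n'" "length V = n + n'" "length W = n + n'"
    using lx ly by (simp_all add: U_def V_def W_def)
  define tm where "tm p = triple_prod n F H ((permute_list p U, permute_list p V), permute_list p W)" for p
  have dich: "tm p = 0 \<or> tm p = F x * H y" if p: "p permutes {..<n + n'}" for p
  proof (cases "tm p = 0")
    case False
    define a b c where "a = take n (permute_list p U)" and "b = take n (permute_list p V)" and "c = take n (permute_list p W)"
    define a' b' c' where "a' = drop n (permute_list p U)" and "b' = drop n (permute_list p V)" and "c' = drop n (permute_list p W)"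
    have t: "tm p = F ((a, b), c) * H ((a', b'), c')"
      by (simp add: tm_def triple_prod_def a_def b_def c_def a'_def b'_def c'_def)
    then have nz: "F ((a, b), c) \<noteq> 0" "H ((a', b'), c') \<noteq> 0"
      using False by auto
    have la: "length a = n" "length b = n" "length c = n" "length a' = n'" "length b' = n'" "length c' = n'"
      using L by (simp_all add: a_def b_def c_def a'_def b'_def c'_def)
    have "monomial ((a, b), c) + monomial ((a', b'), c') = monomial ((permute_list p U, permute_list p V), permute_list p W)"
      using monomial_append[OF la(1-3), of a' b' c'] by (simp add: a_def b_def c_def a'_def b'_def c'_def)
    also have "\<dots> = monomial ((U, V), W)"
    proof -
      have "zip (zip (permute_list p U) (permute_list p V)) (permute_list p W) = permute_list p (zip (zip U V) W)"
        using p L by (simp add: permute_list_zip_same_length)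
      then show ?thesis
        using p L by (simp add: monomial_def)
    qed
    also have "\<dots> = monomial x + monomial y"
      unfolding U_def V_def W_def xe ye by (rule monomial_append[OF lx])
    finally have sum: "monomial ((a, b), c) + monomial ((a', b'), c') = monomial x + monomial y" .
    have le: "monomial ((a, b), c) \<le> monomial x" "monomial ((a', b'), c') \<le> monomial y"
      using x(2)[OF nz(1)] y(2)[OF nz(2)] .
    have eqs: "monomial ((a, b), c) = monomial x" "monomial ((a', b'), c') = monomial y"
      using sum le add_less_le_mono[of "monomial ((a, b), c)" "monomial x" "monomial ((a', b'), c')" "monomial y"]
        add_le_less_mono[of "monomial ((a, b), c)" "monomial x" "monomial ((a', b'), c')" "monomial y"]
      by (auto simp: order.order_iff_strict)
    have "F ((a, b), c) = F x"
      unfolding xe by (rule invariant_monomial[OF F(1) la(1-3) lx eqs(1)[unfolded xe]])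
    moreover have "H ((a', b'), c') = H y"
      unfolding ye by (rule invariant_monomial[OF H(1) la(4-6) ly eqs(2)[unfolded ye]])
    ultimately show ?thesis
      using t by simp
  qed simp
  define G where "G = {p. p permutes {..<n + n'}}"
  \<comment> \<open>The permutations whose summand survives; all these summands are equal, and the identity is one of them.\<close>
  define N where "N = {p \<in> G. tm p \<noteq> 0}"
  have fin: "finite G"
    by (simp add: G_def finite_permutations)
  have id: "id \<in> N"
    using x(1) y(1) lx by (simp add: N_def G_def permutes_id tm_def triple_prod_def U_def V_def W_def xe ye)
  have "average (n + n') (triple_rep l'' m'' r'') (triple_prod n F H) ((U, V), W) = (\<Sum>p\<in>G. tm p)"
    unfolding average_def sum_fun_apply G_def
    by (intro sum.cong refl) (simp add: rep_act_triple[of _ "{..<n + n'}"] tm_def)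
  also have "\<dots> = (\<Sum>p\<in>N. tm p)"
    using fin by (intro sum.mono_neutral_right) (auto simp: N_def)
  also have "\<dots> = (\<Sum>p\<in>N. F x * H y)"
    using dich by (intro sum.cong) (auto simp: N_def G_def)
  also have "\<dots> = of_nat (card N) * (F x * H y)"
    by simp
  also have "\<dots> \<noteq> 0"
    using id fin x(1) y(1) by (auto simp: N_def)
  finally show ?thesis
    by auto
qed

definition part_add :: "nat list \<Rightarrow> nat list \<Rightarrow> nat list" where
  "part_add l m = map (\<lambda>i. (if i < length l then l ! i else 0) + (if i < length m then m ! i else 0))
    [0..<max (length l) (length m)]"

lemma row_content_part_add: "row_content (part_add l m) = row_content l + row_content m"
  by (rule multiset_eqI) (simp add: count_row_content part_add_def less_max_iff_disj)

lemma is_partition_part_add: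
  assumes "is_partition l" "is_partition m"
  shows "is_partition (part_add l m)"
proof -
  have anti: "(if j < length l then l ! j else 0) \<le> (if i < length l then l ! i else 0)"
    if "is_partition l" "i < j" for l :: "nat list" and i j
    using that by (auto simp: is_partition_def sorted_wrt_iff_nth_less)
  have pos: "0 < l ! i" if "is_partition l" "i < length l" for l :: "nat list" and i
    using that by (auto simp: is_partition_def)
  have "sorted_wrt (\<ge>) (part_add l m)"
    unfolding sorted_wrt_iff_nth_less
  proof (intro allI impI)
    fix i j assume ij: "i < j" "j < length (part_add l m)"
    then have bounds: "i < max (length l) (length m)" "j < max (length l) (length m)"
      by (simp_all add: part_add_def)
    have nth: "part_add l m ! i = (if i < length l then l ! i else 0) + (if i < length m then m ! i else 0)"
      if "i < max (length l) (length m)" for i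
      using that by (simp add: part_add_def)
    show "part_add l m ! j \<le> part_add l m ! i"
      unfolding nth[OF bounds(1)] nth[OF bounds(2)]
      by (rule add_mono[OF anti[OF assms(1) ij(1)] anti[OF assms(2) ij(1)]])
  qed
  moreover have "\<forall>x\<in>set (part_add l m). 0 < x"
    using pos[OF assms(1)] pos[OF assms(2)] by (auto simp: part_add_def less_max_iff_disj)
  ultimately show ?thesis
    by (simp add: is_partition_def)
qed

lemma sum_list_part_add: "sum_list (part_add l m) = sum_list l + sum_list m"
  using arg_cong[OF row_content_part_add[of l m], of size] by (simp add: size_row_content)

lemma part_add_partitions: "l \<in> partitions_of n \<Longrightarrow> m \<in> partitions_of k \<Longrightarrow> part_add l m \<in> partitions_of (n + k)"
  by (simp add: partitions_of_def is_partition_part_add sum_list_part_add)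

text \<open>Multiplication by a nonzero invariant of the second triple embeds the invariants of the first triple into
  those of the sum.\<close>

theorem kronecker_mono:
  assumes t: "l \<in> partitions_of n" "m \<in> partitions_of n" "r \<in> partitions_of n"
    and t': "l' \<in> partitions_of n'" "m' \<in> partitions_of n'" "r' \<in> partitions_of n'"
    and nz: "kronecker l' m' r' \<noteq> 0"
  shows "kronecker l m r \<le> kronecker (part_add l l') (part_add m m') (part_add r r')"
proof -
  let ?l = "part_add l l'" and ?m = "part_add m m'" and ?r = "part_add r r'"
  have sums: "sum_list l = n" "sum_list m = n" "sum_list r = n" "sum_list l' = n'" "sum_list m' = n'" "sum_list r' = n'"
    using t t' by (auto simp: partitions_of_def)
  obtain H where H: "H \<in> invariants n' (triple_rep l' m' r')" "H \<noteq> 0"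
  proof -
    obtain B where B: "card B = kronecker l' m' r'" "cfun.independent B" "cfun.span B = invariants n' (triple_rep l' m' r')"
      using has_dim_kronecker(2)[OF t'] by (auto simp: has_dim_def)
    obtain H where "H \<in> B"
      using nz B(1) by fastforce
    then show ?thesis
      using that[of H] B cfun.span_base[of H B] cfun.dependent_zero[of B] by auto
  qed
  have T: "is_rep (n + n') (triple_rep ?l ?m ?r)"
    using is_rep_wspecht[of ?l] is_rep_wspecht[of ?m] is_rep_wspecht[of ?r] sums
    by (simp add: is_rep_tensor sum_list_part_add)
  define \<Phi> where "\<Phi> F = average (n + n') (triple_rep ?l ?m ?r) (triple_prod n F H)" for F
  have lin: "cfun_linear \<Phi>"
    unfolding \<Phi>_def average_def cfun_linear_iff
    by (auto simp: cfun_linearD[OF cfun_linear_compose[OF triple_prod_linear(1) rep_act_linear]]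
        sum.distrib sum_fun_apply sum_distrib_left fun_eq_iff)
  show ?thesis
  proof (rule has_dim_injection[OF has_dim_kronecker(2)[OF t] has_dim_kronecker(2) lin])
    show "?l \<in> partitions_of (n + n')" "?m \<in> partitions_of (n + n')" "?r \<in> partitions_of (n + n')"
      using t t' by (simp_all add: part_add_partitions)
    show "inj_on \<Phi> (invariants n (triple_rep l m r))"
    proof (rule inj_onI, rule ccontr)
      fix F F' assume F: "F \<in> invariants n (triple_rep l m r)" "F' \<in> invariants n (triple_rep l m r)"
        and eq: "\<Phi> F = \<Phi> F'" and neq: "F \<noteq> F'"
      have "F - F' \<in> invariants n (triple_rep l m r)"
        using F cfun.subspace_diff[OF subspace_tensor[OF subspace_tensor[OF subspace_wspecht]]]
        by (auto simp: invariants_def cfun_linear_diff[OF rep_act_linear])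
      then have "\<Phi> (F - F') \<noteq> 0"
        unfolding \<Phi>_def using neq by (intro average_prod_nonzero[OF sums _ _ H]) auto
      then show False
        using eq by (simp add: cfun_linear_diff[OF lin])
    qed
    show "\<Phi> ` invariants n (triple_rep l m r) \<subseteq> invariants (n + n') (triple_rep ?l ?m ?r)"
    proof
      fix G assume "G \<in> \<Phi> ` invariants n (triple_rep l m r)"
      then obtain F where F: "F \<in> rep_space (triple_rep l m r)" "G = \<Phi> F"
        by (auto simp: invariants_def)
      have "H \<in> rep_space (triple_rep l' m' r')"
        using H by (simp add: invariants_def)
      then have "triple_prod n F H \<in> rep_space (triple_rep ?l ?m ?r)"
        using F(1) by (intro triple_prod_space[OF sums(1-3) _ _ _ F(1)]) (simp_all add: row_content_part_add)
      then show "G \<in> invariants (n + n') (triple_rep ?l ?m ?r)"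
        unfolding F(2) \<Phi>_def by (rule average_invariant[OF T])
    qed
  qed
qed

lemma kronecker_empty: "kronecker [] [] [] \<noteq> 0"
proof -
  have p0: "[] \<in> partitions_of 0"
    by (simp add: partitions_of_def is_partition_def)
  have "tableau [] []"
    by (simp add: tableau_def)
  then have P: "polyt [] [] \<in> rep_space (wspecht [])" and P1: "polyt [] [] [] = 1"
    using polyt_in_Specht[of "[]" "[]"] polyt_self[of "[]" "[]"] by (simp_all add: wspecht_def row_content_def)
  have rep: "is_rep 0 (wspecht [])"
    using is_rep_wspecht[of "[]"] by simp
  define F where "F = outer (outer (polyt [] []) (polyt [] [])) (polyt [] [])"
  have "F \<in> rep_space (triple_rep [] [] [])"
    unfolding F_def by (intro outer_in_tensor[OF is_rep_tensor[OF rep rep]] outer_in_tensor[OF rep] P)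
  moreover have "rep_act (triple_rep [] [] []) id F = F"
    using is_repD(2)[OF is_rep_tensor[OF is_rep_tensor[OF rep rep] rep] calculation] .
  ultimately have F: "F \<in> invariants 0 (triple_rep [] [] [])"
    by (simp add: invariants_def permutes_empty)
  have "F (([], []), []) = 1"
    by (simp add: F_def outer_def P1)
  then have "F \<noteq> 0" by auto
  moreover obtain B where B: "finite B" "card B = kronecker [] [] []" "cfun.span B = invariants 0 (triple_rep [] [] [])"
    using has_dim_kronecker(2)[OF p0 p0 p0] by (auto simp: has_dim_def)
  moreover have "B \<noteq> {}"
    using F \<open>F \<noteq> 0\<close> B(3) by auto
  ultimately show ?thesis
    by auto
qed

section \<open>The semigroup of Kronecker triples and its faces\<close>

type_synonym triple = "nat list \<times> nat list \<times> nat list"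

definition triple_add :: "triple \<Rightarrow> triple \<Rightarrow> triple" where
  "triple_add = (\<lambda>(l, m, r) (l', m', r'). (part_add l l', part_add m m', part_add r r'))"

definition triple_scale :: "nat \<Rightarrow> triple \<Rightarrow> triple" where
  "triple_scale k = (\<lambda>(l, m, r). (scale_partition k l, scale_partition k m, scale_partition k r))"

definition kron :: "triple \<Rightarrow> nat" where
  "kron = (\<lambda>(l, m, r). kronecker l m r)"

lemma Kron_imp_partitions:
  assumes "(l, m, r) \<in> Kron a b c"
  obtains n where "l \<in> partitions_of n" "m \<in> partitions_of n" "r \<in> partitions_of n"
  using kronecker_nonzero_imp[of l m r] assms by (auto simp: Kron_def)

lemma kron_le_add:
  assumes "s \<in> Kron a b c" "t \<in> Kron a b c"
  shows "kron s \<le> kron (triple_add s t)"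
proof -
  obtain l m r l' m' r' where st: "s = (l, m, r)" "t = (l', m', r')"
    by (metis prod_cases3)
  obtain n n' where "l \<in> partitions_of n" "m \<in> partitions_of n" "r \<in> partitions_of n"
      "l' \<in> partitions_of n'" "m' \<in> partitions_of n'" "r' \<in> partitions_of n'"
    using assms unfolding st by (metis Kron_imp_partitions)
  moreover have "kronecker l' m' r' \<noteq> 0"
    using assms(2) by (simp add: st Kron_def)
  ultimately show ?thesis
    unfolding st kron_def triple_add_def by (simp add: kronecker_mono)
qed

lemma length_part_add: "length (part_add l m) = max (length l) (length m)"
  by (simp add: part_add_def)

lemma Kron_add:
  assumes "s \<in> Kron a b c" "t \<in> Kron a b c"
  shows "triple_add s t \<in> Kron a b c"
proof -
  obtain l m r l' m' r' where st: "s = (l, m, r)" "t = (l', m', r')"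
    by (metis prod_cases3)
  have "kron (triple_add s t) \<noteq> 0"
    using kron_le_add[OF assms] assms(1) by (simp add: kron_def Kron_def st)
  then show ?thesis
    using assms by (simp add: Kron_def st triple_add_def kron_def length_part_add is_partition_part_add)
qed

lemma Kron_empty: "([], [], []) \<in> Kron a b c"
  using kronecker_empty by (simp add: Kron_def is_partition_def)

lemma part_add_scale: "part_add (scale_partition k l) l = scale_partition (Suc k) l"
  by (rule nth_equalityI) (simp_all add: part_add_def scale_partition_def)

lemma scale_partition_part_add:
  "scale_partition k (part_add l m) = part_add (scale_partition k l) (scale_partition k m)"
  by (rule nth_equalityI) (auto simp: part_add_def scale_partition_def distrib_left)

lemma triple_scale_Suc: "triple_scale (Suc k) t = triple_add (triple_scale k t) t"
  by (cases t) (simp add: triple_scale_def triple_add_def part_add_scale)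

lemma triple_scale_1: "triple_scale 1 t = t"
  by (cases t) (simp add: triple_scale_def scale_partition_def)

lemma triple_scale_add: "triple_scale k (triple_add s t) = triple_add (triple_scale k s) (triple_scale k t)"
  by (cases s; cases t) (simp add: triple_scale_def triple_add_def scale_partition_part_add)

lemma triple_scale_scale: "triple_scale k (triple_scale j t) = triple_scale (k * j) t"
  by (cases t) (simp add: triple_scale_def scale_partition_def mult.assoc)

lemma Kron_scale:
  assumes "t \<in> Kron a b c" "k \<ge> 1"
  shows "triple_scale k t \<in> Kron a b c"
  using assms(2)
proof (induction k rule: dec_induct)
  case base
  then show ?case using assms(1) by (simp add: triple_scale_1[unfolded One_nat_def] triple_scale_1)
next
  case (step k)
  then show ?case using assms(1) by (simp add: triple_scale_Suc Kron_add)
qed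

lemma weakly_stable_iff: "weakly_stable t \<longleftrightarrow> (\<forall>k\<ge>1. kron (triple_scale k t) = 1)"
  by (cases t) (simp add: weakly_stable_def kron_def triple_scale_def)

lemma partition_vec_add: "partition_vec (part_add l m) = partition_vec l + partition_vec m"
  by (auto simp: partition_vec_def part_add_def vec_eq_iff Let_def)

lemma partition_vec_scale: "partition_vec (scale_partition k l) = real k *\<^sub>R partition_vec l"
  by (auto simp: partition_vec_def scale_partition_def vec_eq_iff Let_def)

lemma triple_vec_add: "triple_vec (triple_add s t) = triple_vec s + triple_vec t"
  by (cases s; cases t) (simp add: triple_vec_def triple_add_def partition_vec_add)

lemma triple_vec_scale: "triple_vec (triple_scale k t) = real k *\<^sub>R triple_vec t"
  by (cases t) (simp add: triple_vec_def triple_scale_def partition_vec_scale)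

lemma triple_vec_empty: "triple_vec ([], [], []) = 0"
  by (simp add: triple_vec_def partition_vec_def vec_eq_iff zero_prod_def)

lemma position_surj:
  assumes "k < CARD('d :: {finite, linorder})"
  obtains i :: "'d :: {finite, linorder}" where "card {..<i} = k"
proof -
  have less: "card {..<i} < card {..<j}" if "i < j" for i j :: 'd
    using that by (intro psubset_card_mono) auto
  have "inj (\<lambda>i :: 'd. card {..<i})"
    by (rule injI) (metis less less_irrefl linorder_less_linear)
  moreover have "card {..<i} < CARD('d)" for i :: 'd
    by (intro psubset_card_mono) auto
  then have "range (\<lambda>i :: 'd. card {..<i}) \<subseteq> {..<CARD('d)}"
    by auto
  ultimately have "range (\<lambda>i :: 'd. card {..<i}) = {..<CARD('d)}"
    by (intro card_subset_eq) (simp_all add: card_image)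
  then show ?thesis
    using assms that by (metis imageE lessThan_iff)
qed

lemma partition_vec_inj:
  assumes eq: "partition_vec l = (partition_vec m :: real ^ ('d :: {finite, linorder}))"
    and l: "is_partition l" "length l \<le> CARD('d)"
    and m: "is_partition m" "length m \<le> CARD('d)"
  shows "l = m"
proof (rule row_content_inj[OF l(1) m(1)], rule multiset_eqI)
  fix k
  show "count (row_content l) k = count (row_content m) k"
  proof (cases "k < CARD('d)")
    case True
    then obtain i :: 'd where i: "card {..<i} = k"
      by (rule position_surj)
    have "partition_vec l $ i = partition_vec m $ i"
      using eq by simp
    then show ?thesis
      by (auto simp: partition_vec_def count_row_content i split: if_splits)
  next
    case False
    then show ?thesis
      using l(2) m(2) by (simp add: count_row_content)
  qed
qed

lemma triple_vec_inj:
  assumes "triple_vec s = (triple_vec t :: (real ^ ('a :: {finite, linorder})) \<times> (real ^ ('b :: {finite, linorder})) \<times>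
      (real ^ ('c :: {finite, linorder})))"
    and "s \<in> Kron CARD('a) CARD('b) CARD('c)" "t \<in> Kron CARD('a) CARD('b) CARD('c)"
  shows "s = t"
proof -
  obtain l m r l' m' r' where st: "s = (l, m, r)" "t = (l', m', r')"
    by (metis prod_cases3)
  have "l = l'"
    using assms by (intro partition_vec_inj[where 'd = 'a]) (auto simp: st Kron_def triple_vec_def)
  moreover have "m = m'"
    using assms by (intro partition_vec_inj[where 'd = 'b]) (auto simp: st Kron_def triple_vec_def)
  moreover have "r = r'"
    using assms by (intro partition_vec_inj[where 'd = 'c]) (auto simp: st Kron_def triple_vec_def)
  ultimately show ?thesis
    by (simp add: st)
qed

definition integral_vec :: "(real ^ 'a) \<times> (real ^ 'b) \<times> (real ^ 'c) \<Rightarrow> bool" where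
  "integral_vec x \<longleftrightarrow> (\<forall>i. fst x $ i \<in> \<int>) \<and> (\<forall>i. fst (snd x) $ i \<in> \<int>) \<and> (\<forall>i. snd (snd x) $ i \<in> \<int>)"

lemma integral_vec_combine:
  "integral_vec x \<Longrightarrow> integral_vec y \<Longrightarrow> integral_vec (x - y)"
  "integral_vec x \<Longrightarrow> integral_vec (of_int k *\<^sub>R x)"
  by (simp_all add: integral_vec_def)

lemma integral_vec_sum: "(\<And>i. i \<in> A \<Longrightarrow> integral_vec (f i)) \<Longrightarrow> integral_vec (\<Sum>i\<in>A. f i)"
  by (induction A rule: infinite_finite_induct) (auto simp: integral_vec_def)

lemma integral_vec_triple: "integral_vec (triple_vec t)"
  by (cases t) (auto simp: integral_vec_def triple_vec_def partition_vec_def Let_def)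

text \<open>Forces the rounding error in \<open>Kron_multiple_dominates\<close> to be 0.\<close>

lemma integral_vec_small:
  fixes x :: "(real ^ 'a :: finite) \<times> (real ^ 'b :: finite) \<times> (real ^ 'c :: finite)"
  assumes x: "integral_vec x" "norm x < 1"
  shows "x = 0"
proof -
  obtain u v w where xe: "x = (u, v, w)"
    by (metis prod_cases3)
  have "norm u \<le> norm x" "norm (v, w) \<le> norm x" "norm v \<le> norm (v, w)" "norm w \<le> norm (v, w)"
    unfolding xe by (rule norm_fst_le norm_snd_le)+
  then have "norm u < 1" "norm v < 1" "norm w < 1"
    using x(2) by linarith+
  then have "\<bar>u $ i\<bar> < 1" "\<bar>v $ j\<bar> < 1" "\<bar>w $ k\<bar> < 1" for i j k
    using component_le_norm_cart[of u i] component_le_norm_cart[of v j] component_le_norm_cart[of w k]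
    by linarith+
  then have "u $ i = 0" "v $ j = 0" "w $ k = 0" for i j k
    using x(1) by (auto simp: integral_vec_def xe intro: Ints_nonzero_abs_less1)
  then show ?thesis
    by (simp add: xe vec_eq_iff zero_prod_def)
qed

lemma cone_combination:
  assumes "x \<in> convex_cone hull (v ` K)"
  obtains S c where "finite S" "S \<subseteq> K" "\<And>t. t \<in> S \<Longrightarrow> 0 \<le> c t" "x = (\<Sum>t\<in>S. c t *\<^sub>R v t)"
proof -
  define Q where "Q = {x. \<exists>S c. finite S \<and> S \<subseteq> K \<and> (\<forall>t. 0 \<le> c t) \<and> x = (\<Sum>t\<in>S. c t *\<^sub>R v t)}"
  have "convex_cone hull (v ` K) \<subseteq> Q"
  proof (rule hull_minimal)
    show "v ` K \<subseteq> Q"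
    proof
      fix x assume "x \<in> v ` K"
      then obtain t where "t \<in> K" "x = v t" by blast
      then show "x \<in> Q"
        unfolding Q_def by (auto intro!: exI[of _ "{t}"] exI[of _ "\<lambda>_. 1"])
    qed
    show "convex_cone Q"
      unfolding convex_cone_iff
    proof (intro conjI ballI allI impI)
      show "0 \<in> Q"
        unfolding Q_def by (auto intro!: exI[of _ "{}"] exI[of _ "\<lambda>_. 0"])
    next
      fix x y assume "x \<in> Q" "y \<in> Q"
      then obtain S c T d where S: "finite S" "S \<subseteq> K" "\<forall>t. 0 \<le> c t" "x = (\<Sum>t\<in>S. c t *\<^sub>R v t)"
        and T: "finite T" "T \<subseteq> K" "\<forall>t. 0 \<le> d t" "y = (\<Sum>t\<in>T. d t *\<^sub>R v t)"
        unfolding Q_def by blast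
      have "x = (\<Sum>t\<in>S \<union> T. (if t \<in> S then c t else 0) *\<^sub>R v t)"
        unfolding S(4) using S(1) T(1) by (intro sum.mono_neutral_cong_left) auto
      moreover have "y = (\<Sum>t\<in>S \<union> T. (if t \<in> T then d t else 0) *\<^sub>R v t)"
        unfolding T(4) using S(1) T(1) by (intro sum.mono_neutral_cong_left) auto
      ultimately have "x + y = (\<Sum>t\<in>S \<union> T. ((if t \<in> S then c t else 0) + (if t \<in> T then d t else 0)) *\<^sub>R v t)"
        by (simp add: scaleR_left_distrib sum.distrib)
      moreover have "\<forall>t. 0 \<le> (if t \<in> S then c t else 0) + (if t \<in> T then d t else 0)"
        using S(3) T(3) by auto
      ultimately show "x + y \<in> Q"
        unfolding Q_def using S(1,2) T(1,2)
        by (intro CollectI exI[of _ "S \<union> T"] exI[of _ "\<lambda>t. (if t \<in> S then c t else 0) + (if t \<in> T then d t else 0)"]) simp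
    next
      fix x and k :: real assume "x \<in> Q" "0 \<le> k"
      then obtain S c where S: "finite S" "S \<subseteq> K" "\<forall>t. 0 \<le> c t" "x = (\<Sum>t\<in>S. c t *\<^sub>R v t)"
        unfolding Q_def by blast
      have "k *\<^sub>R x = (\<Sum>t\<in>S. (k * c t) *\<^sub>R v t)"
        by (simp add: S(4) scaleR_sum_right)
      then show "k *\<^sub>R x \<in> Q"
        unfolding Q_def using S \<open>0 \<le> k\<close> by (intro CollectI exI[of _ S] exI[of _ "\<lambda>t. k * c t"]) simp
    qed
  qed
  then have "x \<in> Q"
    using assms by blast
  then obtain S c where "finite S" "S \<subseteq> K" "\<forall>t. 0 \<le> c t" "x = (\<Sum>t\<in>S. c t *\<^sub>R v t)"
    unfolding Q_def by blast
  then show ?thesis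
    using that[of S c] by simp
qed

lemma Kron_nat_combination:
  fixes v :: "triple \<Rightarrow> 'v::real_vector"
  assumes v: "v ([], [], []) = 0" "\<And>s t. v (triple_add s t) = v s + v t"
      "\<And>k t. v (triple_scale k t) = real k *\<^sub>R v t"
    and S: "finite S" "S \<subseteq> Kron a b c"
  shows "\<exists>u \<in> Kron a b c. v u = (\<Sum>t\<in>S. real (k t) *\<^sub>R v t)"
  using S
proof (induction S)
  case empty
  then show ?case
    using Kron_empty v(1) by (intro bexI[of _ "([], [], [])"]) simp_all
next
  case (insert t S)
  then obtain u where u: "u \<in> Kron a b c" "v u = (\<Sum>t\<in>S. real (k t) *\<^sub>R v t)"
    by blast
  show ?case
  proof (cases "k t = 0")
    case True
    then show ?thesis using u insert by auto
  next
    case False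
    then have "triple_add (triple_scale (k t) t) u \<in> Kron a b c"
      using insert u by (intro Kron_add Kron_scale) auto
    moreover have "v (triple_add (triple_scale (k t) t) u) = (\<Sum>t\<in>insert t S. real (k t) *\<^sub>R v t)"
      using insert u by (simp add: v)
    ultimately show ?thesis by blast
  qed
qed

text \<open>Write \<open>t\<close> as a combination of \<open>s\<close>, with coefficient \<open>\<epsilon>\<close>, and finitely many triples of the semigroup. By Dirichlet's
  theorem some multiple of all coefficients is so close to integers that rounding changes the combination by a
  vector of norm less than 1. This vector is integral, so the rounded combination is an identity in the
  semigroup.\<close>

lemma Kron_multiple_dominates:
  fixes t :: triple
  assumes mem: "triple_vec t - \<epsilon> *\<^sub>R triple_vec s \<in>
      (PKron :: ((real ^ ('a :: {finite, linorder})) \<times> (real ^ ('b :: {finite, linorder})) \<times>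
      (real ^ ('c :: {finite, linorder}))) set)"
    and \<epsilon>: "\<epsilon> > 0" and t: "t \<in> Kron CARD('a) CARD('b) CARD('c)" and s: "s \<in> Kron CARD('a) CARD('b) CARD('c)"
  obtains N u where "N \<ge> 1" "u \<in> Kron CARD('a) CARD('b) CARD('c)" "triple_scale N t = triple_add s u"
proof -
  let ?K = "Kron CARD('a) CARD('b) CARD('c)"
  define v :: "triple \<Rightarrow> (real, 'a) vec \<times> (real, 'b) vec \<times> (real, 'c) vec" where "v = triple_vec"
  have v: "v ([], [], []) = 0" "v (triple_add s t) = v s + v t" "v (triple_scale k t) = real k *\<^sub>R v t" for s t k
    by (simp_all add: v_def triple_vec_empty triple_vec_add triple_vec_scale)
  obtain S c where S: "finite S" "S \<subseteq> ?K" "\<And>u. u \<in> S \<Longrightarrow> 0 \<le> c u"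
      and sum: "v t - \<epsilon> *\<^sub>R v s = (\<Sum>u\<in>S. c u *\<^sub>R v u)"
    using cone_combination[OF mem[unfolded PKron_def]] unfolding v_def by blast
  obtain h where h: "bij_betw h {0..<card S} S"
    using ex_bij_betw_nat_finite[OF S(1)] by blast
  define n where "n = card S"
  define \<theta> where "\<theta> i = (if i < n then c (h i) else \<epsilon>)" for i
  define w where "w i = (if i < n then v (h i) else v s)" for i
  have hS: "h i \<in> S" if "i < n" for i
    using h that by (auto simp: bij_betw_def n_def)
  have \<theta>0: "0 \<le> \<theta> i" for i
    using S(3)[OF hS] \<epsilon> by (simp add: \<theta>_def)
  have "(\<Sum>i<n. \<theta> i *\<^sub>R w i) = (\<Sum>u\<in>S. c u *\<^sub>R v u)"
    using sum.reindex_bij_betw[OF h, of "\<lambda>u. c u *\<^sub>R v u"] by (simp add: \<theta>_def w_def n_def atLeast0LessThan)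
  then have vt: "v t = (\<Sum>i<Suc n. \<theta> i *\<^sub>R w i)"
    using sum by (simp add: \<theta>_def w_def algebra_simps)
  define B where "B = (\<Sum>i<Suc n. norm (w i))"
  \<comment> \<open>The bound \<open>B\<close> keeps the rounding error shorter than 1, the bound \<open>1 / \<epsilon>\<close> keeps the multiplicity of \<open>s\<close> positive.\<close>
  obtain M :: nat where M: "max (B + 1) (1 / \<epsilon>) < real M"
    using reals_Archimedean2 by blast
  have B0: "B \<ge> 0"
    by (simp add: B_def sum_nonneg)
  then have M0: "M > 0" "B < real M"
    using M by (auto simp: max_less_iff_conj intro: gr0I)
  have M\<epsilon>: "1 / real M < \<epsilon>"
    using M M0 \<epsilon> by (simp add: field_simps)
  obtain q p where q: "0 < q" and p: "\<And>i. i < Suc n \<Longrightarrow> \<bar>of_int q * \<theta> i - of_int (p i)\<bar> < 1 / real M"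
    using Dirichlet_approx_simult[OF M0(1), of "Suc n" \<theta>] by blast
  have M1: "1 / real M \<le> 1"
    using M0 by simp
  have p0: "0 \<le> p i" if "i < Suc n" for i
  proof -
    have "0 \<le> of_int q * \<theta> i"
      using q \<theta>0 by simp
    then have "- 1 < real_of_int (p i)"
      using p[OF that] M1 by linarith
    then show ?thesis by linarith
  qed
  \<comment> \<open>One copy of \<open>s\<close> is split off below; the remaining \<open>p n - 1\<close> copies go into \<open>u\<close>.\<close>
  have pn: "1 \<le> p n"
  proof -
    have "\<epsilon> \<le> of_int q * \<epsilon>"
      using q \<epsilon> by simp
    then have "0 < real_of_int (p n)"
      using p[of n] M\<epsilon> by (simp add: \<theta>_def)
    then show ?thesis by linarith
  qed
  define d where "d = of_int q *\<^sub>R v t - (\<Sum>i<Suc n. of_int (p i) *\<^sub>R w i)"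
  have "integral_vec (w i)" for i
    by (simp add: w_def v_def integral_vec_triple)
  then have "integral_vec d"
    unfolding d_def v_def by (intro integral_vec_combine integral_vec_sum integral_vec_triple)
  moreover have "norm d < 1"
  proof -
    have "d = (\<Sum>i<Suc n. (of_int q * \<theta> i - of_int (p i)) *\<^sub>R w i)"
      unfolding d_def vt by (simp add: scaleR_sum_right scaleR_left_diff_distrib sum_subtractf del: sum.lessThan_Suc)
    then have "norm d \<le> (\<Sum>i<Suc n. norm ((of_int q * \<theta> i - of_int (p i)) *\<^sub>R w i))"
      by (simp only: norm_sum)
    also have "\<dots> \<le> (\<Sum>i<Suc n. 1 / real M * norm (w i))"
    proof (rule sum_mono)
      fix i assume "i \<in> {..<Suc n}"
      then have "\<bar>of_int q * \<theta> i - of_int (p i)\<bar> \<le> 1 / real M"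
        using p[of i] by simp
      then show "norm ((of_int q * \<theta> i - of_int (p i)) *\<^sub>R w i) \<le> 1 / real M * norm (w i)"
        unfolding norm_scaleR by (rule mult_right_mono) simp
    qed
    also have "\<dots> = B / real M"
      by (simp only: B_def sum_distrib_left[symmetric]) simp
    also have "\<dots> < 1"
      using M0 by simp
    finally show ?thesis .
  qed
  ultimately have "d = 0"
    by (rule integral_vec_small)
  then have eq: "of_int q *\<^sub>R v t = (\<Sum>i<n. of_int (p i) *\<^sub>R v (h i)) + of_int (p n) *\<^sub>R v s"
    by (simp add: d_def w_def)
  define k where "k u = nat (p (inv_into {0..<card S} h u))" for u
  have "(\<Sum>i<n. of_int (p i) *\<^sub>R v (h i)) = (\<Sum>u\<in>S. real (k u) *\<^sub>R v u)"
  proof -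
    have "(\<Sum>u\<in>S. real (k u) *\<^sub>R v u) = (\<Sum>i\<in>{0..<card S}. real (k (h i)) *\<^sub>R v (h i))"
      by (rule sum.reindex_bij_betw[OF h, symmetric])
    also have "\<dots> = (\<Sum>i<n. of_int (p i) *\<^sub>R v (h i))"
    proof (rule sum.cong)
      fix i assume "i \<in> {..<n}"
      then have "inv_into {0..<card S} h (h i) = i"
        using h by (intro inv_into_f_f) (auto simp: bij_betw_def n_def)
      then have "real (k (h i)) = of_int (p i)"
        using p0[of i] \<open>i \<in> {..<n}\<close> by (simp add: k_def)
      then show "real (k (h i)) *\<^sub>R v (h i) = of_int (p i) *\<^sub>R v (h i)"
        by simp
    qed (simp add: n_def atLeast0LessThan)
    finally show ?thesis by simp
  qed
  moreover obtain u0 where u0: "u0 \<in> ?K" "v u0 = (\<Sum>u\<in>S. real (k u) *\<^sub>R v u)"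
    using Kron_nat_combination[OF v S(1,2), of k] by blast
  moreover obtain u1 where u1: "u1 \<in> ?K" "v u1 = (\<Sum>u\<in>{s}. real (nat (p n - 1)) *\<^sub>R v u)"
    using Kron_nat_combination[OF v, of "{s}" _ _ _ "\<lambda>_. nat (p n - 1)"] s by blast
  ultimately have "v (triple_scale (nat q) t) = v (triple_add s (triple_add u0 u1))"
    using eq q pn by (simp add: v_def triple_vec_scale triple_vec_add algebra_simps of_nat_nat)
  moreover have "triple_scale (nat q) t \<in> ?K" "triple_add s (triple_add u0 u1) \<in> ?K"
    using t s u0 u1 q by (auto intro: Kron_scale Kron_add)
  ultimately have "triple_scale (nat q) t = triple_add s (triple_add u0 u1)"
    unfolding v_def by (intro triple_vec_inj)
  then show ?thesis
    using that[of "nat q" "triple_add u0 u1"] u0 u1 q by (simp add: Kron_add)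
qed

text \<open>The smallest face of a convex cone \<open>C\<close> through the point \<open>x\<close> of \<open>C\<close>.\<close>

definition cone_face :: "'v::real_vector set \<Rightarrow> 'v \<Rightarrow> 'v set" where
  "cone_face C x = {y \<in> C. \<exists>\<epsilon>>0. x - \<epsilon> *\<^sub>R y \<in> C}"

lemma cone_face_face:
  assumes C: "convex_cone C" and x: "x \<in> C"
  shows "cone_face C x face_of C"
  unfolding face_of_def
proof (intro conjI ballI impI)
  note add = convex_cone_add[OF C] and scale = convex_cone_scaleR[OF C]
  have shrink: "x - \<delta> *\<^sub>R y \<in> C" if "x - \<epsilon> *\<^sub>R y \<in> C" "0 < \<delta>" "\<delta> \<le> \<epsilon>" for y \<epsilon> \<delta>
  proof -
    have "x - \<delta> *\<^sub>R y = (1 - \<delta> / \<epsilon>) *\<^sub>R x + (\<delta> / \<epsilon>) *\<^sub>R (x - \<epsilon> *\<^sub>R y)"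
      using that by (simp add: algebra_simps)
    then show ?thesis
      using that x by (auto intro!: add scale)
  qed
  show "cone_face C x \<subseteq> C"
    by (auto simp: cone_face_def)
  show "convex (cone_face C x)"
    unfolding convex_def
  proof (intro ballI allI impI)
    fix y z and u v :: real assume yz: "y \<in> cone_face C x" "z \<in> cone_face C x" and uv: "0 \<le> u" "0 \<le> v" "u + v = 1"
    obtain \<delta> \<epsilon> where \<delta>: "\<delta> > 0" "x - \<delta> *\<^sub>R y \<in> C" and \<epsilon>: "\<epsilon> > 0" "x - \<epsilon> *\<^sub>R z \<in> C"
      using yz by (auto simp: cone_face_def)
    define \<mu> where "\<mu> = min \<delta> \<epsilon>"
    have \<mu>: "\<mu> > 0" "x - \<mu> *\<^sub>R y \<in> C" "x - \<mu> *\<^sub>R z \<in> C"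
      using \<delta> \<epsilon> by (auto simp: \<mu>_def intro: shrink)
    have "x - \<mu> *\<^sub>R (u *\<^sub>R y + v *\<^sub>R z) = u *\<^sub>R (x - \<mu> *\<^sub>R y) + v *\<^sub>R (x - \<mu> *\<^sub>R z)"
      using scaleR_left_distrib[of u v x] uv(3) by (simp add: algebra_simps)
    also have "\<dots> \<in> C"
      using \<mu> uv by (intro add scale)
    finally show "u *\<^sub>R y + v *\<^sub>R z \<in> cone_face C x"
      using yz uv \<mu>(1) by (auto simp: cone_face_def intro!: add scale)
  qed
  fix a b y assume ab: "a \<in> C" "b \<in> C" and y: "y \<in> cone_face C x" "y \<in> open_segment a b"
  obtain \<epsilon> where \<epsilon>: "\<epsilon> > 0" "x - \<epsilon> *\<^sub>R y \<in> C"
    using y by (auto simp: cone_face_def)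
  obtain u where u: "0 < u" "u < 1" "y = (1 - u) *\<^sub>R a + u *\<^sub>R b"
    using y(2) by (auto simp: in_segment)
  have "x - (\<epsilon> * (1 - u)) *\<^sub>R a = (x - \<epsilon> *\<^sub>R y) + (\<epsilon> * u) *\<^sub>R b"
    by (simp add: u(3) algebra_simps)
  also have "\<dots> \<in> C"
    using \<epsilon> u ab by (intro add scale) auto
  finally show "a \<in> cone_face C x"
    using ab \<epsilon> u by (auto simp: cone_face_def intro!: exI[of _ "\<epsilon> * (1 - u)"])
  have "x - (\<epsilon> * u) *\<^sub>R b = (x - \<epsilon> *\<^sub>R y) + (\<epsilon> * (1 - u)) *\<^sub>R a"
    by (simp add: u(3) algebra_simps)
  also have "\<dots> \<in> C"
    using \<epsilon> u ab by (intro add scale) auto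
  finally show "b \<in> cone_face C x"
    using ab \<epsilon> u by (auto simp: cone_face_def intro!: exI[of _ "\<epsilon> * u"])
qed

text \<open>Monotonicity bounds the coefficient of \<open>k s\<close> by that of \<open>k s + k u\<close>, which is a multiple of \<open>t\<close>.\<close>

lemma weakly_stable_summand:
  assumes t: "weakly_stable t" and s: "s \<in> Kron a b c" and u: "u \<in> Kron a b c"
    and N: "N \<ge> 1" "triple_scale N t = triple_add s u"
  shows "weakly_stable s"
  unfolding weakly_stable_iff
proof (intro allI impI)
  fix k :: nat assume k: "k \<ge> 1"
  have ks: "triple_scale k s \<in> Kron a b c" and ku: "triple_scale k u \<in> Kron a b c"
    using Kron_scale[OF s k] Kron_scale[OF u k] .
  have "kron (triple_scale k s) \<le> kron (triple_add (triple_scale k s) (triple_scale k u))"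
    by (rule kron_le_add[OF ks ku])
  also have "\<dots> = kron (triple_scale (k * N) t)"
    by (simp add: triple_scale_add[symmetric] N(2)[symmetric] triple_scale_scale)
  also have "\<dots> = 1"
    using t k N(1) by (simp add: weakly_stable_iff)
  finally have "kron (triple_scale k s) \<le> 1" .
  moreover have "kron (triple_scale k s) \<noteq> 0"
    using ks by (cases "triple_scale k s") (simp add: Kron_def kron_def)
  ultimately show "kron (triple_scale k s) = 1"
    by simp
qed

theorem proposition2:
  shows "\<exists>\<F> :: ((real ^ ('a :: {finite, linorder})) \<times> (real ^ ('b :: {finite, linorder})) \<times>
      (real ^ ('c :: {finite, linorder}))) set set.
    (\<forall>F\<in>\<F>. F face_of PKron) \<and>
    SKron CARD('a) CARD('b) CARD('c) =
      {t \<in> Kron CARD('a) CARD('b) CARD('c). triple_vec t \<in> \<Union>\<F>}"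
proof -
  let ?K = "Kron CARD('a) CARD('b) CARD('c)" and ?S = "SKron CARD('a) CARD('b) CARD('c)"
  let ?C = "PKron :: ((real, 'a) vec \<times> (real, 'b) vec \<times> (real, 'c) vec) set"
  let ?F = "\<lambda>t. cone_face ?C (triple_vec t)"
  have cone: "convex_cone ?C"
    unfolding PKron_def by (rule convex_cone_convex_cone_hull)
  have vec: "triple_vec t \<in> ?C" if "t \<in> ?K" for t
    unfolding PKron_def using that by (intro hull_inc imageI)
  have sub: "t \<in> ?K" "weakly_stable t" if "t \<in> ?S" for t
    using that by (simp_all add: SKron_def)
  have "\<forall>F\<in>?F ` ?S. F face_of ?C"
    using cone_face_face[OF cone] vec sub by blast
  moreover have "?S = {t \<in> ?K. triple_vec t \<in> \<Union>(?F ` ?S)}"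
  proof (intro subset_antisym subsetI)
    fix t assume t: "t \<in> ?S"
    have "triple_vec t - 1 *\<^sub>R triple_vec t \<in> ?C"
      using convex_cone_contains_0[OF cone] by simp
    then have "triple_vec t \<in> ?F t"
      unfolding cone_face_def using vec sub[OF t] zero_less_one by blast
    then show "t \<in> {t \<in> ?K. triple_vec t \<in> \<Union>(?F ` ?S)}"
      using t sub by blast
  next
    fix s assume "s \<in> {t \<in> ?K. triple_vec t \<in> \<Union>(?F ` ?S)}"
    then obtain t where s: "s \<in> ?K" and t: "t \<in> ?S" "triple_vec s \<in> ?F t"
      by blast
    obtain \<epsilon> where \<epsilon>: "\<epsilon> > 0" "triple_vec t - \<epsilon> *\<^sub>R triple_vec s \<in> ?C"
      using t(2) unfolding cone_face_def by blast
    obtain N u where "N \<ge> 1" "u \<in> ?K" "triple_scale N t = triple_add s u"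
      using Kron_multiple_dominates[OF \<epsilon>(2,1) sub(1)[OF t(1)] s] .
    then have "weakly_stable s"
      using weakly_stable_summand[OF sub(2)[OF t(1)] s] by blast
    then show "s \<in> ?S"
      using s by (simp add: SKron_def)
  qed
  ultimately show ?thesis
    by blast
qed

end
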